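(* There is an algorithm which, given a finite nonempty set $A\subseteq\mathbb{Z}$, decides whether both conditions $(T_1)$ and $(T_2)$ hold for $A$, and which runs in time polynomial in $D=\operatorname{diam}(A)=\max A-\min A$. Consequently, when $|A|$ has at most two distinct prime factors, this algorithm decides whether $A$ tiles $\mathbb{Z}$ by translation.
   Context: $A$ tiles $\mathbb{Z}$ by translation if there is $B\subseteq\mathbb{Z}$ such that every $g\in\mathbb{Z}$ has a unique representation $g=a+b$ with $a\in A$, $b\in B$. Normalization: all notions involved are invariant under translating $A$, so $A$ is taken to consist of nonnegative integers with $0\in A$; the input is presented as a set $A\subseteq\{0,1,\dots,D\}$ (e.g. as a list of its elements). Put $A(X)=\sum_{a\in A}X^a$. Let $\Phi_n(X)$ be the $n$-th cyclotomic polynomial. Let $S_A$ be the set of prime powers $p^a$ ($p$ prime, $a\ge 1$) such that $\Phi_{p^a}(X)\mid A(X)$. The Coven–Meyerowitz conditions are: $(T_1)$ $A(1)=\prod_{s\in S_A}\Phi_s(1)$; $(T_2)$ if $s_1,\dots,s_m\in S_A$ are powers of distinct primes then $\Phi_{s_1\cdots s_m}(X)\mid A(X)$. *)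

theory Defs
  imports
    Complex_Main
    "HOL-Library.Log_Nat"
    "HOL-Computational_Algebra.Computational_Algebra"
begin

section \<open>Tilings and the Coven--Meyerowitz conditions\<close>

definition tiles_int :: "int set \<Rightarrow> bool" where
  "tiles_int A \<longleftrightarrow> (\<exists>B :: int set. \<forall>g. \<exists>!ab. ab \<in> A \<times> B \<and> g = fst ab + snd ab)"

definition diam :: "int set \<Rightarrow> nat" where
  "diam A = nat (Max A - Min A)"

definition normalized :: "int set \<Rightarrow> int set" where
  "normalized A = (\<lambda>a. a - Min A) ` A"

text \<open>
  Polynomials are taken over the complex numbers.  Cyclotomic polynomials are monic with integer
  coefficients, so divisibility of an integer polynomial by one of them means the same over
  \<open>\<int>\<close>, \<open>\<rat>\<close> and \<open>\<complex>\<close>.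
\<close>

definition cyclotomic :: "nat \<Rightarrow> complex poly" where
  "cyclotomic n = (\<Prod>k | k \<in> {1..n} \<and> coprime k n. [:- cis (2 * pi * real k / real n), 1:])"

definition mask_poly :: "int set \<Rightarrow> complex poly" where
  "mask_poly A = (\<Sum>a\<in>normalized A. monom 1 (nat a))"

definition S_set :: "int set \<Rightarrow> nat set" where
  "S_set A = {s. (\<exists>p a. prime p \<and> 1 \<le> a \<and> s = p ^ a) \<and> cyclotomic s dvd mask_poly A}"

definition T1 :: "int set \<Rightarrow> bool" where
  "T1 A \<longleftrightarrow> poly (mask_poly A) 1 = (\<Prod>s\<in>S_set A. poly (cyclotomic s) 1)"

text \<open>
  In \<open>T2\<close>, \<open>P\<close> is the (nonempty) set of the distinct primes and \<open>e p\<close> the exponent of \<open>p\<close>.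
\<close>

definition T2 :: "int set \<Rightarrow> bool" where
  "T2 A \<longleftrightarrow> (\<forall>(P :: nat set) (e :: nat \<Rightarrow> nat).
     finite P \<longrightarrow> P \<noteq> {} \<longrightarrow> (\<forall>p\<in>P. prime p \<and> 1 \<le> e p \<and> p ^ e p \<in> S_set A) \<longrightarrow>
     cyclotomic (\<Prod>p\<in>P. p ^ e p) dvd mask_poly A)"

text \<open>The product in \<open>T1\<close> is a genuine one: its index set is finite.\<close>

lemma finite_S_set:
  assumes "finite A" "A \<noteq> {}"
  shows "finite (S_set A)"
proof -
  let ?N = "normalized A"
  have fin: "finite ?N" using assms by (simp add: normalized_def)
  have nonneg: "a \<ge> 0" if "a \<in> ?N" for a
    using that assms by (auto simp: normalized_def)
  have zero: "0 \<in> ?N" using Min_in[OF assms] by (force simp: normalized_def)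
  have "coeff (mask_poly A) 0 = (\<Sum>a\<in>?N. if a = 0 then 1 else 0)"
    unfolding mask_poly_def coeff_sum using nonneg by (intro sum.cong) force+
  also have "\<dots> = 1" using fin zero by (simp add: sum.delta)
  finally have nz: "mask_poly A \<noteq> 0" by auto
  let ?f = "\<lambda>s :: nat. cis (2 * pi / real s)"
  have "?f ` S_set A \<subseteq> {z. poly (mask_poly A) z = 0}"
  proof safe
    fix s assume s: "s \<in> S_set A"
    then have "s \<ge> 1" by (auto simp: S_set_def Suc_le_eq prime_gt_0_nat)
    then have "[:- ?f s, 1:] dvd cyclotomic s"
      unfolding cyclotomic_def
      by (intro dvd_trans[OF _ dvd_prodI[where a = 1]]) auto
    also have "cyclotomic s dvd mask_poly A" using s by (simp add: S_set_def)
    finally show "poly (mask_poly A) (?f s) = 0" by (simp add: poly_eq_0_iff_dvd)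
  qed
  then have "finite (?f ` S_set A)"
    using poly_roots_finite[OF nz] finite_subset by blast
  moreover have "inj_on ?f (S_set A)"
  proof (rule inj_onI)
    fix s t assume st: "s \<in> S_set A" "t \<in> S_set A" "?f s = ?f t"
    have ge2: "u \<ge> 2" if "u \<in> S_set A" for u
    proof -
      from that obtain p a where pa: "prime p" "1 \<le> a" "u = p ^ a" by (auto simp: S_set_def)
      have "2 \<le> p" using pa by (simp add: prime_ge_2_nat)
      also have "p \<le> p ^ a" using pa by (simp add: self_le_power prime_gt_0_nat Suc_le_eq)
      finally show ?thesis using pa by simp
    qed
    have *: "0 \<le> 2 * pi / real u \<and> 2 * pi / real u \<le> pi" if "u \<in> S_set A" for u
      using ge2[OF that] by (simp add: field_simps)
    have "cos (2 * pi / real s) = cos (2 * pi / real t)"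
      using arg_cong[OF st(3), of Re] by simp
    then have "2 * pi / real s = 2 * pi / real t"
      using *[OF st(1)] *[OF st(2)] cos_inj_pi by blast
    then show "s = t" using ge2[OF st(1)] ge2[OF st(2)] by (simp add: field_simps)
  qed
  ultimately show ?thesis using finite_imageD by blast
qed


section \<open>Algorithms: random access machines with logarithmic cost\<close>

text \<open>
  The machine is that of Cook and Reckhow, presented with structured control flow.  It has
  integer registers, an integer memory addressed indirectly through registers, and addition and
  subtraction as its only arithmetic.  Every step is charged the bit lengths of the integers it
  handles, addresses included, so that running times agree with those of Turing machines up to
  a polynomial.
\<close>

datatype com =
    Const nat int
  | Add nat nat nat
  | Sub nat nat nat
  | Load nat nat
  | Store nat nat
  | Seq com com
  | IfPos nat com com
  | WhilePos nat com

type_synonym state = "(nat \<Rightarrow> int) \<times> (nat \<Rightarrow> int)"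

definition len :: "int \<Rightarrow> nat" where
  "len z = floorlog 2 (nat \<bar>z\<bar>)"

text \<open>
  \<open>exec c \<sigma> t \<sigma>'\<close>: started in \<open>\<sigma>\<close> (registers, memory), \<open>c\<close> halts in \<open>\<sigma>'\<close> at total cost \<open>t\<close>.
  Accessing a negative address is an error: there is no rule for it, so such a run does not halt
  in the sense of \<open>exec\<close>.
\<close>

inductive exec :: "com \<Rightarrow> state \<Rightarrow> nat \<Rightarrow> state \<Rightarrow> bool" where
  Const: "exec (Const r k) (R, M) (1 + len k) (R(r := k), M)"
| Add: "exec (Add r x y) (R, M) (1 + len (R x) + len (R y)) (R(r := R x + R y), M)"
| Sub: "exec (Sub r x y) (R, M) (1 + len (R x) + len (R y)) (R(r := R x - R y), M)"
| Load: "R x \<ge> 0 \<Longrightarrow>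
    exec (Load r x) (R, M) (1 + len (R x) + len (M (nat (R x)))) (R(r := M (nat (R x))), M)"
| Store: "R x \<ge> 0 \<Longrightarrow>
    exec (Store x y) (R, M) (1 + len (R x) + len (R y)) (R, M(nat (R x) := R y))"
| Seq: "exec c \<sigma> t \<sigma>' \<Longrightarrow> exec d \<sigma>' u \<sigma>'' \<Longrightarrow> exec (Seq c d) \<sigma> (t + u) \<sigma>''"
| IfPosT: "R x > 0 \<Longrightarrow> exec c (R, M) t \<sigma>' \<Longrightarrow>
    exec (IfPos x c d) (R, M) (1 + len (R x) + t) \<sigma>'"
| IfPosF: "R x \<le> 0 \<Longrightarrow> exec d (R, M) t \<sigma>' \<Longrightarrow>
    exec (IfPos x c d) (R, M) (1 + len (R x) + t) \<sigma>'"
| WhilePosF: "R x \<le> 0 \<Longrightarrow> exec (WhilePos x c) (R, M) (1 + len (R x)) (R, M)"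
| WhilePosT: "R x > 0 \<Longrightarrow> exec c (R, M) t \<sigma>' \<Longrightarrow> exec (WhilePos x c) \<sigma>' u \<sigma>'' \<Longrightarrow>
    exec (WhilePos x c) (R, M) (1 + len (R x) + t + u) \<sigma>''"

inductive_cases exec_elims:
  "exec (Const r k) \<sigma> t \<sigma>'"
  "exec (Add r x y) \<sigma> t \<sigma>'"
  "exec (Sub r x y) \<sigma> t \<sigma>'"
  "exec (Load r x) \<sigma> t \<sigma>'"
  "exec (Store x y) \<sigma> t \<sigma>'"

inductive_cases exec_SeqE: "exec (Seq c d) \<sigma> t \<sigma>'"
inductive_cases exec_IfPosE: "exec (IfPos x c d) (R, M) t \<sigma>'"
inductive_cases exec_WhilePosE: "exec (WhilePos x c) (R, M) t \<sigma>'"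

lemma exec_deterministic:
  "exec c \<sigma> t \<sigma>\<^sub>1 \<Longrightarrow> exec c \<sigma> u \<sigma>\<^sub>2 \<Longrightarrow> t = u \<and> \<sigma>\<^sub>1 = \<sigma>\<^sub>2"
proof (induction arbitrary: u \<sigma>\<^sub>2 rule: exec.induct)
  case (Seq c \<sigma> t \<sigma>' d v \<sigma>'')
  from Seq.prems obtain t' \<tau> v' where
    *: "u = t' + v'" "exec c \<sigma> t' \<tau>" "exec d \<tau> v' \<sigma>\<^sub>2"
    by (rule exec_SeqE)
  from Seq.IH(1)[OF *(2)] have "t = t'" "\<sigma>' = \<tau>" by simp_all
  with Seq.IH(2)[of v' \<sigma>\<^sub>2] * show ?case by simp
next
  case (IfPosT R x c M t \<sigma>' d)
  from IfPosT.prems IfPosT.hyps obtain t' where "u = 1 + len (R x) + t'" "exec c (R, M) t' \<sigma>\<^sub>2"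
    by (auto elim: exec_IfPosE)
  with IfPosT.IH show ?case by simp
next
  case (IfPosF R x d M t \<sigma>' c)
  from IfPosF.prems IfPosF.hyps obtain t' where "u = 1 + len (R x) + t'" "exec d (R, M) t' \<sigma>\<^sub>2"
    by (auto elim: exec_IfPosE)
  with IfPosF.IH show ?case by simp
next
  case (WhilePosF R x c M)
  with WhilePosF.prems show ?case by (auto elim: exec_WhilePosE)
next
  case (WhilePosT R x c M t \<sigma>' v \<sigma>'')
  from WhilePosT.prems WhilePosT.hyps obtain t' \<tau> v' where
    *: "u = 1 + len (R x) + t' + v'" "exec c (R, M) t' \<tau>" "exec (WhilePos x c) \<tau> v' \<sigma>\<^sub>2"
    by (auto elim: exec_WhilePosE)
  from WhilePosT.IH(1)[OF *(2)] have "t = t'" "\<sigma>' = \<tau>" by simp_all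
  with WhilePosT.IH(2)[of v' \<sigma>\<^sub>2] * show ?case by simp
qed (auto elim: exec_elims)

text \<open>
  The input list occupies memory cells \<open>0, 1, \<dots>\<close> and its length is in register \<open>0\<close>; every other
  register and cell is \<open>0\<close>.  The answer is read from register \<open>0\<close>.
\<close>

definition init :: "int list \<Rightarrow> state" where
  "init xs = ((\<lambda>_. 0)(0 := int (length xs)), \<lambda>i. if i < length xs then xs ! i else 0)"

definition halts_with :: "com \<Rightarrow> int list \<Rightarrow> nat \<Rightarrow> int \<Rightarrow> bool" where
  "halts_with c xs t v \<longleftrightarrow> (\<exists>R M. exec c (init xs) t (R, M) \<and> R 0 = v)"

text \<open>
  A set is presented by listing the elements of its normalization in any order, without
  repetition; the diameter itself is not part of the input.
\<close>

definition presents :: "int list \<Rightarrow> int set \<Rightarrow> bool" where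
  "presents xs A \<longleftrightarrow> distinct xs \<and> set xs = normalized A"

definition decides :: "com \<Rightarrow> int set set \<Rightarrow> (int set \<Rightarrow> bool) \<Rightarrow> bool" where
  "decides c \<A> Q \<longleftrightarrow>
     (\<forall>A\<in>\<A>. \<forall>xs. presents xs A \<longrightarrow> (\<exists>t. halts_with c xs t (if Q A then 1 else 0)))"

definition runs_in_time :: "com \<Rightarrow> int set set \<Rightarrow> (int set \<Rightarrow> nat) \<Rightarrow> bool" where
  "runs_in_time c \<A> f \<longleftrightarrow>
     (\<forall>A\<in>\<A>. \<forall>xs. presents xs A \<longrightarrow> (\<exists>t v. halts_with c xs t v \<and> t \<le> f A))"

end

theory Submission
  imports Defs "HOL-Number_Theory.Cong" "HOL-Number_Theory.Prime_Powers" "HOL-Number_Theory.Totient"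
begin

text \<open>
  \<open>T1 \<and> T2\<close> implies tiling because the Coven--Meyerowitz product of dilated cyclotomic polynomials is
  a complement modulo \<open>\<Prod>S\<^sub>A\<close>.  Conversely, a complement \<open>B\<close> of a finite tile is periodic, and
  Tijdeman's theorem (\<open>r A\<close> also tiles with \<open>B\<close> for \<open>r\<close> coprime to \<open>|A|\<close>, because
  \<open>A(X)\<^sup>p \<equiv> A(X\<^sup>p)\<close> modulo \<open>p\<close>) shows that each \<open>\<Phi>\<^sub>s\<close> with \<open>s\<close> a nontrivial divisor of the period
  divides \<open>A(X)\<close> or \<open>B(X)\<close>; comparing values at \<open>1\<close> gives \<open>T1\<close>.  For \<open>T2\<close> the same theorem removes
  from the period all primes not dividing \<open>|A|\<close>; if at most two primes are left then \<open>A\<close> or \<open>B\<close> lies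
  in a residue class modulo one of them (Sands), and one descends to a smaller period.

  The divisibility \<open>\<Phi>\<^sub>M | A\<close> means that \<open>\<Sum>|A(z)|\<^sup>2\<close> over the primitive \<open>M\<close>-th roots of unity is zero.
  By Moebius inversion this sum is \<open>\<Sum>\<^bsub>d e = M\<^esub> \<mu>(e) d N(d)\<close>, where \<open>N(d)\<close> counts the pairs of
  elements congruent modulo \<open>d\<close>.  Hence \<open>T1\<close> and \<open>T2\<close> are expressed by a fixed formula with
  polynomially bounded quantifiers and sums, which nested loops evaluate in polynomial time.  The
  bound on \<open>M\<close> in \<open>T2\<close> comes from a minimal failing product: under \<open>T1\<close> a proper subproduct is at
  most \<open>D |A|\<close>, since its cyclotomic polynomial divides \<open>A(X)\<close>, and the remaining factor at most \<open>2 D\<close>.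
\<close>


section \<open>Computing bounded arithmetic expressions in polynomial time\<close>

text \<open>A family of prime powers in T2 enters only through its product M, from which it can be
  recovered, so the test runs over integers M. A priori such a product has up to log |A| factors of
  size up to 2 D and need not be polynomially bounded; this is why a minimal failing product is
  considered. That bound is proved under T1, so the T2 test is shown equivalent to T2 only there,
  which suffices for deciding the conjunction. The computation contains no polynomial division and
  no cyclotomic coefficients: the energy is an integer formula in counts of congruent pairs, suited
  to a machine that only adds and subtracts. The program is not written out; closure lemmas generate
  it from the formula. In the descent for T2 the delicate case is that B, not A, lies in one class.
  Then A splits into classes that all tile with the same smaller complement, and vanishing at prime
  powers passes from A to each class through the complement, because a prime power dividing the
  period is taken by exactly one of the two sides.\<close>

text \<open>Logarithmic costs are only ever bounded through this: all values that occur are themselves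
  polynomially bounded.\<close>

lemma len_le: "int (len z) \<le> \<bar>z\<bar>"
proof -
  have "floorlog 2 n \<le> n" for n
    by (rule floorlog_leI) (auto simp: less_exp)
  from this[of "nat \<bar>z\<bar>"] show ?thesis unfolding len_def by linarith
qed

section \<open>Runs with a bound on the cost\<close>

text \<open>Costs are bounded from above rather than computed, so that bounds can be weakened to
  polynomials. Since \<open>exec\<close> is deterministic, exhibiting one run settles the
  outcome.\<close>

definition runs :: "com \<Rightarrow> state \<Rightarrow> nat \<Rightarrow> (state \<Rightarrow> bool) \<Rightarrow> bool" where
  "runs c \<sigma> T Q \<longleftrightarrow> (\<exists>t \<sigma>'. exec c \<sigma> t \<sigma>' \<and> t \<le> T \<and> Q \<sigma>')"

lemma runs_mono: "runs c \<sigma> T P \<Longrightarrow> T \<le> U \<Longrightarrow> (\<And>\<tau>. P \<tau> \<Longrightarrow> Q \<tau>) \<Longrightarrow> runs c \<sigma> U Q"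
  unfolding runs_def by (meson order.trans)

lemma runs_Seq:
  "runs c \<sigma> T P \<Longrightarrow> (\<And>\<tau>. P \<tau> \<Longrightarrow> runs d \<tau> U Q) \<Longrightarrow> runs (Seq c d) \<sigma> (T + U) Q"
  unfolding runs_def by (meson add_mono exec.Seq)

lemma runsI: "exec c \<sigma> t \<sigma>' \<Longrightarrow> t \<le> T \<Longrightarrow> Q \<sigma>' \<Longrightarrow> runs c \<sigma> T Q"
  unfolding runs_def by blast

lemma runs_Const: "Q (R(r := k), M) \<Longrightarrow> runs (Const r k) (R, M) (1 + nat \<bar>k\<bar>) Q"
  by (rule runsI[OF exec.Const]) (use len_le[of k] in auto)

lemma runs_Add:
  "Q (R(r := R x + R y), M) \<Longrightarrow> runs (Add r x y) (R, M) (1 + nat \<bar>R x\<bar> + nat \<bar>R y\<bar>) Q"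
  by (rule runsI[OF exec.Add]) (use len_le[of "R x"] len_le[of "R y"] in auto)

lemma runs_Sub:
  "Q (R(r := R x - R y), M) \<Longrightarrow> runs (Sub r x y) (R, M) (1 + nat \<bar>R x\<bar> + nat \<bar>R y\<bar>) Q"
  by (rule runsI[OF exec.Sub]) (use len_le[of "R x"] len_le[of "R y"] in auto)

lemma runs_Load:
  "R x \<ge> 0 \<Longrightarrow> Q (R(r := M (nat (R x))), M) \<Longrightarrow>
    runs (Load r x) (R, M) (1 + nat \<bar>R x\<bar> + nat \<bar>M (nat (R x))\<bar>) Q"
  by (rule runsI[OF exec.Load]) (use len_le[of "R x"] len_le[of "M (nat (R x))"] in auto)

lemma runs_IfPos:
  "(R x > 0 \<Longrightarrow> runs c (R, M) T Q) \<Longrightarrow> (R x \<le> 0 \<Longrightarrow> runs d (R, M) T Q) \<Longrightarrow>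
    runs (IfPos x c d) (R, M) (1 + nat \<bar>R x\<bar> + T) Q"
proof (cases "R x > 0")
  case True
  assume "R x > 0 \<Longrightarrow> runs c (R, M) T Q"
  then obtain t \<sigma>' where "exec c (R, M) t \<sigma>'" "t \<le> T" "Q \<sigma>'" using True unfolding runs_def by blast
  then show ?thesis unfolding runs_def using True len_le[of "R x"]
    by (intro exI[of _ "1 + len (R x) + t"] exI[of _ \<sigma>'] conjI exec.IfPosT) auto
next
  case False
  assume "R x \<le> 0 \<Longrightarrow> runs d (R, M) T Q"
  then obtain t \<sigma>' where "exec d (R, M) t \<sigma>'" "t \<le> T" "Q \<sigma>'" using False unfolding runs_def by force
  then show ?thesis unfolding runs_def using False len_le[of "R x"]
    by (intro exI[of _ "1 + len (R x) + t"] exI[of _ \<sigma>'] conjI exec.IfPosF) auto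
qed

lemma runs_Const_Seq:
  "runs c (R(r := k), M) T Q \<Longrightarrow> runs (Seq (Const r k) c) (R, M) (1 + nat \<bar>k\<bar> + T) Q"
  by (rule runs_Seq[OF runs_Const[where Q = "\<lambda>\<tau>. \<tau> = (R(r := k), M)"]]) auto

lemma runs_Add_Seq:
  "runs c (R(r := R x + R y), M) T Q \<Longrightarrow>
    runs (Seq (Add r x y) c) (R, M) (1 + nat \<bar>R x\<bar> + nat \<bar>R y\<bar> + T) Q"
  by (rule runs_Seq[OF runs_Add[where Q = "\<lambda>\<tau>. \<tau> = (R(r := R x + R y), M)"]]) auto

text \<open>The loop register counts down from \<open>N\<close>, and \<open>I k\<close> is the
  invariant after \<open>k\<close> rounds. For \<open>N \<le> 0\<close> no round takes place;
  \<open>Suc (nat N)\<close> pays for the failing test at the end.\<close>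

lemma runs_WhilePos:
  assumes step: "\<And>k R. k < nat N \<Longrightarrow> I k R \<Longrightarrow> runs c (R, M) T (\<lambda>(R', M'). M' = M \<and> I (Suc k) R')"
    and ctr: "\<And>k R. k \<le> nat N \<Longrightarrow> I k R \<Longrightarrow> R x = N - int k"
    and init: "I 0 R"
  shows "runs (WhilePos x c) (R, M) (Suc (nat N) * (1 + nat \<bar>N\<bar> + T)) (\<lambda>(R', M'). M' = M \<and> I (nat N) R')"
proof -
  define n where "n = nat N"
  have "runs (WhilePos x c) (R, M) (Suc (n - k) * (1 + nat \<bar>N\<bar> + T)) (\<lambda>(R', M'). M' = M \<and> I n R')"
    if "k \<le> n" "I k R" for k R
    using that
  proof (induction k arbitrary: R rule: inc_induct)
    case base
    have *: "R x = N - int n" using ctr[of n R] base by (simp add: n_def)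
    then have "R x \<le> 0" by (simp add: n_def)
    from exec.WhilePosF[of R x c M, OF this] show ?case
      by (rule runsI) (use base * len_le[of "R x"] in \<open>auto simp: n_def\<close>)
  next
    case (step k)
    have rx: "R x = N - int k" using ctr[of k R] step by (simp add: n_def)
    from assms(1)[of k R] step obtain t R' where
      *: "exec c (R, M) t (R', M)" "t \<le> T" "I (Suc k) R'" unfolding runs_def n_def by auto
    from step.IH[OF *(3)] obtain u R'' where
      **: "exec (WhilePos x c) (R', M) u (R'', M)" "u \<le> Suc (n - Suc k) * (1 + nat \<bar>N\<bar> + T)" "I n R''"
      unfolding runs_def by auto
    have "R x > 0" using rx step.hyps by (simp add: n_def)
    from exec.WhilePosT[OF this *(1) **(1)] show ?case
    proof (rule runsI)
      have "len (R x) \<le> nat \<bar>N\<bar>" using len_le[of "R x"] rx \<open>R x > 0\<close> by simp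
      moreover have "Suc (n - k) = Suc (Suc (n - Suc k))" using step.hyps by simp
      ultimately show "1 + len (R x) + t + u \<le> Suc (n - k) * (1 + nat \<bar>N\<bar> + T)"
        using *(2) **(2) by (simp only: mult_Suc)
    qed (use ** in auto)
  qed
  from this[of 0 R] init show ?thesis by (simp add: n_def)
qed

text \<open>In \<open>f e m\<close> the environment \<open>e\<close> lists the variables in de Bruijn order and \<open>m\<close> is the memory; \<open>\<rho>\<close>
  assigns registers to the variables, and \<open>d\<close> receives the result while the registers below it are
  preserved. The polynomial \<open>q\<close> bounds both the value and the running time. In \<open>comput\<close> it does not
  depend on the register allocation, which makes the notion closed under composition and loops.\<close>

definition computes :: "com \<Rightarrow> (nat \<Rightarrow> nat) \<Rightarrow> nat \<Rightarrow> nat poly \<Rightarrow> ((nat \<Rightarrow> int) \<Rightarrow> (nat \<Rightarrow> int) \<Rightarrow> int) \<Rightarrow> bool" where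
  "computes c \<rho> d q f \<longleftrightarrow> (\<forall>R M B. (\<forall>i. \<bar>R (\<rho> i)\<bar> \<le> int B) \<longrightarrow> (\<forall>i. \<bar>M i\<bar> \<le> int B) \<longrightarrow>
     \<bar>f (\<lambda>i. R (\<rho> i)) M\<bar> \<le> int (poly q B) \<and>
     runs c (R, M) (poly q B) (\<lambda>(R', M'). M' = M \<and> R' d = f (\<lambda>i. R (\<rho> i)) M \<and> (\<forall>r<d. R' r = R r)))"

definition comput :: "((nat \<Rightarrow> int) \<Rightarrow> (nat \<Rightarrow> int) \<Rightarrow> int) \<Rightarrow> bool" where
  "comput f \<longleftrightarrow> (\<exists>q. \<forall>\<rho> d. (\<forall>i. \<rho> i < d) \<longrightarrow> (\<exists>c. computes c \<rho> d q f))"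

lemma computI:
  assumes "\<And>\<rho> d R M B. (\<And>i. \<rho> i < d) \<Longrightarrow> (\<And>i. \<bar>R (\<rho> i)\<bar> \<le> int B) \<Longrightarrow> (\<And>i. \<bar>M i\<bar> \<le> int B) \<Longrightarrow>
     \<bar>f (\<lambda>i. R (\<rho> i)) M\<bar> \<le> int (poly q B) \<and>
     runs (c \<rho> d) (R, M) (poly q B) (\<lambda>(R', M'). M' = M \<and> R' d = f (\<lambda>i. R (\<rho> i)) M \<and> (\<forall>r<d. R' r = R r))"
  shows "comput f"
  unfolding comput_def computes_def using assms by meson

lemma computesD:
  assumes "computes c \<rho> d q f" "\<forall>i. \<bar>R (\<rho> i)\<bar> \<le> int B" "\<forall>i. \<bar>M i\<bar> \<le> int B"
  shows "\<bar>f (\<lambda>i. R (\<rho> i)) M\<bar> \<le> int (poly q B)"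
    "runs c (R, M) (poly q B) (\<lambda>(R', M'). M' = M \<and> R' d = f (\<lambda>i. R (\<rho> i)) M \<and> (\<forall>r<d. R' r = R r))"
  using assms unfolding computes_def by blast+

section \<open>Elementary operations, binding and loops\<close>

lemma comput_const: "comput (\<lambda>e m. k)"
proof (rule computI[where q = "[:1 + nat \<bar>k\<bar>:]" and c = "\<lambda>\<rho> d. Const d k"], intro conjI)
  fix \<rho> :: "nat \<Rightarrow> nat" and d and R M :: "nat \<Rightarrow> int" and B
  show "runs (Const d k) (R, M) (poly [:1 + nat \<bar>k\<bar>:] B) (\<lambda>(R', M'). M' = M \<and> R' d = k \<and> (\<forall>r<d. R' r = R r))"
    by (rule runs_mono[OF runs_Const[where Q = "\<lambda>\<tau>. \<tau> = (R(d := k), M)"]]) auto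
qed auto

lemma comput_add_var: "comput (\<lambda>e m. e j + e k)"
proof (rule computI[where q = "[:1, 2:]" and c = "\<lambda>\<rho> d. Add d (\<rho> j) (\<rho> k)"])
  fix \<rho> :: "nat \<Rightarrow> nat" and d and R M :: "nat \<Rightarrow> int" and B
  assume "\<And>i. \<bar>R (\<rho> i)\<bar> \<le> int B"
  from this[of j] this[of k]
  show "\<bar>R (\<rho> j) + R (\<rho> k)\<bar> \<le> int (poly [:1, 2:] B) \<and>
    runs (Add d (\<rho> j) (\<rho> k)) (R, M) (poly [:1, 2:] B)
      (\<lambda>(R', M'). M' = M \<and> R' d = R (\<rho> j) + R (\<rho> k) \<and> (\<forall>r<d. R' r = R r))"
    by (intro conjI runs_mono[OF runs_Add[where Q = "\<lambda>\<tau>. \<tau> = (R(d := R (\<rho> j) + R (\<rho> k)), M)"]]) auto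
qed

lemma comput_diff_var: "comput (\<lambda>e m. e j - e k)"
proof (rule computI[where q = "[:1, 2:]" and c = "\<lambda>\<rho> d. Sub d (\<rho> j) (\<rho> k)"])
  fix \<rho> :: "nat \<Rightarrow> nat" and d and R M :: "nat \<Rightarrow> int" and B
  assume "\<And>i. \<bar>R (\<rho> i)\<bar> \<le> int B"
  from this[of j] this[of k]
  show "\<bar>R (\<rho> j) - R (\<rho> k)\<bar> \<le> int (poly [:1, 2:] B) \<and>
    runs (Sub d (\<rho> j) (\<rho> k)) (R, M) (poly [:1, 2:] B)
      (\<lambda>(R', M'). M' = M \<and> R' d = R (\<rho> j) - R (\<rho> k) \<and> (\<forall>r<d. R' r = R r))"
    by (intro conjI runs_mono[OF runs_Sub[where Q = "\<lambda>\<tau>. \<tau> = (R(d := R (\<rho> j) - R (\<rho> k)), M)"]]) auto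
qed

lemma comput_pos_var: "comput (\<lambda>e m. of_bool (0 < e k))"
proof (rule computI[where q = "[:3, 1:]" and c = "\<lambda>\<rho> d. IfPos (\<rho> k) (Const d 1) (Const d 0)"])
  fix \<rho> :: "nat \<Rightarrow> nat" and d and R M :: "nat \<Rightarrow> int" and B
  assume *: "\<And>i. \<bar>R (\<rho> i)\<bar> \<le> int B"
  have "runs (IfPos (\<rho> k) (Const d 1) (Const d 0)) (R, M) (1 + nat \<bar>R (\<rho> k)\<bar> + 2)
      (\<lambda>\<tau>. \<tau> = (R(d := of_bool (0 < R (\<rho> k))), M))"
    by (rule runs_IfPos; rule runs_mono[OF runs_Const[where Q = "\<lambda>\<tau>. \<tau> = (R(d := of_bool (0 < R (\<rho> k))), M)"]]) auto
  from runs_mono[OF this, of "poly [:3, 1:] B"] *[of k]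
  show "\<bar>of_bool (0 < R (\<rho> k)) :: int\<bar> \<le> int (poly [:3, 1:] B) \<and>
    runs (IfPos (\<rho> k) (Const d 1) (Const d 0)) (R, M) (poly [:3, 1:] B)
      (\<lambda>(R', M'). M' = M \<and> R' d = of_bool (0 < R (\<rho> k)) \<and> (\<forall>r<d. R' r = R r))"
    by auto
qed

text \<open>\<open>exec\<close> is stuck on a negative address, whereas \<open>nat\<close> turns it
  into 0. All nonpositive addresses are therefore sent to a branch that loads cell 0.\<close>

lemma comput_mem_var: "comput (\<lambda>e m. m (nat (e k)))"
proof (rule computI[where q = "[:4, 3:]" and
      c = "\<lambda>\<rho> d. IfPos (\<rho> k) (Load d (\<rho> k)) (Seq (Const d 0) (Load d d))"])
  fix \<rho> :: "nat \<Rightarrow> nat" and d and R M :: "nat \<Rightarrow> int" and B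
  assume *: "\<And>i. \<bar>R (\<rho> i)\<bar> \<le> int B" and M: "\<And>i. \<bar>M i\<bar> \<le> int B"
  let ?v = "M (nat (R (\<rho> k)))"
  have "runs (IfPos (\<rho> k) (Load d (\<rho> k)) (Seq (Const d 0) (Load d d))) (R, M)
      (1 + nat \<bar>R (\<rho> k)\<bar> + (2 + B + B)) (\<lambda>\<tau>. \<tau> = (R(d := ?v), M))"
  proof (rule runs_IfPos)
    assume "0 < R (\<rho> k)"
    then show "runs (Load d (\<rho> k)) (R, M) (2 + B + B) (\<lambda>\<tau>. \<tau> = (R(d := ?v), M))"
      using *[of k] M[of "nat (R (\<rho> k))"]
      by (intro runs_mono[OF runs_Load[where Q = "\<lambda>\<tau>. \<tau> = (R(d := ?v), M)"]]) auto
  next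
    assume "R (\<rho> k) \<le> 0"
    then show "runs (Seq (Const d 0) (Load d d)) (R, M) (2 + B + B) (\<lambda>\<tau>. \<tau> = (R(d := ?v), M))"
      using M[of "nat (R (\<rho> k))"]
      by (intro runs_mono[OF runs_Const_Seq[OF runs_Load[where Q = "\<lambda>\<tau>. \<tau> = (R(d := ?v), M)"]]]) auto
  qed
  from runs_mono[OF this, of "poly [:4, 3:] B"] *[of k] M[of "nat (R (\<rho> k))"]
  show "\<bar>?v\<bar> \<le> int (poly [:4, 3:] B) \<and>
    runs (IfPos (\<rho> k) (Load d (\<rho> k)) (Seq (Const d 0) (Load d d))) (R, M) (poly [:4, 3:] B)
      (\<lambda>(R', M'). M' = M \<and> R' d = ?v \<and> (\<forall>r<d. R' r = R r))"
    by auto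
qed

text \<open>No code is added: renaming variables only changes the register allocation, over which
  \<open>comput\<close> quantifies. This provides weakening under binders.\<close>

lemma comput_rename: 
  assumes "comput f"
  shows "comput (\<lambda>e m. f (\<lambda>i. e (h i)) m)"
proof -
  obtain q where q: "\<And>\<rho> d. (\<And>i. \<rho> i < d) \<Longrightarrow> \<exists>c. computes c \<rho> d q f"
    using assms unfolding comput_def by blast
  have "\<exists>c. computes c \<rho> d q (\<lambda>e m. f (\<lambda>i. e (h i)) m)" if \<rho>: "\<And>i. \<rho> i < d" for \<rho> d
  proof -
    obtain c where "computes c (\<lambda>i. \<rho> (h i)) d q f" using q[of "\<lambda>i. \<rho> (h i)" d] \<rho> by blast
    then show ?thesis unfolding computes_def by blast
  qed
  then show ?thesis unfolding comput_def by blast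
qed

text \<open>A let-binding, the basis of all composition: the value of \<open>f\<close> stays in
  register \<open>d\<close> as the new variable 0, \<open>g\<close> leaves its result in
  \<open>d + 1\<close>, and this is copied down to \<open>d\<close>. The bounds compose because
  \<open>g\<close> runs on data bounded by \<open>B + poly qf B\<close>.\<close>

lemma comput_bind:
  assumes f: "comput f" and g: "comput g"
  shows "comput (\<lambda>e m. g (case_nat (f e m) e) m)"
proof -
  obtain qf where qf: "\<And>\<rho> d. (\<And>i. \<rho> i < d) \<Longrightarrow> \<exists>c. computes c \<rho> d qf f"
    using f unfolding comput_def by blast
  obtain qg where qg: "\<And>\<rho> d. (\<And>i. \<rho> i < d) \<Longrightarrow> \<exists>c. computes c \<rho> d qg g"
    using g unfolding comput_def by blast
  let ?q' = "pcompose qg ([:0, 1:] + qf)"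
  let ?q = "qf + 2 * ?q' + 2"
  have "\<exists>c. computes c \<rho> d ?q (\<lambda>e m. g (case_nat (f e m) e) m)" if \<rho>: "\<And>i. \<rho> i < d" for \<rho> d
  proof -
    obtain cf where cf: "computes cf \<rho> d qf f" using qf \<rho> by blast
    have "case_nat d \<rho> i < Suc d" for i using \<rho> by (auto split: nat.split intro: less_SucI)
    then obtain cg where cg: "computes cg (case_nat d \<rho>) (Suc d) qg g"
      using qg[of "case_nat d \<rho>" "Suc d"] by blast
    have "computes (Seq cf (Seq cg (Seq (Const d 0) (Add d d (Suc d))))) \<rho> d ?q (\<lambda>e m. g (case_nat (f e m) e) m)"
      unfolding computes_def
    proof (intro allI impI)
      fix R M :: "nat \<Rightarrow> int" and B
      assume RB: "\<forall>i. \<bar>R (\<rho> i)\<bar> \<le> int B" and MB: "\<forall>i. \<bar>M i\<bar> \<le> int B"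
      let ?v = "f (\<lambda>i. R (\<rho> i)) M"
      let ?w = "g (case_nat ?v (\<lambda>i. R (\<rho> i))) M"
      let ?B = "B + poly qf B"
      have fB: "\<bar>?v\<bar> \<le> int (poly qf B)" and
        fr: "runs cf (R, M) (poly qf B) (\<lambda>(R', M'). M' = M \<and> R' d = ?v \<and> (\<forall>r<d. R' r = R r))"
        using computesD[OF cf] RB MB by blast+
      have step: "\<bar>?w\<bar> \<le> int (poly qg ?B) \<and> runs cg (R', M) (poly qg ?B)
          (\<lambda>(R'', M'). M' = M \<and> R'' (Suc d) = ?w \<and> (\<forall>r<Suc d. R'' r = R' r))"
        if R': "R' d = ?v" "\<forall>r<d. R' r = R r" for R'
      proof -
        have env: "(\<lambda>i. R' (case_nat d \<rho> i)) = case_nat ?v (\<lambda>i. R (\<rho> i))"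
          using R' \<rho> by (auto split: nat.split)
        have "\<bar>R' (case_nat d \<rho> i)\<bar> \<le> int ?B" for i
          using R' \<rho> fB RB by (auto split: nat.split intro: order.trans)
        moreover have "\<bar>M i\<bar> \<le> int ?B" for i using MB by (auto intro: order.trans)
        ultimately show ?thesis using computesD[OF cg, of R' ?B M] by (simp add: env)
      qed
      have wB: "\<bar>?w\<bar> \<le> int (poly qg ?B)"
        using step[of "\<lambda>r. if r = d then ?v else R r"] by simp
      have "runs (Seq cf (Seq cg (Seq (Const d 0) (Add d d (Suc d))))) (R, M)
          (poly qf B + (poly qg ?B + (1 + (1 + poly qg ?B))))
          (\<lambda>(R', M'). M' = M \<and> R' d = ?w \<and> (\<forall>r<d. R' r = R r))"
        apply (rule runs_Seq[OF fr], clarify)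
        apply (rule runs_Seq[OF conjunct2[OF step]], assumption, assumption, clarify)
        subgoal for R1 M1 R2 M2
          using wB
          apply (intro runs_mono[OF runs_Const_Seq[OF runs_Add[where Q = "\<lambda>\<tau>. \<tau> = (R2(d := ?w), M)"]]])
            apply auto
          done
        done
      then have "runs (Seq cf (Seq cg (Seq (Const d 0) (Add d d (Suc d))))) (R, M) (poly ?q B)
          (\<lambda>(R', M'). M' = M \<and> R' d = ?w \<and> (\<forall>r<d. R' r = R r))"
        by (rule runs_mono) (auto simp: poly_pcompose)
      moreover have "\<bar>?w\<bar> \<le> int (poly ?q B)" using wB by (simp add: poly_pcompose)
      ultimately show "\<bar>?w\<bar> \<le> int (poly ?q B) \<and>
        runs (Seq cf (Seq cg (Seq (Const d 0) (Add d d (Suc d))))) (R, M) (poly ?q B)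
          (\<lambda>(R', M'). M' = M \<and> R' d = ?w \<and> (\<forall>r<d. R' r = R r))" by blast
    qed
    then show ?thesis by blast
  qed
  then show ?thesis unfolding comput_def by blast
qed

lemma comput_sum_var:
  assumes g: "comput g"
  shows "comput (\<lambda>e m. \<Sum>i\<in>{0..<e b}. g (case_nat i e) m)"
proof -
  obtain q where q: "\<And>\<rho> d. (\<And>i. \<rho> i < d) \<Longrightarrow> \<exists>c. computes c \<rho> d q g"
    using g unfolding comput_def by blast
  let ?X = "[:0, 1:] :: nat poly"
  \<comment> \<open>One round: evaluate the summand, add it to a partial sum bounded by
    \<open>B * poly q B\<close>, then update index and counter.\<close>
  let ?T = "q + (1 + ?X * q + q) + 2 * (2 + ?X)"
  let ?q = "10 + ?X + ?X * q + (1 + ?X) * (1 + ?X + ?T)"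
  have "\<exists>c. computes c \<rho> d ?q (\<lambda>e m. \<Sum>i\<in>{0..<e b}. g (case_nat i e) m)"
    if \<rho>: "\<And>i. \<rho> i < d" for \<rho> d
  proof -
    \<comment> \<open>Registers: \<open>d\<close> holds the partial sum, \<open>d+1\<close> the
      number of remaining rounds, \<open>d+2\<close> the summation index, \<open>d+3\<close> the
      constant 1 and \<open>d+4\<close> the current summand.\<close>
    have "case_nat (d+2) \<rho> i < d+4" for i using \<rho>[of "i-1"] by (auto split: nat.split)
    then obtain cg where cg: "computes cg (case_nat (d+2) \<rho>) (d+4) q g"
      using q[of "case_nat (d+2) \<rho>" "d+4"] by blast
    let ?body = "Seq cg (Seq (Add d d (d+4)) (Seq (Add (d+2) (d+2) (d+3)) (Sub (d+1) (d+1) (d+3))))"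
    let ?c = "Seq (Const d 0) (Seq (Const (d+2) 0) (Seq (Const (d+3) 1) (Seq (Const (d+1) 0)
      (Seq (Add (d+1) (d+1) (\<rho> b)) (WhilePos (d+1) ?body)))))"
    have "computes ?c \<rho> d ?q (\<lambda>e m. \<Sum>i\<in>{0..<e b}. g (case_nat i e) m)"
      unfolding computes_def
    proof (intro allI impI)
      fix R M :: "nat \<Rightarrow> int" and B
      assume RB: "\<forall>i. \<bar>R (\<rho> i)\<bar> \<le> int B" and MB: "\<forall>i. \<bar>M i\<bar> \<le> int B"
      let ?e = "\<lambda>i. R (\<rho> i)"
      define h where "h = (\<lambda>i. g (case_nat i ?e) M)"
      define N where "N = R (\<rho> b)"
      define S where "S = (\<lambda>k. \<Sum>i\<in>{0..<int k}. h i)"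
      define I where "I = (\<lambda>k R'. (\<forall>r<d. R' r = R r) \<and> R' d = S k \<and> R' (d+2) = int k \<and> R' (d+3) = 1 \<and>
        R' (d+1) = N - int k)"
      have NB: "\<bar>N\<bar> \<le> int B" using RB by (simp add: N_def)
      have S_Suc: "S (Suc k) = S k + h (int k)" for k
      proof -
        have "{0..<int (Suc k)} = insert (int k) {0..<int k}" by auto
        then show ?thesis unfolding S_def by simp
      qed
      have step: "\<bar>h (int k)\<bar> \<le> int (poly q B) \<and> runs cg (R', M) (poly q B)
          (\<lambda>(R'', M'). M' = M \<and> R'' (d+4) = h (int k) \<and> (\<forall>r<d+4. R'' r = R' r))"
        if k: "k < nat N" and R': "R' (d+2) = int k" "\<forall>r<d. R' r = R r" for R' k
      proof -
        have env: "(\<lambda>i. R' (case_nat (d+2) \<rho> i)) = case_nat (int k) ?e"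
          using R' \<rho> by (auto split: nat.split)
        have "\<forall>i. \<bar>R' (case_nat (d+2) \<rho> i)\<bar> \<le> int B"
          using R' \<rho> k NB RB by (auto split: nat.split intro: order.trans)
        then show ?thesis using computesD[OF cg, of R' B M] MB unfolding env h_def by simp
      qed
      have hB: "\<bar>h (int k)\<bar> \<le> int (poly q B)" if "k < nat N" for k
        using step[OF that, of "\<lambda>r. if r < d then R r else int k"] by simp
      have SB: "\<bar>S k\<bar> \<le> int (B * poly q B)" if "k \<le> nat N" for k
      proof -
        have "\<bar>S k\<bar> \<le> int k * int (poly q B)"
          using that
        proof (induction k)
          case 0 show ?case by (simp add: S_def)
        next
          case (Suc k)
          then show ?case using hB[of k] by (simp add: S_Suc algebra_simps)
        qed
        also have "\<dots> \<le> int B * int (poly q B)" using that NB by (intro mult_right_mono) auto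
        finally show ?thesis by simp
      qed
      have nB: "nat \<bar>h (int k)\<bar> \<le> poly q B" "nat \<bar>S k\<bar> \<le> B * poly q B" if "k < nat N" for k
        using hB[OF that] SB[of k] that by linarith+
      have loop: "runs (WhilePos (d+1) ?body) (R', M) (Suc (nat N) * (1 + nat \<bar>N\<bar> + poly ?T B))
          (\<lambda>(R', M'). M' = M \<and> I (nat N) R')" if "I 0 R'" for R'
      proof (rule runs_WhilePos[where I = I])
        fix k R1 assume k: "k < nat N" and I: "I k R1"
        have kB: "int k < int B" using k NB by linarith
        show "runs ?body (R1, M) (poly ?T B) (\<lambda>(R', M'). M' = M \<and> I (Suc k) R')"
        proof (rule runs_mono)
          show "runs ?body (R1, M)
            (poly q B + ((1 + B * poly q B + poly q B) + ((2 + B) + (2 + B)))) (\<lambda>(R', M'). M' = M \<and> I (Suc k) R')"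
          proof (rule runs_Seq[OF conjunct2[OF step[OF k]]], use I in \<open>simp add: I_def\<close>, use I in \<open>simp add: I_def\<close>, clarify)
            fix R2 assume R2: "R2 (d+4) = h (int k)" "\<forall>r<d+4. R2 r = R1 r"
            have v: "R2 d = S k" "R2 (d+4) = h (int k)" "R2 (d+2) = int k" "R2 (d+3) = 1" "R2 (d+1) = N - int k"
              "\<forall>r<d. R2 r = R r"
              using R2 I by (auto simp: I_def)
            let ?R3 = "R2(d := S k + h (int k))"
            let ?R4 = "?R3(d+2 := int k + 1)"
            let ?R5 = "?R4(d+1 := N - int k - 1)"
            have "runs (Sub (d+1) (d+1) (d+3)) (?R4, M) (2 + B) (\<lambda>\<tau>. \<tau> = (?R5, M))"
              using v kB NB k by (intro runs_mono[OF runs_Sub[where Q = "\<lambda>\<tau>. \<tau> = (?R5, M)"]]) auto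
            then have "runs (Seq (Add (d+2) (d+2) (d+3)) (Sub (d+1) (d+1) (d+3))) (?R3, M) ((2 + B) + (2 + B))
                (\<lambda>\<tau>. \<tau> = (?R5, M))"
              using v kB by (intro runs_Seq[OF runs_mono[OF runs_Add[where Q = "\<lambda>\<tau>. \<tau> = (?R4, M)"]]]) auto
            then have "runs (Seq (Add d d (d+4)) (Seq (Add (d+2) (d+2) (d+3)) (Sub (d+1) (d+1) (d+3)))) (R2, M)
                ((1 + B * poly q B + poly q B) + ((2 + B) + (2 + B))) (\<lambda>\<tau>. \<tau> = (?R5, M))"
              using v nB[OF k]
              by (intro runs_Seq[OF runs_mono[OF runs_Add[where Q = "\<lambda>\<tau>. \<tau> = (?R3, M)"]]]) auto
            then show "runs (Seq (Add d d (d+4)) (Seq (Add (d+2) (d+2) (d+3)) (Sub (d+1) (d+1) (d+3)))) (R2, M)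
                ((1 + B * poly q B + poly q B) + ((2 + B) + (2 + B))) (\<lambda>(R', M'). M' = M \<and> I (Suc k) R')"
              by (rule runs_mono) (use v in \<open>auto simp: I_def S_Suc\<close>)
          qed
        qed (auto simp: algebra_simps)
      qed (use that in \<open>auto simp: I_def\<close>)
      let ?R4 = "R(d := 0, d+2 := 0, d+3 := 1, d+1 := 0)"
      let ?R5 = "?R4(d+1 := ?R4 (d+1) + ?R4 (\<rho> b))"
      have \<rho>b: "?R4 (\<rho> b) = N" using \<rho>[of b] by (auto simp: N_def)
      have I0: "I 0 ?R5" using \<rho>b by (auto simp: I_def S_def)
      have "runs ?c (R, M) (1 + nat \<bar>0\<bar> + (1 + nat \<bar>0\<bar> + (1 + nat \<bar>1\<bar> + (1 + nat \<bar>0\<bar> +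
          (1 + nat \<bar>?R4 (d+1)\<bar> + nat \<bar>?R4 (\<rho> b)\<bar> + Suc (nat N) * (1 + nat \<bar>N\<bar> + poly ?T B))))))
          (\<lambda>(R', M'). M' = M \<and> I (nat N) R')"
        by (intro runs_Const_Seq runs_Add_Seq loop I0)
      moreover have "1 + nat \<bar>0::int\<bar> + (1 + nat \<bar>0::int\<bar> + (1 + nat \<bar>1::int\<bar> + (1 + nat \<bar>0::int\<bar> +
          (1 + nat \<bar>?R4 (d+1)\<bar> + nat \<bar>?R4 (\<rho> b)\<bar> + Suc (nat N) * (1 + nat \<bar>N\<bar> + poly ?T B))))) \<le> poly ?q B"
      proof -
        have "Suc (nat N) * (1 + nat \<bar>N\<bar> + poly ?T B) \<le> (1 + B) * (1 + B + poly ?T B)"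
          using NB by (intro mult_mono) auto
        moreover have "nat \<bar>N\<bar> \<le> B" using NB by simp
        moreover have "poly ?q B = 10 + B + B * poly q B + (1 + B) * (1 + B + poly ?T B)" by simp
        ultimately show ?thesis unfolding \<rho>b by simp
      qed
      moreover have S: "(\<Sum>i\<in>{0..<?e b}. g (case_nat i ?e) M) = S (nat N)"
        by (cases "N \<ge> 0") (auto simp: S_def h_def N_def)
      moreover have "\<bar>S (nat N)\<bar> \<le> int (poly ?q B)"
      proof -
        have "\<bar>S (nat N)\<bar> \<le> int (B * poly q B)" using SB by blast
        also have "B * poly q B \<le> 10 + B + B * poly q B + (1 + B) * (1 + B + poly ?T B)" by linarith
        also have "\<dots> = poly ?q B" by simp
        finally show ?thesis by simp
      qed
      ultimately show "\<bar>\<Sum>i\<in>{0..<?e b}. g (case_nat i ?e) M\<bar> \<le> int (poly ?q B) \<and>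
        runs ?c (R, M) (poly ?q B)
          (\<lambda>(R', M'). M' = M \<and> R' d = (\<Sum>i\<in>{0..<?e b}. g (case_nat i ?e) M) \<and> (\<forall>r<d. R' r = R r))"
        unfolding S by (auto elim!: runs_mono simp: I_def simp del: poly_add poly_mult)
    qed
    then show ?thesis by blast
  qed
  then show ?thesis unfolding comput_def by blast
qed

section \<open>Integer expressions and truth values\<close>

text \<open>It is enough to implement an operation on two variables; binding substitutes arbitrary
  expressions for them. The value bound last becomes variable 0, hence the swap of the
  arguments.\<close>

lemma comput_bind2:
  assumes "comput f" "comput g" "comput (\<lambda>e m. h (e 0) (e (Suc 0)) m)"
  shows "comput (\<lambda>e m. h (f e m) (g e m) m)"
proof -
  have h: "comput (\<lambda>e m. h (e (Suc 0)) (e 0) m)"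
    using comput_rename[OF assms(3), of "\<lambda>i. if i = 0 then Suc 0 else 0"] by simp
  have "comput (\<lambda>e m. (\<lambda>e m. (\<lambda>e m. h (e (Suc 0)) (e 0) m) (case_nat (g (\<lambda>i. e (Suc i)) m) e) m) (case_nat (f e m) e) m)"
    by (intro comput_bind assms(1) comput_rename[OF assms(2), of Suc] h)
  then show ?thesis by simp
qed

lemma comput_bind1:
  assumes "comput f" "comput (\<lambda>e m. h (e 0) m)"
  shows "comput (\<lambda>e m. h (f e m) m)"
  using comput_bind[OF assms] by simp

lemma comput_var: "comput (\<lambda>e m. e k)"
  using comput_bind[OF comput_const[of 0] comput_add_var[of 0 "Suc k"]] by simp

lemma comput_add: "comput f \<Longrightarrow> comput g \<Longrightarrow> comput (\<lambda>e m. f e m + g e m)"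
  by (erule comput_bind2[where h = "\<lambda>x y m. x + y"]) (auto intro: comput_add_var)

lemma comput_diff: "comput f \<Longrightarrow> comput g \<Longrightarrow> comput (\<lambda>e m. f e m - g e m)"
  by (erule comput_bind2[where h = "\<lambda>x y m. x - y"]) (auto intro: comput_diff_var)

lemma comput_mem: "comput f \<Longrightarrow> comput (\<lambda>e m. m (nat (f e m)))"
  by (erule comput_bind1[where h = "\<lambda>x m. m (nat x)"]) (rule comput_mem_var)

lemma comput_pos: "comput f \<Longrightarrow> comput (\<lambda>e m. of_bool (0 < f e m))"
  by (erule comput_bind1[where h = "\<lambda>x m. of_bool (0 < x)"]) (rule comput_pos_var)

lemma comput_sum:
  assumes b: "comput b" and g: "comput (\<lambda>e m. g (e 0) (\<lambda>i. e (Suc i)) m)"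
  shows "comput (\<lambda>e m. \<Sum>i\<in>{0..<b e m}. g i e m)"
proof -
  have "comput (\<lambda>e m. (\<lambda>e m. \<Sum>i\<in>{0..<e 0}. (\<lambda>e m. g (e 0) (\<lambda>i. e (Suc (Suc i))) m) (case_nat i e) m) (case_nat (b e m) e) m)"
    by (intro comput_bind b comput_sum_var comput_rename[OF g, of "\<lambda>i. if i = 0 then 0 else Suc i", simplified])
  then show ?thesis by simp
qed

lemma comput_mult:
  assumes "comput f" "comput g"
  shows "comput (\<lambda>e m. f e m * g e m)"
proof (rule comput_bind2[OF assms, where h = "\<lambda>x y m. x * y"])
  \<comment> \<open>Repeated addition; at most one of the two ranges is nonempty, which takes care
    of the sign of \<open>x\<close>.\<close>
  have *: "x * y = (\<Sum>i\<in>{0..<x}. y) - (\<Sum>i\<in>{0..<0-x}. y)" for x y :: int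
    by (cases "x \<ge> 0") auto
  show "comput (\<lambda>e m. e 0 * e (Suc 0))"
    by (subst *) (intro comput_diff comput_sum comput_var comput_const)
qed

lemma comput_eq: "comput f \<Longrightarrow> comput g \<Longrightarrow> comput (\<lambda>e m. of_bool (f e m = g e m))"
proof (erule (1) comput_bind2[where h = "\<lambda>x y m. of_bool (x = y)"])
  have *: "of_bool (x = y) = (1::int) - of_bool (0 < x - y) - of_bool (0 < y - x)" for x y :: int
    by auto
  show "comput (\<lambda>e m. of_bool (e 0 = e (Suc 0)))"
    by (subst *) (intro comput_diff comput_pos comput_var comput_const)
qed

lemma comput_less: "comput f \<Longrightarrow> comput g \<Longrightarrow> comput (\<lambda>e m. of_bool (f e m < g e m))"
proof (erule (1) comput_bind2[where h = "\<lambda>x y m. of_bool (x < y)"])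
  have *: "(x < y) = (0 < y - x)" for x y :: int by auto
  show "comput (\<lambda>e m. of_bool (e 0 < e (Suc 0)))"
    by (subst *) (intro comput_diff comput_pos comput_var)
qed

lemma comput_not: "comput (\<lambda>e m. of_bool (P e m)) \<Longrightarrow> comput (\<lambda>e m. of_bool (\<not> P e m))"
proof -
  have *: "of_bool (\<not> P) = (1::int) - of_bool P" for P by simp
  show "comput (\<lambda>e m. of_bool (P e m)) \<Longrightarrow> ?thesis"
    by (subst *) (intro comput_diff comput_const)
qed

lemma comput_conj:
  "comput (\<lambda>e m. of_bool (P e m)) \<Longrightarrow> comput (\<lambda>e m. of_bool (Q e m)) \<Longrightarrow> comput (\<lambda>e m. of_bool (P e m \<and> Q e m))"
  unfolding of_bool_conj by (rule comput_mult)

lemma comput_imp: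
  assumes "comput (\<lambda>e m. of_bool (P e m))" "comput (\<lambda>e m. of_bool (Q e m))"
  shows "comput (\<lambda>e m. of_bool (P e m \<longrightarrow> Q e m))"
proof -
  have *: "(P \<longrightarrow> Q) = (\<not> (P \<and> \<not> Q))" for P Q by simp
  show ?thesis by (subst *) (intro comput_not comput_conj assms)
qed

lemma comput_disj:
  assumes "comput (\<lambda>e m. of_bool (P e m))" "comput (\<lambda>e m. of_bool (Q e m))"
  shows "comput (\<lambda>e m. of_bool (P e m \<or> Q e m))"
proof -
  have *: "(P \<or> Q) = (\<not> (\<not> P \<and> \<not> Q))" for P Q by simp
  show ?thesis by (subst *) (intro comput_not comput_conj assms)
qed

section \<open>Natural numbers and bounded quantifiers\<close>

lemma comput_nat_var: "comput (\<lambda>e m. int (nat (e k)))"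
proof -
  have *: "int (nat x) = of_bool (0 < x) * x" for x by auto
  show ?thesis by (subst *) (intro comput_mult comput_pos comput_var)
qed

lemma comput_nat_mem:
  assumes "comput (\<lambda>e m. int (f e m))" shows "comput (\<lambda>e m. int (nat (m (f e m))))"
proof -
  have *: "int (nat x) = of_bool (0 < x) * x" for x by auto
  show ?thesis by (subst (2) nat_int[symmetric], subst *) (intro comput_mult comput_pos comput_mem assms)
qed

lemma comput_nat_add:
  "comput (\<lambda>e m. int (f e m)) \<Longrightarrow> comput (\<lambda>e m. int (g e m)) \<Longrightarrow> comput (\<lambda>e m. int (f e m + g e m))"
  unfolding of_nat_add by (rule comput_add)

lemma comput_nat_mult:
  "comput (\<lambda>e m. int (f e m)) \<Longrightarrow> comput (\<lambda>e m. int (g e m)) \<Longrightarrow> comput (\<lambda>e m. int (f e m * g e m))"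
  unfolding of_nat_mult by (rule comput_mult)

lemma comput_nat_sum:
  assumes "comput (\<lambda>e m. int (b e m))" "comput (\<lambda>e m. g (nat (e 0)) (\<lambda>i. e (Suc i)) m)"
  shows "comput (\<lambda>e m. \<Sum>i<b e m. g i e m)"
proof -
  have *: "(\<Sum>i<n. h i) = (\<Sum>i\<in>{0..<int n}. h (nat i))" for n and h :: "nat \<Rightarrow> int"
    by (rule sum.reindex_bij_witness[of _ nat int]) auto
  show ?thesis by (subst *) (intro comput_sum assms)
qed

text \<open>Counting counterexamples turns the quantifier into a sum.\<close>

lemma comput_all:
  assumes "comput (\<lambda>e m. int (b e m))" "comput (\<lambda>e m. of_bool (P (nat (e 0)) (\<lambda>i. e (Suc i)) m))"
  shows "comput (\<lambda>e m. of_bool (\<forall>i<b e m. P i e m))"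
proof -
  have *: "(\<forall>i<n. P i) = (\<not> (0 < (\<Sum>i<n. of_bool (\<not> P i) :: int)))" for n :: nat and P
    by (auto simp: less_le sum_nonneg sum_nonneg_eq_0_iff)
  show ?thesis by (subst *) (intro comput_not comput_pos comput_nat_sum assms)
qed

lemma comput_ex:
  assumes "comput (\<lambda>e m. int (b e m))" "comput (\<lambda>e m. of_bool (P (nat (e 0)) (\<lambda>i. e (Suc i)) m))"
  shows "comput (\<lambda>e m. of_bool (\<exists>i<b e m. P i e m))"
proof -
  have *: "(\<exists>i<n. P i) = (\<not> (\<forall>i<n. \<not> P i))" for n :: nat and P by auto
  show ?thesis by (subst *) (intro comput_not comput_all assms)
qed

lemma comput_nat_eq:
  "comput (\<lambda>e m. int (f e m)) \<Longrightarrow> comput (\<lambda>e m. int (g e m)) \<Longrightarrow> comput (\<lambda>e m. of_bool (f e m = g e m))"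
  unfolding of_nat_eq_iff[symmetric, where 'a = int] by (rule comput_eq)

lemma comput_nat_less:
  "comput (\<lambda>e m. int (f e m)) \<Longrightarrow> comput (\<lambda>e m. int (g e m)) \<Longrightarrow> comput (\<lambda>e m. of_bool (f e m < g e m))"
  unfolding of_nat_less_iff[symmetric, where 'a = int] by (rule comput_less)

lemma comput_dvd:
  assumes "comput (\<lambda>e m. int (f e m))" "comput (\<lambda>e m. int (g e m))"
  shows "comput (\<lambda>e m. of_bool (f e m dvd g e m))"
proof -
  have *: "a dvd b \<longleftrightarrow> (\<exists>c<b+1. b = a * c)" for a b :: nat
  proof
    assume "a dvd b"
    then obtain c where c: "b = a * c" by (elim dvdE)
    show "\<exists>c<b+1. b = a * c"
    proof (cases "a = 0")
      case False
      then have "c < b + 1" using c by (simp add: less_Suc_eq_le)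
      then show ?thesis using c by blast
    qed (use c in auto)
  qed auto
  have h: "comput (\<lambda>e m. of_bool (\<exists>c<nat (e (Suc 0))+1. nat (e (Suc 0)) = nat (e 0) * c))"
    by (intro comput_ex comput_nat_eq comput_nat_add comput_nat_mult comput_nat_var comput_const)
  have "comput (\<lambda>e m. of_bool (nat (int (f e m)) dvd nat (int (g e m))))"
    by (rule comput_bind2[OF assms, where h = "\<lambda>x y m. of_bool (nat x dvd nat y)"]) (use h in \<open>simp only: *\<close>)
  then show ?thesis by simp
qed

section \<open>Roots of unity and mask polynomials\<close>

text \<open>The multiplicative order, expressed through divisibility. For \<open>n = 0\<close> it
  describes the numbers none of whose positive powers is 1, so positivity of \<open>n\<close> has to
  be assumed where genuine roots of unity are meant.\<close>

definition prim_root :: "nat \<Rightarrow> complex \<Rightarrow> bool" where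
  "prim_root n z \<longleftrightarrow> (\<forall>k. z ^ k = 1 \<longleftrightarrow> n dvd k)"

lemma prim_root_power_eq_1_iff: "prim_root n z \<Longrightarrow> z ^ k = 1 \<longleftrightarrow> n dvd k"
  by (simp add: prim_root_def)

lemma prim_root_nonzero: "prim_root n z \<Longrightarrow> 0 < n \<Longrightarrow> z \<noteq> 0"
  using prim_root_power_eq_1_iff[of n z n] by (auto simp: power_0_left)

lemma prim_root_unique: "prim_root m z \<Longrightarrow> prim_root n z \<Longrightarrow> m = n"
  by (metis prim_root_def dvd_refl dvd_antisym)

lemma prim_root_1_iff: "prim_root 1 z \<longleftrightarrow> z = 1"
  unfolding prim_root_def by (metis one_dvd power_one power_one_right)

lemma prim_root_exists:
  assumes "0 < N" "z ^ N = 1"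
  obtains s where "s dvd N" "prim_root s z"
proof -
  define s where "s = (LEAST s. 0 < s \<and> z ^ s = 1)"
  have s: "0 < s" "z ^ s = 1"
    unfolding s_def using LeastI[of "\<lambda>s. 0 < s \<and> z ^ s = 1" N] assms by auto
  have least: "s \<le> k" if "0 < k" "z ^ k = 1" for k
    unfolding s_def using that by (intro Least_le) auto
  have mod: "z ^ k = z ^ (k mod s)" for k
  proof -
    have "z ^ k = z ^ (s * (k div s) + k mod s)" by simp
    also have "\<dots> = z ^ (k mod s)" unfolding power_add power_mult s by simp
    finally show ?thesis .
  qed
  have "prim_root s z" unfolding prim_root_def
  proof (intro allI iffI)
    fix k assume "z ^ k = 1"
    then have "z ^ (k mod s) = 1" using mod by simp
    then show "s dvd k" using least[of "k mod s"] s by (meson mod_eq_0_iff_dvd mod_less_divisor not_gr0 not_less)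
  next
    fix k assume "s dvd k" then show "z ^ k = 1" using mod[of k] by simp
  qed
  then show ?thesis using that assms prim_root_power_eq_1_iff by blast
qed

lemma prim_root_cong_power:
  assumes "prim_root n z" "[i = j] (mod n)"
  shows "z ^ i = z ^ j"
proof -
  have "z ^ k = z ^ (k mod n)" for k
  proof -
    have "z ^ k = z ^ (n * (k div n) + k mod n)" by simp
    also have "\<dots> = z ^ (k mod n)"
      unfolding power_add power_mult using prim_root_power_eq_1_iff[OF assms(1), of n] by simp
    finally show ?thesis .
  qed
  then show ?thesis using assms(2) by (metis cong_def)
qed

lemma prim_root_power:
  assumes "prim_root n z" "0 < n"
  shows "prim_root (n div gcd n k) (z ^ k)"
  unfolding prim_root_def
proof
  fix j
  have "n dvd k * j \<longleftrightarrow> n div gcd n k dvd j"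
  proof -
    let ?g = "gcd n k"
    have g: "?g > 0" using assms by simp
    have "n = ?g * (n div ?g)" "k * j = ?g * ((k div ?g) * j)" by (simp_all flip: mult.assoc)
    then have "n dvd k * j \<longleftrightarrow> ?g * (n div ?g) dvd ?g * ((k div ?g) * j)" by metis
    also have "\<dots> \<longleftrightarrow> n div ?g dvd (k div ?g) * j"
      using g by (subst dvd_times_left_cancel_iff) simp_all
    also have "\<dots> \<longleftrightarrow> n div ?g dvd j"
      using div_gcd_coprime[of n k] assms by (simp add: coprime_dvd_mult_right_iff)
    finally show ?thesis .
  qed
  then show "(z ^ k) ^ j = 1 \<longleftrightarrow> n div gcd n k dvd j"
    using prim_root_power_eq_1_iff[OF assms(1), of "k * j"] by (simp add: power_mult)
qed

lemma prim_root_power_coprime: "prim_root n z \<Longrightarrow> 0 < n \<Longrightarrow> coprime k n \<Longrightarrow> prim_root n (z ^ k)"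
  using prim_root_power[of n z k] by (simp add: coprime_iff_gcd_eq_1 gcd.commute)

lemma prim_root_cis:
  assumes "0 < n"
  shows "prim_root n (cis (2 * pi / real n))"
proof -
  have eq: "cis (2 * pi / real n) ^ k = cis (2 * pi * real k / real n)" for k
    by (simp add: DeMoivre mult_ac)
  have "cis (2 * pi / real n) ^ n = 1" using assms eq[of n] by simp
  then obtain s where s: "s dvd n" "prim_root s (cis (2 * pi / real n))" using prim_root_exists assms by blast
  have "s = n"
  proof (rule ccontr)
    assume "s \<noteq> n"
    then have "s < n" using dvd_imp_le[OF s(1) assms] by linarith
    moreover have "cis (2 * pi * real s / real n) = cis (2 * pi * real 0 / real n)"
      using prim_root_power_eq_1_iff[OF s(2), of s] eq[of s] by simp
    moreover have "s > 0" using s(1) assms by (auto intro: Nat.gr0I)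
    ultimately show False
      using bij_betw_imp_inj_on[OF bij_betw_roots_unity[OF assms]] assms unfolding inj_on_def by blast
  qed
  then show ?thesis using s by simp
qed

lemma prim_root_power_surj:
  assumes "prim_root n z" "0 < n" "w ^ n = 1"
  obtains k where "k < n" "w = z ^ k"
proof -
  have "inj_on (\<lambda>k. z ^ k) {..<n}"
  proof (rule linorder_inj_onI')
    fix i j assume ij: "i \<in> {..<n}" "j \<in> {..<n}" "i < j"
    show "z ^ i \<noteq> z ^ j"
    proof
      assume "z ^ i = z ^ j"
      also have "z ^ j = z ^ i * z ^ (j - i)" using ij by (simp flip: power_add)
      finally have "z ^ (j - i) = 1" using prim_root_nonzero[OF assms(1,2)] by simp
      then have "n dvd j - i" using prim_root_power_eq_1_iff[OF assms(1)] by blast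
      then show False using ij by (auto dest: dvd_imp_le)
    qed
  qed
  then have "card ((\<lambda>k. z ^ k) ` {..<n}) = n" by (simp add: card_image)
  moreover have "(\<lambda>k. z ^ k) ` {..<n} \<subseteq> {w. w ^ n = 1}"
    using prim_root_power_eq_1_iff[OF assms(1)] by (auto simp flip: power_mult)
  ultimately have "(\<lambda>k. z ^ k) ` {..<n} = {w. w ^ n = 1}"
    using assms by (intro card_subset_eq) (auto simp: card_roots_unity_eq finite_roots_unity)
  then show ?thesis using assms(3) that by auto
qed

lemma prim_root_power_surj_coprime:
  assumes "prim_root n z" "0 < n" "prim_root n w"
  obtains k where "k < n" "coprime k n" "w = z ^ k"
proof -
  have "w ^ n = 1" using assms(3) by (simp add: prim_root_def)
  then obtain k where k: "k < n" "w = z ^ k" using prim_root_power_surj assms by metis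
  have "n div gcd n k = n" using prim_root_unique prim_root_power[OF assms(1,2)] assms(3) k by blast
  then have "gcd n k = 1" using assms(2) by (metis div_eq_dividend_iff)
  then show ?thesis using that k by (simp add: coprime_iff_gcd_eq_1 gcd.commute)
qed

section \<open>Divisibility by cyclotomic polynomials\<close>

lemma prod_linear_dvd_iff:
  fixes g :: "'b \<Rightarrow> 'a :: idom"
  assumes "finite S" "inj_on g S"
  shows "(\<Prod>k\<in>S. [:- g k, 1:]) dvd f \<longleftrightarrow> (\<forall>k\<in>S. poly f (g k) = 0)"
  using assms
proof (induction S arbitrary: f rule: finite_induct)
  case (insert x S)
  show ?case
  proof (cases "poly f (g x) = 0")
    case True
    then obtain h where h: "f = [:- g x, 1:] * h" using poly_eq_0_iff_dvd by (metis dvdE)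
    have "(\<Prod>k\<in>insert x S. [:- g k, 1:]) dvd f \<longleftrightarrow> (\<Prod>k\<in>S. [:- g k, 1:]) dvd h"
      unfolding h using insert by (simp del: mult_pCons_left)
    also have "\<dots> \<longleftrightarrow> (\<forall>k\<in>S. poly h (g k) = 0)" using insert by simp
    also have "\<dots> \<longleftrightarrow> (\<forall>k\<in>S. poly f (g k) = 0)" using insert by (auto simp: h inj_on_def)
    finally show ?thesis using True by simp
  next
    case False
    moreover have "[:- g x, 1:] dvd (\<Prod>k\<in>insert x S. [:- g k, 1:])" using insert by (simp del: mult_pCons_left)
    ultimately show ?thesis using poly_eq_0_iff_dvd dvd_trans by blast
  qed
qed auto

lemma cyclotomic_root_inj: "0 < n \<Longrightarrow> inj_on (\<lambda>k. cis (2 * pi * real k / real n)) {1..n}"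
proof (rule linorder_inj_onI')
  fix i j assume n: "0 < n" and ij: "i \<in> {1..n}" "j \<in> {1..n}" "i < j"
  let ?z = "cis (2 * pi / real n)"
  have eq: "cis (2 * pi * real k / real n) = ?z ^ k" for k by (simp add: DeMoivre mult_ac)
  have "?z ^ i \<noteq> ?z ^ j"
  proof
    assume "?z ^ i = ?z ^ j"
    also have "?z ^ j = ?z ^ i * ?z ^ (j - i)" using ij by (simp flip: power_add)
    finally have "?z ^ (j - i) = 1" by simp
    then have "n dvd j - i" using prim_root_power_eq_1_iff[OF prim_root_cis[OF n]] by blast
    then show False using ij by (auto dest: dvd_imp_le)
  qed
  then show "cis (2 * pi * real i / real n) \<noteq> cis (2 * pi * real j / real n)" by (simp add: eq)
qed

lemma prim_root_iff_cis:
  assumes "0 < n"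
  shows "prim_root n z \<longleftrightarrow> (\<exists>k\<in>{1..n}. coprime k n \<and> z = cis (2 * pi * real k / real n))"
proof -
  let ?z = "cis (2 * pi / real n)"
  have eq: "cis (2 * pi * real k / real n) = ?z ^ k" for k by (simp add: DeMoivre mult_ac)
  show ?thesis
  proof
    assume "prim_root n z"
    then obtain k where k: "k < n" "coprime k n" "z = ?z ^ k"
      using prim_root_power_surj_coprime[OF prim_root_cis[OF assms] assms] by blast
    show "\<exists>k\<in>{1..n}. coprime k n \<and> z = cis (2 * pi * real k / real n)"
    proof (cases "k = 0")
      case True
      with k show ?thesis by (intro bexI[of _ 1]) (auto simp: assms)
    next
      case False
      with k show ?thesis by (intro bexI[of _ k]) (auto simp: eq)
    qed
  next
    assume "\<exists>k\<in>{1..n}. coprime k n \<and> z = cis (2 * pi * real k / real n)"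
    then show "prim_root n z" using prim_root_power_coprime[OF prim_root_cis[OF assms] assms] by (auto simp: eq)
  qed
qed

text \<open>The roots of \<open>cyclotomic n\<close> are the primitive roots, all of them simple.
  From here on divisibility is handled as vanishing at these roots.\<close>

lemma cyclotomic_dvd_iff:
  assumes "0 < n"
  shows "cyclotomic n dvd f \<longleftrightarrow> (\<forall>z. prim_root n z \<longrightarrow> poly f z = 0)"
  unfolding cyclotomic_def
proof (subst prod_linear_dvd_iff)
  show "inj_on (\<lambda>k. cis (2 * pi * real k / real n)) {k. k \<in> {1..n} \<and> coprime k n}"
    by (rule inj_on_subset[OF cyclotomic_root_inj[OF assms]]) auto
  show "(\<forall>k\<in>{k. k \<in> {1..n} \<and> coprime k n}. poly f (cis (2 * pi * real k / real n)) = 0) \<longleftrightarrow>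
    (\<forall>z. prim_root n z \<longrightarrow> poly f z = 0)"
    (is "?L \<longleftrightarrow> ?R")
  proof
    assume L: ?L
    show ?R
    proof (intro allI impI)
      fix z assume "prim_root n z"
      then obtain k where "k \<in> {1..n}" "coprime k n" "z = cis (2 * pi * real k / real n)"
        using prim_root_iff_cis[OF assms] by metis
      with L show "poly f z = 0" by simp
    qed
  next
    assume R: ?R
    show ?L
    proof
      fix k assume "k \<in> {k. k \<in> {1..n} \<and> coprime k n}"
      then have "prim_root n (cis (2 * pi * real k / real n))" using prim_root_iff_cis[OF assms] by blast
      with R show "poly f (cis (2 * pi * real k / real n)) = 0" by simp
    qed
  qed
qed auto

text \<open>Units modulo \<open>m\<close> lift to units modulo \<open>n\<close>. With
  \<open>t\<close> the product of the primes of \<open>n\<close> that do not divide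
  \<open>k\<close>, every prime factor of \<open>n\<close> divides exactly one of \<open>k\<close>
  and \<open>m * t\<close>, hence not their sum.\<close>

lemma lift_coprime:
  assumes "coprime k m" "m dvd n" "0 < (n::nat)"
  obtains k' where "coprime k' n" "[k' = k] (mod m)"
proof -
  define t where "t = \<Prod>{p \<in> prime_factors n. \<not> p dvd k}"
  have "coprime (k + m * t) n"
  proof (rule ccontr)
    assume "\<not> coprime (k + m * t) n"
    then have "gcd (k + m * t) n \<noteq> 1" using coprime_iff_gcd_eq_1 by blast
    from prime_factor_nat[OF this] obtain p where p: "prime p" "p dvd k + m * t" "p dvd n" by auto
    show False
    proof (cases "p dvd k")
      case True
      then have "p dvd m * t" using p by (simp add: dvd_add_right_iff)
      moreover have "\<not> p dvd m" using True assms(1) p(1) using coprime_common_divisor not_prime_unit by blast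
      ultimately have "p dvd t" using p(1) by (simp add: prime_dvd_mult_iff)
      then obtain r where r: "r \<in> prime_factors n" "\<not> r dvd k" "p dvd r"
        unfolding t_def using p(1) by (subst (asm) prime_dvd_prod_iff) auto
      then have "p = r" using p(1) primes_dvd_imp_eq in_prime_factors_imp_prime by blast
      with r True show False by simp
    next
      case False
      then have "p dvd t" unfolding t_def using p assms(3)
        by (intro dvd_prodI) (auto simp: prime_factors_dvd)
      then show False using p(2) False by (simp add: dvd_add_left_iff)
    qed
  qed
  moreover have "[k + m * t = k] (mod m)" by (simp add: cong_def)
  ultimately show ?thesis using that by blast
qed

section \<open>Values of mask polynomials at roots of unity\<close>

definition mask_eval :: "int set \<Rightarrow> complex \<Rightarrow> complex" where
  "mask_eval A z = (\<Sum>a\<in>A. z powi a)"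

text \<open>Divisibility by the cyclotomic polynomial in Laurent form. Integer exponents allow
  translation, dilation and splitting into residue classes without renormalizing the set.\<close>

definition vanishes :: "int set \<Rightarrow> nat \<Rightarrow> bool" where
  "vanishes A s \<longleftrightarrow> (\<forall>z. prim_root s z \<longrightarrow> mask_eval A z = 0)"

lemma mask_eval_translate: "z \<noteq> 0 \<Longrightarrow> mask_eval ((\<lambda>a. a + k) ` A) z = z powi k * mask_eval A z"
  by (simp add: mask_eval_def sum.reindex power_int_add sum_distrib_left mult_ac)

lemma vanishes_translate: "0 < s \<Longrightarrow> vanishes ((\<lambda>a. a + k) ` A) s \<longleftrightarrow> vanishes A s"
  unfolding vanishes_def using prim_root_nonzero by (auto simp: mask_eval_translate)

lemma mask_eval_scale: "r > 0 \<Longrightarrow> mask_eval ((\<lambda>a. int r * a) ` A) z = mask_eval A (z ^ r)"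
  by (subst mask_eval_def, subst sum.reindex) (auto simp: mask_eval_def inj_on_def power_int_mult)

text \<open>At \<open>z\<close> the dilated set takes the value of \<open>A\<close> at
  \<open>z ^ r\<close>, which has order \<open>s div gcd s r\<close>. Conversely every root of that
  order is such a power: write it as a power of a fixed \<open>z0 ^ r\<close> and lift the exponent
  to a unit modulo \<open>s\<close>.\<close>

lemma vanishes_scale:
  assumes "0 < r" "0 < s"
  shows "vanishes ((\<lambda>a. int r * a) ` A) s \<longleftrightarrow> vanishes A (s div gcd s r)"
proof
  assume "vanishes A (s div gcd s r)"
  then show "vanishes ((\<lambda>a. int r * a) ` A) s"
    using prim_root_power[of s _ r] assms by (simp add: vanishes_def mask_eval_scale)
next
  assume vanishes: "vanishes ((\<lambda>a. int r * a) ` A) s"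
  show "vanishes A (s div gcd s r)" unfolding vanishes_def
  proof (intro allI impI)
    fix w assume w: "prim_root (s div gcd s r) w"
    define z0 where "z0 = cis (2 * pi / real s)"
    have z0: "prim_root s z0" using assms prim_root_cis by (simp add: z0_def)
    let ?m = "s div gcd s r"
    have m: "?m > 0" "?m dvd s" using assms
      by (metis dvd_div_eq_0_iff gcd_dvd1 not_gr0, metis dvd_div_mult_self dvd_triv_left gcd_dvd1)
    have mz: "prim_root ?m (z0 ^ r)" using prim_root_power[OF z0 assms(2)] .
    from prim_root_power_surj_coprime[OF mz m(1) w] obtain k where k: "coprime k ?m" "w = (z0 ^ r) ^ k" by blast
    obtain k' where k': "coprime k' s" "[k' = k] (mod ?m)"
      using lift_coprime[OF k(1) m(2) assms(2)] by blast
    have "w = (z0 ^ r) ^ k'" using k k' prim_root_cong_power[OF mz] by metis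
    then have "w = (z0 ^ k') ^ r" by (simp flip: power_mult add: mult.commute)
    moreover have "prim_root s (z0 ^ k')" using prim_root_power_coprime[OF z0 assms(2) k'(1)] .
    ultimately show "mask_eval A w = 0" using vanishes assms by (auto simp: vanishes_def mask_eval_scale)
  qed
qed

lemma poly_mask_poly:
  assumes "finite A" "A \<noteq> {}" "z \<noteq> 0"
  shows "poly (mask_poly A) z = mask_eval (normalized A) z"
proof -
  have "z powi a = z ^ nat a" if "a \<in> normalized A" for a
    using that assms(1) by (auto simp: normalized_def power_int_def)
  then show ?thesis by (simp add: mask_poly_def mask_eval_def poly_sum poly_monom)
qed

lemma cyclotomic_dvd_mask_iff:
  assumes "finite A" "A \<noteq> {}" "0 < s"
  shows "cyclotomic s dvd mask_poly A \<longleftrightarrow> vanishes A s"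
proof -
  have n: "normalized A = (\<lambda>a. a + (- Min A)) ` A" by (simp add: normalized_def)
  have "cyclotomic s dvd mask_poly A \<longleftrightarrow> vanishes (normalized A) s"
    unfolding cyclotomic_dvd_iff[OF assms(3)] vanishes_def
    using poly_mask_poly[OF assms(1,2)] prim_root_nonzero[OF _ assms(3)] by auto
  also have "\<dots> \<longleftrightarrow> vanishes A s" unfolding n by (rule vanishes_translate[OF assms(3)])
  finally show ?thesis .
qed

lemma card_normalized: "card (normalized A) = card A"
  unfolding normalized_def by (rule card_image) (simp add: inj_on_def)

lemma poly_mask_poly_1:
  assumes "finite A" "A \<noteq> {}"
  shows "poly (mask_poly A) 1 = of_nat (card A)"
  using poly_mask_poly[OF assms, of 1] by (simp add: mask_eval_def card_normalized)

section \<open>Cyclotomic polynomials of prime powers\<close>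

abbreviation root_poly :: "nat \<Rightarrow> complex poly" where
  "root_poly n \<equiv> monom 1 n - 1"

lemma lead_coeff_root_poly:
  assumes "0 < n" shows "degree (root_poly n) = n" "lead_coeff (root_poly n) = 1"
proof -
  show d: "degree (root_poly n) = n"
    using degree_add_eq_left[of "- 1" "monom 1 n :: complex poly"] assms by (simp add: degree_monom_eq)
  show "lead_coeff (root_poly n) = 1" unfolding d using assms by simp
qed

text \<open>The distinct linear factors all divide X^n - 1; both sides are monic of degree
  \<open>n\<close>, so the cofactor is 1.\<close>

lemma root_poly_conv_prod:
  assumes "0 < n"
  shows "root_poly n = (\<Prod>k\<in>{1..n}. [:- cis (2 * pi * real k / real n), 1:])" (is "_ = ?P")
proof -
  have deg: "degree ?P = n"
    by (subst degree_prod_eq_sum_degree) simp_all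
  have lead: "lead_coeff ?P = 1" by (subst lead_coeff_prod) simp
  have one: "cis (2 * pi * real k / real n) ^ n = 1" for k
    using assms by (simp add: DeMoivre cis_multiple_2pi)
  have "?P dvd root_poly n"
    using cyclotomic_root_inj[OF assms] one
    by (subst prod_linear_dvd_iff) (auto simp: poly_monom)
  then obtain h where h: "root_poly n = ?P * h" by (elim dvdE)
  have nz: "root_poly n \<noteq> 0" using lead_coeff_root_poly[OF assms] by auto
  then have "?P \<noteq> 0" "h \<noteq> 0" using h by auto
  then have "degree (root_poly n) = n + degree h" using h deg degree_mult_eq by metis
  then have "degree h = 0" using lead_coeff_root_poly[OF assms] by simp
  then obtain c where c: "h = [:c:]" by (metis degree_eq_zeroE)
  have "lead_coeff (root_poly n) = lead_coeff ?P * lead_coeff h" unfolding h by (rule lead_coeff_mult)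
  then have "c = 1" using lead lead_coeff_root_poly[OF assms] c by simp
  then show ?thesis using h c by simp
qed

lemma geometric_poly:
  "(monom (1::'a::comm_ring_1) m - 1) * (\<Sum>i<p. monom 1 (i * m)) = monom 1 (p * m) - 1"
  using power_diff_1_eq[of "monom (1::'a) m" p] by (simp add: monom_power mult.commute)

text \<open>The indices not coprime to \<open>p\<close> are its multiples, and their linear factors
  multiply to X^(p^k) - 1. The quotient is a geometric sum.\<close>

lemma cyclotomic_prime_power:
  assumes p: "prime p"
  shows "cyclotomic (p ^ Suc k) = (\<Sum>i<p. monom 1 (i * p ^ k))"
proof -
  let ?n = "p ^ Suc k" and ?m = "p ^ k"
  have pos: "0 < p" using p prime_gt_0_nat by blast
  have split: "{1..?n} = {j. j \<in> {1..?n} \<and> coprime j ?n} \<union> (\<lambda>j. p * j) ` {1..?m}"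
  proof (intro equalityI subsetI)
    fix j assume j: "j \<in> {1..?n}"
    show "j \<in> {j. j \<in> {1..?n} \<and> coprime j ?n} \<union> (\<lambda>j. p * j) ` {1..?m}"
    proof (cases "p dvd j")
      case True
      then obtain i where "j = p * i" by blast
      then show ?thesis using j pos by (intro UnI2 image_eqI[of _ _ i]) (auto simp: Suc_le_eq)
    next
      case False
      then have "coprime p j" using p prime_imp_coprime by blast
      then show ?thesis using j by (simp add: coprime_commute)
    qed
  qed (use pos in \<open>auto simp: Suc_le_eq\<close>)
  have disj: "{j. j \<in> {1..?n} \<and> coprime j ?n} \<inter> (\<lambda>j. p * j) ` {1..?m} = {}"
    using p by (auto simp: not_prime_unit)
  have "root_poly ?n = (\<Prod>j\<in>{1..?n}. [:- cis (2 * pi * real j / real ?n), 1:])"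
    using pos by (intro root_poly_conv_prod) simp
  also have "\<dots> = cyclotomic ?n * (\<Prod>j\<in>(\<lambda>j. p * j) ` {1..?m}. [:- cis (2 * pi * real j / real ?n), 1:])"
    unfolding cyclotomic_def by (subst split, subst prod.union_disjoint) (use disj in auto)
  also have "(\<Prod>j\<in>(\<lambda>j. p * j) ` {1..?m}. [:- cis (2 * pi * real j / real ?n), 1:]) =
      (\<Prod>j\<in>{1..?m}. [:- cis (2 * pi * real j / real ?m), 1:])"
    using pos by (subst prod.reindex) (auto simp: inj_on_def field_simps intro!: prod.cong)
  also have "\<dots> = root_poly ?m" using pos by (intro root_poly_conv_prod[symmetric]) simp
  finally have "root_poly ?m * cyclotomic ?n = root_poly ?m * (\<Sum>i<p. monom 1 (i * ?m))"
    unfolding geometric_poly by (simp only: mult.commute power_Suc)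
  moreover have "root_poly ?m \<noteq> 0"
    using lead_coeff_root_poly[of ?m] pos by auto
  ultimately show ?thesis by (metis mult_left_cancel)
qed

lemma lead_coeff_cyclotomic: "lead_coeff (cyclotomic n) = 1"
  unfolding cyclotomic_def by (subst lead_coeff_prod) simp

lemma primepowE:
  assumes "primepow (s::nat)"
  obtains p k where "prime p" "s = p ^ Suc k" "aprimedivisor s = p"
  using assms unfolding primepow_def by (metis aprimedivisor_prime_power gr0_implies_Suc)

lemma poly_cyclotomic_primepow_1:
  assumes "primepow s" shows "poly (cyclotomic s) 1 = of_nat (aprimedivisor s)"
  using assms by (elim primepowE) (simp add: cyclotomic_prime_power poly_sum poly_monom del: power_Suc)

text \<open>A prime occurs once for each of its positive powers dividing \<open>N\<close>, hence as
  often as in the factorization of \<open>N\<close>.\<close>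

lemma prod_aprimedivisor_primepow_factors:
  assumes "0 < (N::nat)" shows "(\<Prod>s\<in>primepow_factors N. aprimedivisor s) = N"
proof -
  have "image_mset aprimedivisor (mset_set (primepow_factors N)) = prime_factorization N"
    using assms by (intro aprimedivisor_primepow_factors_conv_prime_factorization) simp
  then show ?thesis
    using assms prod_mset_prime_factorization_nat[of N] by (simp add: prod_unfold_prod_mset)
qed

section \<open>Integrality of cofactors\<close>

definition int_coeffs :: "complex poly \<Rightarrow> bool" where
  "int_coeffs f \<longleftrightarrow> (\<forall>i. coeff f i \<in> \<int>)"

lemma int_coeffs_mult: "int_coeffs f \<Longrightarrow> int_coeffs g \<Longrightarrow> int_coeffs (f * g)"
  unfolding int_coeffs_def coeff_mult by (auto intro!: Ints_sum)

lemma int_coeffs_sum: "(\<And>i. i \<in> S \<Longrightarrow> int_coeffs (f i)) \<Longrightarrow> int_coeffs (\<Sum>i\<in>S. f i)"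
  unfolding int_coeffs_def coeff_sum by (auto intro!: Ints_sum)

lemma int_coeffs_monom: "c \<in> \<int> \<Longrightarrow> int_coeffs (monom c n)"
  unfolding int_coeffs_def by simp

lemma int_coeffs_prod: "(\<And>i. i \<in> S \<Longrightarrow> int_coeffs (f i)) \<Longrightarrow> int_coeffs (\<Prod>i\<in>S. f i)"
proof (induction S rule: infinite_finite_induct)
  case (insert x S) then show ?case by (simp add: int_coeffs_mult)
qed (auto simp: int_coeffs_def)

lemma int_coeffs_cyclotomic: "primepow s \<Longrightarrow> int_coeffs (cyclotomic s)"
  by (elim primepowE) (auto simp: cyclotomic_prime_power intro!: int_coeffs_sum int_coeffs_monom simp del: power_Suc)

text \<open>Division by a monic polynomial, from the top coefficient of \<open>g\<close> downwards:
  coefficient \<open>degree f + i\<close> of the product is \<open>coeff g i\<close> plus integer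
  multiples of higher coefficients of \<open>g\<close>.\<close>

lemma int_coeffs_cofactor:
  assumes fg: "int_coeffs (f * g)" and f: "int_coeffs f" "lead_coeff f = 1"
  shows "int_coeffs g"
proof -
  have "coeff g i \<in> \<int>" for i
  proof (induction "degree g - i" arbitrary: i rule: less_induct)
    case less
    show ?case
    proof (cases "i > degree g")
      case True then show ?thesis by (simp add: coeff_eq_0)
    next
      case False
      let ?d = "degree f"
      have "coeff (f * g) (?d + i) = (\<Sum>j\<le>?d + i. coeff f j * coeff g (?d + i - j))"
        by (rule coeff_mult)
      also have "\<dots> = coeff g i + (\<Sum>j\<in>{..?d + i} - {?d}. coeff f j * coeff g (?d + i - j))"
        by (subst sum.remove[of _ ?d]) (use f in auto)
      finally have "coeff g i = coeff (f * g) (?d + i) - (\<Sum>j\<in>{..?d + i} - {?d}. coeff f j * coeff g (?d + i - j))"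
        by simp
      also have "\<dots> \<in> \<int>"
      proof (intro Ints_diff Ints_sum)
        fix j assume j: "j \<in> {..?d + i} - {?d}"
        show "coeff f j * coeff g (?d + i - j) \<in> \<int>"
        proof (cases "j > ?d")
          case True then show ?thesis by (simp add: coeff_eq_0)
        next
          case f': False
          show ?thesis
          proof (cases "?d + i - j > degree g")
            case True then show ?thesis by (simp add: coeff_eq_0)
          next
            case False
            then have "coeff g (?d + i - j) \<in> \<int>" using j f' by (intro less) auto
            then show ?thesis using f by (auto simp: int_coeffs_def)
          qed
        qed
      qed (use fg in \<open>auto simp: int_coeffs_def\<close>)
      finally show ?thesis .
    qed
  qed
  then show ?thesis by (simp add: int_coeffs_def)
qed

text \<open>Roots of different orders are different, so the product still has only simple
  roots.\<close>

lemma prod_cyclotomic_dvd: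
  assumes "finite S" "\<And>s. s \<in> S \<Longrightarrow> 0 < s" "\<And>s. s \<in> S \<Longrightarrow> cyclotomic s dvd f"
  shows "(\<Prod>s\<in>S. cyclotomic s) dvd f"
proof -
  let ?g = "\<lambda>(s, k). cis (2 * pi * real k / real s)"
  let ?T = "Sigma S (\<lambda>s. {k. k \<in> {1..s} \<and> coprime k s})"
  have pr: "prim_root s (?g (s, k))" if "(s, k) \<in> ?T" for s k
    using that assms(2) by (auto simp: prim_root_iff_cis)
  have "(\<Prod>s\<in>S. cyclotomic s) = (\<Prod>x\<in>?T. [:- ?g x, 1:])"
    unfolding cyclotomic_def using assms(1) by (subst prod.Sigma) (auto simp: case_prod_unfold)
  moreover have "inj_on ?g ?T"
  proof (rule inj_onI)
    fix x y assume xy: "x \<in> ?T" "y \<in> ?T" "?g x = ?g y"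
    obtain s k t l where [simp]: "x = (s, k)" "y = (t, l)" by (cases x, cases y)
    have "s = t" using prim_root_unique pr[of s k] pr[of t l] xy by simp
    moreover from this have "k = l"
      using xy inj_onD[OF cyclotomic_root_inj[of s], of k l] assms(2) by auto
    ultimately show "x = y" by simp
  qed
  moreover have "poly f (?g x) = 0" if "x \<in> ?T" for x
  proof -
    obtain s k where x: "x = (s, k)" by (cases x)
    then have "s \<in> S" using that by auto
    then have "0 < s" "cyclotomic s dvd f" using assms by auto
    then show ?thesis using cyclotomic_dvd_iff pr[of s k] that x by auto
  qed
  ultimately show ?thesis using assms(1) by (simp add: prod_linear_dvd_iff)
qed

text \<open>Take the cofactor of the product of the \<Phi>_s in A(X) and evaluate at 1: each
  \<Phi>_s contributes the prime below \<open>s\<close>, and the cofactor has integer coefficients.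
  This is the half of T1 shared by all finite nonempty sets.\<close>

lemma prod_aprimedivisor_dvd_card:
  assumes A: "finite A" "A \<noteq> {}" and S: "finite S" "\<And>s. s \<in> S \<Longrightarrow> primepow s" "\<And>s. s \<in> S \<Longrightarrow> vanishes A s"
  shows "(\<Prod>s\<in>S. aprimedivisor s) dvd card A"
proof -
  let ?P = "\<Prod>s\<in>S. cyclotomic s"
  have pos: "0 < s" if "s \<in> S" for s using S(2)[OF that] by (rule primepow_gt_0_nat)
  have "?P dvd mask_poly A"
    by (rule prod_cyclotomic_dvd) (use S pos cyclotomic_dvd_mask_iff[OF A] in auto)
  then obtain g where g: "mask_poly A = ?P * g" by (elim dvdE)
  have "int_coeffs g"
  proof (rule int_coeffs_cofactor)
    show "int_coeffs (?P * g)" unfolding g[symmetric] mask_poly_def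
      by (intro int_coeffs_sum int_coeffs_monom) simp
    show "int_coeffs ?P" using S by (intro int_coeffs_prod int_coeffs_cyclotomic)
    show "lead_coeff ?P = 1" by (subst lead_coeff_prod) (simp add: lead_coeff_cyclotomic)
  qed
  then have "poly g 1 \<in> \<int>" unfolding int_coeffs_def poly_altdef by (auto intro!: Ints_sum)
  then obtain k where k: "poly g 1 = of_int k" by (auto elim: Ints_cases)
  have "of_nat (card A) = poly ?P 1 * poly g 1"
    using poly_mask_poly_1[OF A] g by simp
  also have "poly ?P 1 = of_nat (\<Prod>s\<in>S. aprimedivisor s)"
    using S by (simp add: poly_prod poly_cyclotomic_primepow_1)
  finally have "(of_int (int (card A)) :: complex) = of_int (int (\<Prod>s\<in>S. aprimedivisor s) * k)"
    unfolding k by simp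
  then have "int (card A) = int (\<Prod>s\<in>S. aprimedivisor s) * k" using of_int_eq_iff by blast
  then have "int (\<Prod>s\<in>S. aprimedivisor s) dvd int (card A)" by simp
  then show ?thesis using of_nat_dvd_iff by blast
qed

section \<open>The conditions T1 and T2 in terms of vanishing\<close>

lemma S_set_iff:
  assumes "finite A" "A \<noteq> {}"
  shows "s \<in> S_set A \<longleftrightarrow> primepow s \<and> vanishes A s"
proof -
  have "(\<exists>p a. prime p \<and> 1 \<le> a \<and> s = p ^ a) \<longleftrightarrow> primepow s"
    unfolding primepow_def by (simp add: Suc_le_eq)
  then show ?thesis
    using cyclotomic_dvd_mask_iff[OF assms, of s] primepow_gt_0_nat[of s] unfolding S_set_def by auto
qed

lemma T1_iff:
  assumes "finite A" "A \<noteq> {}"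
  shows "T1 A \<longleftrightarrow> card A = (\<Prod>s\<in>S_set A. aprimedivisor s)"
proof -
  have "(\<Prod>s\<in>S_set A. poly (cyclotomic s) 1) = of_nat (\<Prod>s\<in>S_set A. aprimedivisor s)"
    using S_set_iff[OF assms] by (simp add: poly_cyclotomic_primepow_1)
  then show ?thesis unfolding T1_def poly_mask_poly_1[OF assms] of_nat_eq_iff[symmetric, where 'a = complex]
    by simp
qed

lemma T2_iff:
  assumes "finite A" "A \<noteq> {}"
  shows "T2 A \<longleftrightarrow> (\<forall>P e. finite P \<longrightarrow> P \<noteq> {} \<longrightarrow> (\<forall>p\<in>P. prime p \<and> 1 \<le> e p \<and> vanishes A (p ^ e p)) \<longrightarrow>
     vanishes A (\<Prod>p\<in>P. p ^ e p))"
proof -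
  have *: "prime p \<and> 1 \<le> (e::nat) \<and> p ^ e \<in> S_set A \<longleftrightarrow> prime p \<and> 1 \<le> e \<and> vanishes A (p ^ e)" for p e
    using S_set_iff[OF assms] by auto
  have **: "cyclotomic (\<Prod>p\<in>P. p ^ e p) dvd mask_poly A \<longleftrightarrow> vanishes A (\<Prod>p\<in>P. p ^ e p)"
    if "\<forall>p\<in>P. prime p \<and> 1 \<le> e p \<and> vanishes A (p ^ e p)" for P e
    using that prime_gt_0_nat by (intro cyclotomic_dvd_mask_iff[OF assms] prod_pos) auto
  show ?thesis unfolding T2_def * using ** by (meson)
qed

section \<open>Tilings of the integers\<close>

definition tiling :: "int set \<Rightarrow> int set \<Rightarrow> bool" where
  "tiling A B \<longleftrightarrow> (\<forall>g. \<exists>!a. a \<in> A \<and> g - a \<in> B)"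

definition periodic :: "nat \<Rightarrow> int set \<Rightarrow> bool" where
  "periodic N B \<longleftrightarrow> 0 < N \<and> (\<forall>x. x + int N \<in> B \<longleftrightarrow> x \<in> B)"

lemma tiles_int_iff: "tiles_int A \<longleftrightarrow> (\<exists>B. tiling A B)"
proof -
  have "(\<exists>!ab. ab \<in> A \<times> B \<and> g = fst ab + snd ab) \<longleftrightarrow> (\<exists>!a. a \<in> A \<and> g - a \<in> B)" for B and g :: int
  proof
    assume "\<exists>!ab. ab \<in> A \<times> B \<and> g = fst ab + snd ab"
    then obtain c where c: "c \<in> A \<times> B" "g = fst c + snd c"
      and uniq: "\<And>d. d \<in> A \<times> B \<and> g = fst d + snd d \<Longrightarrow> d = c" by (elim ex1E) metis
    show "\<exists>!a. a \<in> A \<and> g - a \<in> B"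
    proof (rule ex1I[of _ "fst c"])
      show "fst c \<in> A \<and> g - fst c \<in> B" using c by auto
      fix a assume "a \<in> A \<and> g - a \<in> B"
      then show "a = fst c" using uniq[of "(a, g - a)"] by auto
    qed
  next
    assume "\<exists>!a. a \<in> A \<and> g - a \<in> B"
    then obtain a where a: "a \<in> A" "g - a \<in> B" and uniq: "\<And>c. c \<in> A \<Longrightarrow> g - c \<in> B \<Longrightarrow> c = a" by blast
    show "\<exists>!ab. ab \<in> A \<times> B \<and> g = fst ab + snd ab"
    proof (rule ex1I[of _ "(a, g - a)"])
      fix c assume "c \<in> A \<times> B \<and> g = fst c + snd c"
      then show "c = (a, g - a)" using uniq[of "fst c"] by (cases c) auto
    qed (use a in auto)
  qed
  then show ?thesis unfolding tiles_int_def tiling_def by simp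
qed

lemma tilingE:
  assumes "tiling A B" obtains a where "a \<in> A" "g - a \<in> B"
  using assms unfolding tiling_def by blast

lemma tilingD: "tiling A B \<Longrightarrow> a \<in> A \<Longrightarrow> a' \<in> A \<Longrightarrow> g - a \<in> B \<Longrightarrow> g - a' \<in> B \<Longrightarrow> a = a'"
  unfolding tiling_def by blast

lemma tilingI:
  assumes "\<And>g. \<exists>a\<in>A. g - a \<in> B" "\<And>g a a'. a \<in> A \<Longrightarrow> a' \<in> A \<Longrightarrow> g - a \<in> B \<Longrightarrow> g - a' \<in> B \<Longrightarrow> a = a'"
  shows "tiling A B"
  using assms unfolding tiling_def by blast

lemma tiling_nonempty: "tiling A B \<Longrightarrow> A \<noteq> {}"
  unfolding tiling_def by blast

lemma tiling_translate:
  assumes "tiling A B" shows "tiling ((\<lambda>a. a + k) ` A) B"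
proof (rule tilingI)
  fix g
  obtain a where "a \<in> A" "g - k - a \<in> B" using tilingE[OF assms] by blast
  then show "\<exists>a\<in>(\<lambda>a. a + k) ` A. g - a \<in> B" by (auto simp: algebra_simps)
next
  fix g a a' assume "a \<in> (\<lambda>a. a + k) ` A" "a' \<in> (\<lambda>a. a + k) ` A" "g - a \<in> B" "g - a' \<in> B"
  then show "a = a'" using tilingD[OF assms, of "a - k" "a' - k" "g - k"] by auto
qed

lemma tiling_translate_right:
  assumes "tiling A B" shows "tiling A ((\<lambda>b. b + k) ` B)"
proof (rule tilingI)
  have *: "x \<in> (\<lambda>b. b + k) ` B \<longleftrightarrow> x - k \<in> B" for x by force
  {
    fix g
    obtain a where "a \<in> A" "g - k - a \<in> B" using tilingE[OF assms] by blast
    then show "\<exists>a\<in>A. g - a \<in> (\<lambda>b. b + k) ` B" unfolding * by (auto simp: algebra_simps)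
  next
    fix g a a' assume "a \<in> A" "a' \<in> A" "g - a \<in> (\<lambda>b. b + k) ` B" "g - a' \<in> (\<lambda>b. b + k) ` B"
    then show "a = a'" unfolding * using tilingD[OF assms, of a a' "g - k"] by (auto simp: algebra_simps)
  }
qed

lemma periodic_translate: "periodic N B \<Longrightarrow> periodic N ((\<lambda>b. b + k) ` B)"
proof -
  have *: "x \<in> (\<lambda>b. b + k) ` B \<longleftrightarrow> x - k \<in> B" for x by force
  have **: "x + int N - k = (x - k) + int N" for x by simp
  show "periodic N B \<Longrightarrow> ?thesis" unfolding periodic_def * ** by blast
qed

lemma periodic_pos: "periodic N B \<Longrightarrow> 0 < N" by (simp add: periodic_def)

lemma periodic_add_mult:
  assumes "periodic N B" shows "x + int N * k \<in> B \<longleftrightarrow> x \<in> B"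
proof (induction k rule: int_induct[of _ 0])
  case (step1 k)
  have "x + int N * (k + 1) = (x + int N * k) + int N" by (simp add: algebra_simps)
  then show ?case using step1 assms unfolding periodic_def by metis
next
  case (step2 k)
  have "x + int N * k = (x + int N * (k - 1)) + int N" by (simp add: algebra_simps)
  then show ?case using step2 assms unfolding periodic_def by metis
qed simp

lemma periodic_mod: "periodic N B \<Longrightarrow> x mod int N \<in> B \<longleftrightarrow> x \<in> B"
  using periodic_add_mult[of N B "x mod int N" "x div int N"] by simp

lemma card_eq_1_iff_ex1: "card {x. P x} = 1 \<longleftrightarrow> (\<exists>!x. P x)"
proof
  assume "card {x. P x} = 1"
  then obtain x where x: "{x. P x} = {x}" by (rule card_1_singletonE)
  have "P y \<longleftrightarrow> y = x" for y
    using arg_cong[OF x, of "\<lambda>S. y \<in> S"] by simp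
  then show "\<exists>!x. P x" by simp
next
  assume "\<exists>!x. P x"
  then obtain x where "P x \<and> (\<forall>y. P y \<longrightarrow> y = x)" by (rule ex1E) blast
  then have "{x. P x} = {x}" by auto
  then show "card {x. P x} = 1" by simp
qed

lemma tiling_iff_sum:
  assumes "finite A"
  shows "tiling A B \<longleftrightarrow> (\<forall>g. (\<Sum>a\<in>A. of_bool (g - a \<in> B)) = (1 :: int))"
proof -
  have "(\<Sum>a\<in>A. of_bool (g - a \<in> B)) = int (card {a \<in> A. g - a \<in> B})" for g
    using assms by (simp add: Collect_conj_eq Int_commute)
  then show ?thesis unfolding tiling_def card_eq_1_iff_ex1[symmetric] by simp
qed

text \<open>A complement is determined in both directions by any window as long as the tile, so a
  repeated window makes it periodic.\<close>

lemma tiling_periodic: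
  assumes A: "finite A" and AB: "tiling A B"
  obtains N where "periodic N B"
proof -
  define m M where "m = Min A" and "M = Max A"
  have mM: "m \<in> A" "M \<in> A" "\<And>a. a \<in> A \<Longrightarrow> m \<le> a \<and> a \<le> M"
    using A tiling_nonempty[OF AB] by (auto simp: m_def M_def)
  define D where "D = nat (M - m)"
  have D: "int D = M - m" using mM(3)[OF mM(1)] by (simp add: D_def)
  \<comment> \<open>The point \<open>x + c\<close> is covered exactly once, so it is covered through
    \<open>c\<close> iff no other element of \<open>A\<close> covers it.\<close>
  have det: "x \<in> B \<longleftrightarrow> (\<forall>a\<in>A - {c}. x + c - a \<notin> B)" if "c \<in> A" for c x
  proof -
    obtain a where "a \<in> A" "x + c - a \<in> B" using tilingE[OF AB] by blast
    then show ?thesis using tilingD[OF AB, of _ c "x + c"] that by (cases "a = c") fastforce+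
  qed
  \<comment> \<open>With \<open>c = m\<close> all points \<open>x + m - a\<close> precede
    \<open>x\<close> by at most \<open>D\<close>; in \<open>bwd\<close>, with \<open>c = M\<close>,
    they follow \<open>x\<close> by at most \<open>D\<close>.\<close>
  have fwd: "x \<in> B \<longleftrightarrow> y \<in> B"
    if H: "\<And>k. 1 \<le> k \<Longrightarrow> k \<le> int D \<Longrightarrow> x - k \<in> B \<longleftrightarrow> y - k \<in> B" for x y
  proof -
    have "x + m - a \<in> B \<longleftrightarrow> y + m - a \<in> B" if "a \<in> A - {m}" for a
    proof -
      have "m < a" "a \<le> M" using mM(3)[of a] that by auto
      then show ?thesis using that H[of "a - m"] D by (simp add: algebra_simps)
    qed
    then show ?thesis using det[OF mM(1), of x] det[OF mM(1), of y] by blast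
  qed
  have bwd: "x \<in> B \<longleftrightarrow> y \<in> B"
    if H: "\<And>k. 1 \<le> k \<Longrightarrow> k \<le> int D \<Longrightarrow> x + k \<in> B \<longleftrightarrow> y + k \<in> B" for x y
  proof -
    have "x + M - a \<in> B \<longleftrightarrow> y + M - a \<in> B" if "a \<in> A - {M}" for a
    proof -
      have "a < M" "m \<le> a" using mM(3)[of a] that by auto
      then show ?thesis using that H[of "M - a"] D by (simp add: algebra_simps)
    qed
    then show ?thesis using det[OF mM(2), of x] det[OF mM(2), of y] by blast
  qed
  \<comment> \<open>The pattern of \<open>B\<close> on a window of length \<open>D\<close> is one of
    finitely many subsets, so two windows agree.\<close>
  define W where "W = (\<lambda>i :: nat. {k \<in> {0..<int D}. int i + k \<in> B})"
  have "range W \<subseteq> Pow {0..<int D}" by (auto simp: W_def)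
  then have "finite (range W)" by (rule finite_subset) simp
  then have "\<not> inj W" using finite_imageD[of W UNIV] by auto
  then obtain i j where ij: "i < j" "W i = W j" unfolding inj_on_def by (metis linorder_neqE_nat)
  define N where "N = j - i"
  have win: "int i + k \<in> B \<longleftrightarrow> int i + k + int N \<in> B" if "0 \<le> k" "k < int D" for k
  proof -
    have "k \<in> W i \<longleftrightarrow> k \<in> W j" using ij by simp
    moreover have "int j + k = int i + k + int N" using ij by (simp add: N_def)
    ultimately show ?thesis using that by (simp add: W_def)
  qed
  have up: "int i + int k \<in> B \<longleftrightarrow> int i + int k + int N \<in> B" for k
  proof (induction k rule: less_induct)
    case (less k)
    show ?case
    proof (cases "k < D")
      case True then show ?thesis using win[of "int k"] by simp
    next
      case False
      show ?thesis
      proof (rule fwd)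
        fix l assume l: "1 \<le> l" "l \<le> int D"
        define k' where "k' = k - nat l"
        have k': "k' < k" "int k' = int k - l" using l False by (auto simp: k'_def)
        show "int i + int k - l \<in> B \<longleftrightarrow> int i + int k + int N - l \<in> B"
          using less[OF k'(1)] k'(2) by (simp add: algebra_simps)
      qed
    qed
  qed
  have down: "int i - int k \<in> B \<longleftrightarrow> int i - int k + int N \<in> B" for k
  proof (induction k rule: less_induct)
    case (less k)
    show ?case
    proof (rule bwd)
      fix l assume l: "1 \<le> l" "l \<le> int D"
      show "int i - int k + l \<in> B \<longleftrightarrow> int i - int k + int N + l \<in> B"
      proof (cases "l < int k")
        case True
        define k' where "k' = k - nat l"
        have k': "k' < k" "int k' = int k - l" using l True by (auto simp: k'_def)
        show ?thesis using less[OF k'(1)] k'(2) by (simp add: algebra_simps)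
      next
        case False
        then show ?thesis using up[of "nat (l - int k)"] by (simp add: algebra_simps)
      qed
    qed
  qed
  have "x + int N \<in> B \<longleftrightarrow> x \<in> B" for x
    using up[of "nat (x - int i)"] down[of "nat (int i - x)"] by (cases "x \<ge> int i") auto
  then have "periodic N B" using ij by (simp add: periodic_def N_def)
  then show ?thesis using that by blast
qed

lemma sum_periodic_shift:
  fixes h :: "int \<Rightarrow> 'a :: comm_monoid_add"
  assumes N: "0 < N" and h: "\<And>x. h (x mod N) = h x"
  shows "(\<Sum>g\<in>{0..<N}. h (g + k)) = (\<Sum>g\<in>{0..<N}. h g)"
proof (rule sum.reindex_bij_witness[of _ "\<lambda>g. (g - k) mod N" "\<lambda>g. (g + k) mod N"])
  fix g assume "g \<in> {0..<N}"
  then show "((g + k) mod N - k) mod N = g" "((g - k) mod N + k) mod N = g"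
    by (auto simp: mod_simps)
  show "h ((g + k) mod N) = h (g + k)" by (rule h)
qed (use N in auto)

section \<open>Polynomials acting on functions on the integers\<close>

text \<open>The module structure in which X is the shift by 1. A tiling becomes the equation that
  A(X) sends the indicator of \<open>B\<close> to the constant 1, and polynomial identities apply to
  it although \<open>B\<close> is infinite.\<close>

definition act :: "'a :: comm_ring_1 poly \<Rightarrow> (int \<Rightarrow> 'a) \<Rightarrow> int \<Rightarrow> 'a" where
  "act f h g = (\<Sum>i\<le>degree f. coeff f i * h (g - int i))"

lemma act_conv_sum: "degree f \<le> n \<Longrightarrow> act f h g = (\<Sum>i\<le>n. coeff f i * h (g - int i))"
  unfolding act_def by (rule sum.mono_neutral_left) (auto simp: coeff_eq_0)

lemma act_0 [simp]: "act 0 h = (\<lambda>g. 0)"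
  by (auto simp: act_def)

lemma act_add: "act (f1 + f2) h g = act f1 h g + act f2 h g"
proof -
  let ?n = "max (degree f1) (degree f2)"
  show ?thesis
    by (subst (1 2 3) act_conv_sum[of _ ?n]) (auto simp: degree_add_le algebra_simps sum.distrib)
qed

lemma act_smult: "act (smult c f) h g = c * act f h g"
  by (subst (1 2) act_conv_sum[of _ "degree f"]) (auto simp: degree_smult_le sum_distrib_left mult_ac)

lemma act_pCons: "act (pCons a f) h g = a * h g + act f h (g - 1)"
proof -
  have "act (pCons a f) h g = (\<Sum>i\<le>Suc (degree f). coeff (pCons a f) i * h (g - int i))"
    by (rule act_conv_sum) (simp add: degree_pCons_le)
  also have "\<dots> = a * h g + (\<Sum>i\<le>degree f. coeff f i * h (g - 1 - int i))"
    by (subst sum.atMost_Suc_shift) (simp add: algebra_simps)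
  finally show ?thesis by (simp add: act_def)
qed

lemma act_mult: "act (f1 * f2) h g = act f1 (act f2 h) g"
proof (induction f1 arbitrary: g)
  case (pCons a f1)
  then show ?case by (simp add: act_pCons act_add act_smult)
qed simp

lemma act_sum: "act (\<Sum>i\<in>S. f i) h g = (\<Sum>i\<in>S. act (f i) h g)"
  by (induction S rule: infinite_finite_induct) (auto simp: act_add)

lemma act_monom: "act (monom c n) h g = c * h (g - int n)"
  by (induction n arbitrary: g) (auto simp: monom_0 monom_Suc act_pCons algebra_simps)

text \<open>The middle binomial coefficients are divisible by \<open>p\<close>. The congruence is
  stated with an explicit multiple of \<open>p\<close>, so that it can be used for polynomials and
  then passed through \<open>act\<close>.\<close>

lemma freshman_sum:
  fixes x :: "'b \<Rightarrow> 'a :: comm_ring_1"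
  assumes p: "prime p" and S: "finite S"
  shows "\<exists>q. (\<Sum>i\<in>S. x i) ^ p = (\<Sum>i\<in>S. x i ^ p) + of_nat p * q"
  using S
proof (induction S rule: finite_induct)
  case empty
  then show ?case using p by (intro exI[of _ 0]) (auto simp: power_0_left prime_gt_0_nat)
next
  case (insert j S)
  then obtain q where q: "(\<Sum>i\<in>S. x i) ^ p = (\<Sum>i\<in>S. x i ^ p) + of_nat p * q" by blast
  let ?y = "\<Sum>i\<in>S. x i"
  have p0: "0 < p" using p prime_gt_0_nat by blast
  have "\<exists>r. (x j + ?y) ^ p = x j ^ p + ?y ^ p + of_nat p * r"
  proof -
    have "(x j + ?y) ^ p = (\<Sum>k\<le>p. of_nat (p choose k) * x j ^ k * ?y ^ (p - k))"
      by (rule binomial_ring)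
    also have "{..p} = insert 0 (insert p {0<..<p})" using p0 by auto
    also have "(\<Sum>k\<in>\<dots>. of_nat (p choose k) * x j ^ k * ?y ^ (p - k)) =
        ?y ^ p + (x j ^ p + (\<Sum>k\<in>{0<..<p}. of_nat (p choose k) * x j ^ k * ?y ^ (p - k)))"
      using p0 by (subst sum.insert; simp)+
    also have "(\<Sum>k\<in>{0<..<p}. of_nat (p choose k) * x j ^ k * ?y ^ (p - k)) =
        (\<Sum>k\<in>{0<..<p}. of_nat p * (of_nat ((p choose k) div p) * x j ^ k * ?y ^ (p - k)))"
    proof (rule sum.cong[OF refl])
      fix k assume k: "k \<in> {0<..<p}"
      then have "p dvd (p choose k)" using p by (intro dvd_choose_prime) auto
      then have "(of_nat (p choose k) :: 'a) = of_nat p * of_nat ((p choose k) div p)"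
        by (simp flip: of_nat_mult)
      then show "of_nat (p choose k) * x j ^ k * ?y ^ (p - k) =
        of_nat p * (of_nat ((p choose k) div p) * x j ^ k * ?y ^ (p - k))" by (simp add: mult_ac)
    qed
    also have "\<dots> = of_nat p * (\<Sum>k\<in>{0<..<p}. of_nat ((p choose k) div p) * x j ^ k * ?y ^ (p - k))"
      by (rule sum_distrib_left[symmetric])
    finally have "(x j + ?y) ^ p = x j ^ p + ?y ^ p +
      of_nat p * (\<Sum>k\<in>{0<..<p}. of_nat ((p choose k) div p) * x j ^ k * ?y ^ (p - k))"
      by simp
    then show ?thesis ..
  qed
  then obtain r where r: "(x j + ?y) ^ p = x j ^ p + ?y ^ p + of_nat p * r" by blast
  show ?case using insert.hyps r q
    by (intro exI[of _ "q + r"]) (simp add: algebra_simps)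
qed

section \<open>Tijdeman's theorem and the condition T1\<close>

text \<open>Let \<open>c g\<close> count the representations of \<open>g\<close> in p I + B. As
  \<open>f\<close> sends the indicator of \<open>B\<close> to 1, \<open>f ^ p\<close> sends it to
  the constant |I|^(p-1), and f(X)^p \<equiv> f(X^p) modulo \<open>p\<close> shows that
  \<open>p\<close> does not divide \<open>c g\<close>. Thus \<open>c\<close> is everywhere at least
  1, while its average over a period is 1.\<close>

lemma tijdeman_nat:
  fixes I :: "nat set"
  assumes I: "finite I" and AB: "tiling (int ` I) B" and per: "periodic N B"
    and p: "prime p" "\<not> p dvd card I"
  shows "tiling ((\<lambda>i. int p * int i) ` I) B"
proof -
  define h :: "int \<Rightarrow> int" where "h = (\<lambda>x. of_bool (x \<in> B))"
  define f :: "int poly" where "f = (\<Sum>i\<in>I. monom 1 i)"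
  define c where "c = (\<lambda>g. \<Sum>i\<in>I. h (g - int p * int i))"
  have p0: "0 < p" using p prime_gt_0_nat by blast
  have f1: "act f h g = 1" for g
  proof -
    have "(\<Sum>a\<in>int ` I. h (g - a)) = 1"
      using AB unfolding tiling_iff_sum[OF finite_imageI[OF I]] h_def by blast
    then have "(\<Sum>i\<in>I. h (g - int i)) = 1" by (subst (asm) sum.reindex) auto
    then show ?thesis by (simp add: f_def act_sum act_monom)
  qed
  have f1': "act f h = (\<lambda>_. 1)" using f1 by blast
  have fc: "act f (\<lambda>_. k) g = int (card I) * k" for k g
    by (simp add: f_def act_sum act_monom)
  have fn: "act (f ^ Suc n) h = (\<lambda>_. int (card I) ^ n)" for n
  proof (induction n)
    case (Suc n)
    have "act (f ^ Suc (Suc n)) h g = act f (act (f ^ Suc n) h) g" for g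
      by (subst power_Suc) (rule act_mult)
    then show ?case unfolding Suc fc by (simp add: fun_eq_iff)
  qed (simp add: f1')
  obtain q where q: "f ^ p = (\<Sum>i\<in>I. monom 1 i ^ p) + of_nat p * q"
    using freshman_sum[OF p(1) I, of "monom (1::int)"] unfolding f_def by blast
  have cpos: "1 \<le> c g" for g
  proof -
    have "act (f ^ p) h g = c g + int p * act q h g"
      unfolding q act_add act_sum monom_power
      by (simp add: act_monom c_def mult.commute[of _ p] of_nat_poly act_smult)
    moreover have "act (f ^ p) h g = int (card I) ^ (p - 1)"
      using fn[of "p - 1"] p0 by (simp add: fun_eq_iff)
    ultimately have "c g = int (card I) ^ (p - 1) - int p * act q h g" by simp
    moreover have "\<not> int p dvd int (card I) ^ (p - 1)"
      using p by (metis of_nat_dvd_iff of_nat_power prime_dvd_power_nat)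
    ultimately have "\<not> int p dvd c g" by (simp add: dvd_diff_left_iff)
    then have "c g \<noteq> 0" by auto
    moreover have "c g \<ge> 0" unfolding c_def h_def by (intro sum_nonneg) auto
    ultimately show ?thesis by linarith
  qed
  have N: "0 < int N" using periodic_pos[OF per] by simp
  have hmod: "h (x mod int N) = h x" for x
    unfolding h_def using periodic_mod[OF per] by simp
  have hshift: "(\<Sum>g\<in>{0..<int N}. h (g - k)) = (\<Sum>g\<in>{0..<int N}. h g)" for k
    using sum_periodic_shift[where h = h and N = "int N" and k = "- k", OF N hmod] by simp
  have "(\<Sum>g\<in>{0..<int N}. c g) = (\<Sum>i\<in>I. \<Sum>g\<in>{0..<int N}. h (g - int p * int i))"
    unfolding c_def by (rule sum.swap)
  also have "\<dots> = (\<Sum>i\<in>I. \<Sum>g\<in>{0..<int N}. h (g - int i))" unfolding hshift ..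
  also have "\<dots> = (\<Sum>g\<in>{0..<int N}. act f h g)"
    unfolding f_def act_sum act_monom by (subst sum.swap) simp
  also have "\<dots> = (\<Sum>g\<in>{0..<int N}. 1)" unfolding f1 ..
  finally have "(\<Sum>g\<in>{0..<int N}. c g - 1) = 0" by (simp add: sum_subtractf)
  moreover have cpos': "0 \<le> c g - 1" "0 < c g" for g using cpos[of g] by simp_all
  ultimately have c1: "c g = 1" if "g \<in> {0..<int N}" for g
    using that sum_nonneg_eq_0_iff[of "{0..<int N}" "\<lambda>g. c g - 1"] cpos' by auto
  have "c g = 1" for g
  proof -
    have "c g = c (g mod int N)"
    proof -
      have "h ((g mod int N) - k) = h (g - k)" for k
        using hmod[of "(g mod int N) - k"] hmod[of "g - k"] by (simp add: mod_simps)
      then show ?thesis unfolding c_def by simp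
    qed
    then show ?thesis using c1 N by simp
  qed
  then have "(\<Sum>a\<in>(\<lambda>i. int p * int i) ` I. h (g - a)) = 1" for g
    using p0 by (subst sum.reindex) (auto simp: inj_on_def c_def)
  then show ?thesis using tiling_iff_sum[OF finite_imageI[OF I]] unfolding h_def by blast
qed

text \<open>A translation makes the elements nonnegative, so that they can serve as
  exponents.\<close>

lemma tijdeman_prime:
  assumes A: "finite A" and AB: "tiling A B" and per: "periodic N B"
    and p: "prime p" "\<not> p dvd card A"
  shows "tiling ((\<lambda>a. int p * a) ` A) B"
proof -
  define m where "m = Min A"
  define I where "I = (\<lambda>a. nat (a - m)) ` A"
  have le: "m \<le> a" if "a \<in> A" for a using A that by (simp add: m_def)
  have inj: "inj_on (\<lambda>a. nat (a - m)) A"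
  proof (rule inj_onI)
    fix x y assume "x \<in> A" "y \<in> A" "nat (x - m) = nat (y - m)"
    then show "x = y" using le[of x] le[of y] by simp
  qed
  have "int ` I = (\<lambda>a. a + (- m)) ` A" unfolding I_def image_image using le by (intro image_cong) auto
  then have "tiling (int ` I) B" using tiling_translate[OF AB, of "- m"] by simp
  moreover have "card I = card A" unfolding I_def using inj by (rule card_image)
  ultimately have "tiling ((\<lambda>i. int p * int i) ` I) B"
    using tijdeman_nat[of I B N p] per p A by (simp add: I_def)
  from tiling_translate[OF this, of "int p * m"]
  have "tiling ((\<lambda>i. int p * int i + int p * m) ` I) B" by (simp add: image_image)
  also have "(\<lambda>i. int p * int i + int p * m) ` I = (\<lambda>a. int p * a) ` A"
    unfolding I_def image_image using le by (intro image_cong) (auto simp: algebra_simps)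
  finally show ?thesis .
qed

text \<open>The prime factors of \<open>r\<close> are treated one at a time; each dilation keeps
  both the complement and the cardinality.\<close>

lemma tijdeman:
  assumes A: "finite A" and AB: "tiling A B" and per: "periodic N B"
    and r: "0 < r" "coprime r (card A)"
  shows "tiling ((\<lambda>a. int r * a) ` A) B"
  using r
proof (induction r rule: less_induct)
  case (less r)
  show ?case
  proof (cases "r = 1")
    case True
    then show ?thesis using AB by simp
  next
    case False
    then obtain p where p: "prime p" "p dvd r" using prime_factor_nat by blast
    then obtain s where s: "r = p * s" by blast
    have sr: "s < r" "0 < s" using less.prems(1) p(1) s prime_gt_1_nat[of p] by auto
    have cop: "coprime s (card A)" "coprime p (card A)" using less.prems(2) s by auto
    have "card ((\<lambda>a. int s * a) ` A) = card A"
      using sr(2) by (intro card_image) (auto simp: inj_on_def)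
    moreover have "\<not> p dvd card A" using cop(2) p(1) by (metis coprime_absorb_left not_prime_unit)
    ultimately have "tiling ((\<lambda>a. int p * a) ` (\<lambda>a. int s * a) ` A) B"
      using tijdeman_prime[OF finite_imageI[OF A] less.IH[OF sr cop(1)] per p(1)] by simp
    then show ?thesis unfolding s by (simp add: image_image mult.assoc)
  qed
qed

section \<open>One period of the complement\<close>

definition period_part :: "nat \<Rightarrow> int set \<Rightarrow> int set" where
  "period_part N B = B \<inter> {0..<int N}"

lemma finite_period_part [simp]: "finite (period_part N B)"
  by (simp add: period_part_def)

text \<open>At an N-th root of unity exponents matter only modulo \<open>N\<close>, where
  \<open>A\<close> and one period of \<open>B\<close> represent every residue once.\<close>

lemma mask_eval_mult_period_part:
  assumes A: "finite A" and AB: "tiling A B" and per: "periodic N B" and z: "z ^ N = 1"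
  shows "mask_eval A z * mask_eval (period_part N B) z = (\<Sum>g\<in>{0..<int N}. z powi g)"
proof -
  have N: "0 < int N" using periodic_pos[OF per] by simp
  have z0: "z \<noteq> 0" using z N by (auto simp: power_0_left)
  have zmod: "z powi (g mod int N) = z powi g" for g
  proof -
    have "z powi g = z powi (int N * (g div int N) + g mod int N)" by simp
    also have "\<dots> = z powi (g mod int N)"
      using z z0 by (subst power_int_add) (auto simp: power_int_mult)
    finally show ?thesis by simp
  qed
  have *: "(\<Sum>b\<in>period_part N B. z powi (a + b)) = (\<Sum>g\<in>{0..<int N}. of_bool (g - a \<in> B) * z powi g)" for a
  proof -
    define F where "F = (\<lambda>g. of_bool (g - a \<in> B) * z powi g)"
    have "F (x mod int N) = F x" for x
    proof -
      have "x mod int N - a \<in> B \<longleftrightarrow> x - a \<in> B"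
        using periodic_mod[OF per, of "x mod int N - a"] periodic_mod[OF per, of "x - a"] by (simp add: mod_simps)
      then show ?thesis by (simp add: F_def zmod)
    qed
    from sum_periodic_shift[where h = F and N = "int N" and k = a, OF N this]
    have "(\<Sum>g\<in>{0..<int N}. F g) = (\<Sum>g\<in>{0..<int N}. of_bool (g \<in> B) * z powi (g + a))"
      by (simp add: F_def)
    also have "\<dots> = (\<Sum>b\<in>period_part N B. z powi (a + b))"
      unfolding period_part_def by (rule sum.mono_neutral_cong_right) (auto simp: add.commute)
    finally show ?thesis by (simp add: F_def)
  qed
  have "mask_eval A z * mask_eval (period_part N B) z = (\<Sum>a\<in>A. \<Sum>b\<in>period_part N B. z powi (a + b))"
    using z0 by (simp add: mask_eval_def sum_product power_int_add)
  also have "\<dots> = (\<Sum>g\<in>{0..<int N}. (\<Sum>a\<in>A. of_bool (g - a \<in> B)) * z powi g)"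
    unfolding * by (subst sum.swap) (simp add: sum_distrib_right)
  also have "\<dots> = (\<Sum>g\<in>{0..<int N}. z powi g)"
  proof (rule sum.cong[OF refl])
    fix g
    have "(\<Sum>a\<in>A. of_bool (g - a \<in> B)) = (of_int (\<Sum>a\<in>A. of_bool (g - a \<in> B)) :: complex)" by simp
    also have "\<dots> = 1" using AB tiling_iff_sum[OF A] by simp
    finally show "(\<Sum>a\<in>A. of_bool (g - a \<in> B)) * z powi g = z powi g" by simp
  qed
  finally show ?thesis .
qed

lemma card_mult_period_part:
  assumes "finite A" "tiling A B" "periodic N B"
  shows "card A * card (period_part N B) = N"
proof -
  have "of_nat (card A) * of_nat (card (period_part N B)) = (of_nat N :: complex)"
    using mask_eval_mult_period_part[OF assms, of 1] by (simp add: mask_eval_def)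
  then show ?thesis by (simp only: of_nat_eq_iff flip: of_nat_mult)
qed

lemma mask_eval_mult_period_part_0:
  assumes "finite A" "tiling A B" "periodic N B" "z ^ N = 1" "z \<noteq> 1"
  shows "mask_eval A z = 0 \<or> mask_eval (period_part N B) z = 0"
proof -
  have "(\<Sum>g\<in>{0..<int N}. z powi g) = (\<Sum>g<N. z ^ g)"
    by (rule sum.reindex_bij_witness[of _ int nat]) (auto simp: power_int_def)
  also have "\<dots> = 0" using assms(4,5) by (simp add: geometric_sum)
  finally show ?thesis using mask_eval_mult_period_part[OF assms(1-4)] by simp
qed

text \<open>Tijdeman's theorem replaces the irreducibility of cyclotomic polynomials here.\<close>

lemma vanishes_or_vanishes_period_part:
  assumes A: "finite A" and AB: "tiling A B" and per: "periodic N B" and s: "s dvd N" "1 < s"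
  shows "vanishes A s \<or> vanishes (period_part N B) s"
proof (rule ccontr)
  assume "\<not> (vanishes A s \<or> vanishes (period_part N B) s)"
  then obtain w z where w: "prim_root s w" "mask_eval A w \<noteq> 0" and z: "prim_root s z" "mask_eval (period_part N B) z \<noteq> 0"
    unfolding vanishes_def by blast
  have N: "0 < N" using periodic_pos[OF per] .
  obtain k where k: "coprime k s" "w = z ^ k"
    using prim_root_power_surj_coprime[OF z(1) _ w(1)] s by auto
  \<comment> \<open>The exponent linking the two primitive roots lifts to \<open>r\<close> coprime
    to \<open>N\<close>. Dilating \<open>A\<close> by \<open>r\<close> keeps the complement, and at
    \<open>z\<close> the dilate has the value of \<open>A\<close> at \<open>w\<close>; so both
    factors would be nonzero at \<open>z\<close>.\<close>
  obtain r where r: "coprime r N" "[r = k] (mod s)" using lift_coprime[OF k(1) s(1) N] .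
  have "r \<noteq> 0" using r(1) s N by (intro notI) auto
  have "card A dvd N" using card_mult_period_part[OF A AB per] by (metis dvd_triv_left)
  then have "coprime r (card A)" using r(1) by (meson coprime_divisors dvd_refl)
  then have "tiling ((\<lambda>a. int r * a) ` A) B" using \<open>r \<noteq> 0\<close> by (intro tijdeman[OF A AB per]) auto
  moreover have "z ^ N = 1" using z(1) s(1) by (simp add: prim_root_def)
  moreover have "z \<noteq> 1" using z(1) s(2) prim_root_1_iff prim_root_unique by blast
  ultimately have "mask_eval ((\<lambda>a. int r * a) ` A) z = 0"
    using mask_eval_mult_period_part_0[of "(\<lambda>a. int r * a) ` A" B N z] A per z by auto
  then have "mask_eval A (z ^ r) = 0" using \<open>r \<noteq> 0\<close> by (simp add: mask_eval_scale)
  moreover have "z ^ r = w" using k r(2) prim_root_cong_power[OF z(1)] by metis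
  ultimately show False using w by simp
qed

text \<open>Each prime power dividing \<open>N\<close> lies in one of the two sets, so the primes
  below their elements multiply to at least \<open>N\<close>. They also multiply to at most
  \<open>card A\<close> and \<open>card (period_part N B)\<close>, whose product is
  \<open>N\<close>. Equality throughout leaves no overlap and nothing outside the divisors of
  \<open>N\<close>.\<close>

lemma tiling_primepow_factors:
  assumes A: "finite A" and AB: "tiling A B" and per: "periodic N B"
  shows "card A = (\<Prod>s\<in>S_set A. aprimedivisor s)"
    and "S_set A \<union> S_set (period_part N B) = primepow_factors N"
    and "S_set A \<inter> S_set (period_part N B) = {}"
proof -
  let ?C = "period_part N B"
  let ?a = "aprimedivisor :: nat \<Rightarrow> nat"
  have N: "0 < N" using periodic_pos[OF per] .
  have cN: "card A * card ?C = N" using card_mult_period_part[OF A AB per] .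
  have A0: "A \<noteq> {}" "?C \<noteq> {}" using cN N by auto
  note SA = S_set_iff[OF A A0(1)] and SC = S_set_iff[OF finite_period_part A0(2)]
  have fin: "finite (S_set A)" "finite (S_set ?C)" using finite_S_set A A0 by auto
  have ge2: "2 \<le> ?a s" if "primepow s" for s
    using that aprimedivisor_gt_Suc_0_nat[OF primepow_gt_Suc_0[OF that]] by simp
  have pf: "s \<in> primepow_factors N \<longleftrightarrow> primepow s \<and> s dvd N" for s by (simp add: primepow_factors_def)
  have pp: "primepow s" if "s \<in> S_set A \<union> S_set ?C" for s using that SA SC by auto
  have sub: "primepow_factors N \<subseteq> S_set A \<union> S_set ?C"
  proof
    fix s assume "s \<in> primepow_factors N"
    then have s: "primepow s" "s dvd N" using pf by auto
    then have "vanishes A s \<or> vanishes ?C s" using vanishes_or_vanishes_period_part[OF A AB per] primepow_gt_Suc_0[of s] by simp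
    then show "s \<in> S_set A \<union> S_set ?C" using s SA SC by blast
  qed
  have dA: "(\<Prod>s\<in>S_set A. ?a s) dvd card A" and dC: "(\<Prod>s\<in>S_set ?C. ?a s) dvd card ?C"
    using prod_aprimedivisor_dvd_card[OF A A0(1) fin(1)] prod_aprimedivisor_dvd_card[OF finite_period_part A0(2) fin(2)]
      SA SC by auto
  have cpos: "0 < card A" "0 < card ?C" using A A0 by (auto simp: card_gt_0_iff)
  have le: "(\<Prod>s\<in>S_set A. ?a s) \<le> card A" "(\<Prod>s\<in>S_set ?C. ?a s) \<le> card ?C"
    using dvd_imp_le[OF dA] dvd_imp_le[OF dC] cpos by blast+
  have PN: "(\<Prod>s\<in>primepow_factors N. ?a s) = N"
    using N by (rule prod_aprimedivisor_primepow_factors)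
  let ?U = "S_set A \<union> S_set ?C" and ?I = "S_set A \<inter> S_set ?C"
  \<comment> \<open>Each element of this excess, as well as each element of the overlap, would cost
    a factor of at least 2.\<close>
  define D where "D = ?U - primepow_factors N"
  have U: "(\<Prod>s\<in>?U. ?a s) = (\<Prod>s\<in>D. ?a s) * N"
    using prod.subset_diff[OF sub, of ?a] fin unfolding D_def PN by simp
  have UI: "(\<Prod>s\<in>?U. ?a s) * (\<Prod>s\<in>?I. ?a s) = (\<Prod>s\<in>S_set A. ?a s) * (\<Prod>s\<in>S_set ?C. ?a s)"
    using fin by (rule prod.union_inter)
  have ge1: "1 \<le> (\<Prod>s\<in>X. ?a s)" "X \<noteq> {} \<Longrightarrow> 2 \<le> (\<Prod>s\<in>X. ?a s)" if "X \<subseteq> ?U" for X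
  proof -
    have X: "finite X" using that fin by (auto intro: finite_subset)
    have pos: "1 \<le> ?a s" if "s \<in> X" for s using ge2[OF pp] that \<open>X \<subseteq> ?U\<close> by force
    then show "1 \<le> (\<Prod>s\<in>X. ?a s)" by (rule prod_ge_1)
    assume "X \<noteq> {}"
    then obtain x where x: "x \<in> X" by blast
    have "1 \<le> (\<Prod>s\<in>X - {x}. ?a s)" using pos by (intro prod_ge_1) auto
    moreover have "2 \<le> ?a x" using ge2[OF pp] that x by blast
    ultimately have "2 * 1 \<le> ?a x * (\<Prod>s\<in>X - {x}. ?a s)" by (intro mult_mono) auto
    then show "2 \<le> (\<Prod>s\<in>X. ?a s)" using X x by (simp add: prod.remove)
  qed
  have prodle: "(\<Prod>s\<in>S_set A. ?a s) * (\<Prod>s\<in>S_set ?C. ?a s) \<le> N"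
    using mult_le_mono[OF le] cN by simp
  have DI: "(\<Prod>s\<in>D. ?a s) * (\<Prod>s\<in>?I. ?a s) \<le> 1"
  proof -
    have "((\<Prod>s\<in>D. ?a s) * (\<Prod>s\<in>?I. ?a s)) * N \<le> 1 * N"
      using UI U prodle by (simp add: mult_ac)
    then show ?thesis using N by simp
  qed
  have D1: "1 \<le> (\<Prod>s\<in>D. ?a s)" "1 \<le> (\<Prod>s\<in>?I. ?a s)" using ge1(1) by (auto simp: D_def)
  have "D = {}"
  proof (rule ccontr)
    assume "D \<noteq> {}"
    then have "2 * 1 \<le> (\<Prod>s\<in>D. ?a s) * (\<Prod>s\<in>?I. ?a s)"
      using D1 ge1(2)[of D] by (intro mult_mono) (auto simp: D_def)
    then show False using DI by simp
  qed
  then show "?U = primepow_factors N" using sub by (auto simp: D_def)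
  show I: "?I = {}"
  proof (rule ccontr)
    assume "?I \<noteq> {}"
    then have "1 * 2 \<le> (\<Prod>s\<in>D. ?a s) * (\<Prod>s\<in>?I. ?a s)"
      using D1 ge1(2)[of ?I] by (intro mult_mono) auto
    then show False using DI by simp
  qed
  have "(\<Prod>s\<in>S_set A. ?a s) * (\<Prod>s\<in>S_set ?C. ?a s) = card A * card ?C"
    using UI U \<open>D = {}\<close> I cN by simp
  then show "card A = (\<Prod>s\<in>S_set A. ?a s)"
    using le cpos by (metis le_antisym mult_le_cancel2 mult_le_mono2 not_le order_le_less_trans)
qed

section \<open>Sands' theorem and the condition T2\<close>

text \<open>Differences invertible modulo \<open>N\<close> can be matched: for \<open>r\<close> with
  r (a - a') \<equiv> b - b' the dilate of \<open>A\<close> by \<open>r\<close> still tiles with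
  \<open>B\<close>, yet r a + b' and r a' + b agree modulo \<open>N\<close>.\<close>

lemma no_common_coprime_difference:
  assumes A: "finite A" and AB: "tiling A B" and per: "periodic N B" and N: "1 < N"
    and a: "a \<in> A" "a' \<in> A" "coprime (a - a') (int N)"
    and b: "b \<in> B" "b' \<in> B" "coprime (b - b') (int N)"
  shows False
proof -
  obtain x where x: "[(a - a') * x = 1] (mod int N)" using cong_solve_coprime_int[OF a(3)] by blast
  define r where "r = nat ((x * (b - b')) mod int N)"
  have r: "int r = (x * (b - b')) mod int N" using N by (simp add: r_def)
  have "coprime x (int N)" using x by (metis cong_imp_coprime cong_sym coprime_1_left coprime_mult_left_iff)
  then have "coprime (x * (b - b')) (int N)" using b(3) by simp
  then have "coprime (int r) (int N)" unfolding r using N by (simp add: coprime_iff_gcd_eq_1)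
  then have cop: "coprime r N" by simp
  then have r0: "0 < r" using N by (auto intro: Nat.gr0I)
  have "card A dvd N" using card_mult_period_part[OF A AB per] by (metis dvd_triv_left)
  then have "coprime r (card A)" using cop by (meson coprime_divisors dvd_refl)
  then have rAB: "tiling ((\<lambda>a. int r * a) ` A) B" using r0 by (intro tijdeman[OF A AB per]) auto
  have "[int r * (a - a') = b - b'] (mod int N)"
  proof -
    have "[int r * (a - a') = x * (b - b') * (a - a')] (mod int N)"
      unfolding r by (intro cong_mult) (simp_all add: cong_def)
    also have "x * (b - b') * (a - a') = ((a - a') * x) * (b - b')" by (simp add: mult_ac)
    also have "[((a - a') * x) * (b - b') = 1 * (b - b')] (mod int N)" using x by (intro cong_mult) simp_all
    finally show ?thesis by simp
  qed
  then obtain k where "int r * (a - a') - (b - b') = int N * k"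
    unfolding cong_iff_dvd_diff by (elim dvdE)
  then have "int r * a + b' - int r * a' = b + int N * k" by (simp add: algebra_simps)
  then have "int r * a + b' - int r * a' \<in> B" using b(1) periodic_add_mult[OF per] by simp
  moreover have "int r * a + b' - int r * a \<in> B" using b(2) by simp
  ultimately have "int r * a' = int r * a" using tilingD[OF rAB] a by blast
  then have "a - a' = 0" using r0 by simp
  then show False using a(3) N by simp
qed

text \<open>Only two primes \<open>r\<close> and \<open>s\<close> are available, and one of them
  divides each given difference. As with a group that is never the union of two proper subgroups, a
  point \<open>u\<close> separated modulo \<open>s\<close> from both \<open>x\<close> and
  \<open>x'\<close> is separated modulo \<open>r\<close> from one of them.\<close>

lemma common_divisor_of_differences:
  assumes pq: "prime p" "prime q" and N: "1 < N" "prime_factors N \<subseteq> {p, q}"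
    and X: "\<And>x y. x \<in> X \<Longrightarrow> y \<in> X \<Longrightarrow> \<not> coprime (x - y) (int N)"
  shows "\<exists>r\<in>prime_factors N. \<forall>x\<in>X. \<forall>y\<in>X. int r dvd x - y"
proof (rule ccontr)
  assume neg: "\<not> ?thesis"
  have cop: "coprime u (int N)" if u: "\<And>r. r \<in> prime_factors N \<Longrightarrow> \<not> int r dvd u" for u
  proof (rule ccontr)
    assume "\<not> coprime u (int N)"
    then have "gcd (nat \<bar>u\<bar>) N \<noteq> 1"
      by (metis coprime_iff_gcd_eq_1 coprime_int_iff coprime_abs_left_iff abs_ge_zero int_nat_eq)
    from prime_factor_nat[OF this] obtain r where r: "prime r" "r dvd gcd (nat \<bar>u\<bar>) N" by blast
    then have r: "prime r" "r dvd nat \<bar>u\<bar>" "r dvd N" by (meson gcd_dvd1 gcd_dvd2 dvd_trans)+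
    have "int r dvd int (nat \<bar>u\<bar>)" using r(2) by (simp only: of_nat_dvd_iff)
    then have "int r dvd u" by simp
    moreover have "r \<in> prime_factors N" using r N by (simp add: prime_factors_dvd)
    ultimately show False using u by blast
  qed
  have no: "\<exists>r\<in>prime_factors N. int r dvd x - y" if "x \<in> X" "y \<in> X" for x y
    using cop[of "x - y"] X[OF that] by blast
  obtain r where r: "r \<in> prime_factors N"
    using N(1) prime_factor_nat[of N] by (auto simp: prime_factors_dvd)
  obtain x x' where x: "x \<in> X" "x' \<in> X" "\<not> int r dvd x - x'" using neg r by blast
  obtain s where s: "s \<in> prime_factors N" "int s dvd x - x'" using no x by blast
  have rs: "prime_factors N \<subseteq> {r, s}" using r s x N(2) by auto
  obtain y y' where y: "y \<in> X" "y' \<in> X" "\<not> int s dvd y - y'" using neg s by blast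
  have "\<not> int s dvd y - x \<or> \<not> int s dvd y' - x"
    using y(3) dvd_diff[of "int s" "y - x" "y' - x"] by auto
  then obtain u where u: "u \<in> X" "\<not> int s dvd u - x" using y by blast
  then have us: "\<not> int s dvd u - x'" using dvd_diff[of "int s" "u - x'" "x - x'"] s by auto
  have "\<not> int r dvd u - x \<or> \<not> int r dvd u - x'"
    using x(3) dvd_diff[of "int r" "u - x'" "u - x"] by auto
  then obtain v where "v \<in> {x, x'}" "\<not> int r dvd u - v" by blast
  then have "v \<in> X" "\<not> int r dvd u - v" "\<not> int s dvd u - v" using u us x by auto
  then show False using no[OF u(1), of v] rs by blast
qed

lemma sands:
  assumes A: "finite A" and AB: "tiling A B" and per: "periodic N B"
    and pq: "prime p" "prime q" and N: "1 < N" "prime_factors N \<subseteq> {p, q}"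
  obtains r where "r \<in> prime_factors N" "\<forall>x\<in>A. \<forall>y\<in>A. int r dvd x - y"
  | r where "r \<in> prime_factors N" "\<forall>x\<in>B. \<forall>y\<in>B. int r dvd x - y"
proof (cases "\<exists>x\<in>A. \<exists>y\<in>A. coprime (x - y) (int N)")
  case True
  then have "\<not> coprime (x - y) (int N)" if "x \<in> B" "y \<in> B" for x y
    using no_common_coprime_difference[OF A AB per N(1)] that by blast
  then show ?thesis using that(2) common_divisor_of_differences[OF pq N, of B] by blast
next
  case False
  then show ?thesis using that(1) common_divisor_of_differences[OF pq N, of A] by blast
qed

section \<open>Descent to a smaller period\<close>

definition contraction :: "nat \<Rightarrow> int set \<Rightarrow> int set" where
  "contraction r B = {b. int r * b \<in> B}"

text \<open>For points of r\<int> only the elements of \<open>B\<close> in r\<int> matter; dividing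
  by \<open>r\<close> turns the tiling by r A into one by \<open>A\<close>. Combined with dilation
  this shortens the period without changing \<open>A\<close>.\<close>

lemma tiling_contraction:
  assumes "0 < r" "tiling ((\<lambda>a. int r * a) ` A) B"
  shows "tiling A (contraction r B)"
proof (rule tilingI)
  have *: "g - a \<in> contraction r B \<longleftrightarrow> int r * g - int r * a \<in> B" for g a
    by (simp add: contraction_def right_diff_distrib)
  {
    fix g show "\<exists>a\<in>A. g - a \<in> contraction r B" using tilingE[OF assms(2), of "int r * g"] unfolding * by blast
  next
    fix g a a' assume "a \<in> A" "a' \<in> A" "g - a \<in> contraction r B" "g - a' \<in> contraction r B"
    then have "int r * a = int r * a'" unfolding * using tilingD[OF assms(2)] by blast
    then show "a = a'" using assms(1) by simp
  }
qed

lemma periodic_contraction: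
  assumes "0 < r" "periodic (r * N) B"
  shows "periodic N (contraction r B)"
  using assms unfolding periodic_def contraction_def by (simp add: algebra_simps)

lemma contraction_image:
  assumes "\<And>x. x \<in> B \<Longrightarrow> int r dvd x" shows "B = (\<lambda>b. int r * b) ` contraction r B"
  using assms by (force simp: contraction_def elim: dvdE)

lemma tiling_period_dividing:
  assumes A: "finite A" and "tiling A B"
  obtains B' N where "tiling A B'" "periodic N B'" "prime_factors N \<subseteq> prime_factors (card A)"
proof -
  obtain N where "periodic N B" using tiling_periodic[OF assms] .
  then have "\<exists>B' N. tiling A B' \<and> periodic N B' \<and> prime_factors N \<subseteq> prime_factors (card A)"
    using assms(2)
  proof (induction N arbitrary: B rule: less_induct)
    case (less N)
    have cA: "card A \<noteq> 0" using A tiling_nonempty[OF less.prems(2)] by simp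
    show ?case
    proof (cases "prime_factors N \<subseteq> prime_factors (card A)")
      case True then show ?thesis using less.prems by blast
    next
      case False
      then obtain t where t: "t \<in> prime_factors N" "t \<notin> prime_factors (card A)" by blast
      then have tp: "prime t" "t dvd N" "\<not> t dvd card A" using cA by (auto simp: prime_factors_dvd)
      then obtain M where M: "N = t * M" by blast
      have M': "M < N" using M tp(1) periodic_pos[OF less.prems(1)] prime_gt_1_nat[of t] by auto
      have t0: "0 < t" using tp(1) prime_gt_0_nat by blast
      have "tiling A (contraction t B)"
        by (rule tiling_contraction[OF t0 tijdeman_prime[OF A less.prems(2,1) tp(1,3)]])
      moreover have "periodic M (contraction t B)" using periodic_contraction[OF t0] less.prems(1) M by simp
      ultimately show ?thesis using less.IH[OF M'] by blast
    qed
  qed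
  then show ?thesis using that by blast
qed

lemma mask_eval_residues:
  assumes A: "finite A" and r: "0 < r" and z: "z \<noteq> 0"
  shows "mask_eval A z = (\<Sum>i\<in>{0..<int r}. z powi i * mask_eval {a. i + int r * a \<in> A} (z ^ r))"
proof -
  have "mask_eval A z = (\<Sum>i\<in>{0..<int r}. \<Sum>a\<in>{a \<in> A. a mod int r = i}. z powi a)"
    unfolding mask_eval_def by (rule sum.group[symmetric]) (use A r in auto)
  also have "\<dots> = (\<Sum>i\<in>{0..<int r}. z powi i * mask_eval {a. i + int r * a \<in> A} (z ^ r))"
  proof (rule sum.cong[OF refl])
    fix i assume i: "i \<in> {0..<int r}"
    have "(\<Sum>a\<in>{a \<in> A. a mod int r = i}. z powi a) = (\<Sum>a\<in>{a. i + int r * a \<in> A}. z powi (i + int r * a))"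
      by (rule sum.reindex_bij_witness[of _ "\<lambda>a. i + int r * a" "\<lambda>a. a div int r"]) (use i r in auto)
    also have "\<dots> = z powi i * mask_eval {a. i + int r * a \<in> A} (z ^ r)"
      using z by (simp add: mask_eval_def sum_distrib_left power_int_add power_int_mult)
    finally show "(\<Sum>a\<in>{a \<in> A. a mod int r = i}. z powi a) = z powi i * mask_eval {a. i + int r * a \<in> A} (z ^ r)" .
  qed
  finally show ?thesis .
qed

text \<open>The exclusive alternative lets vanishing at prime powers be read off the complement, and
  so passes it between sets with related complements.\<close>

lemma vanishes_iff_not_vanishes_period_part:
  assumes A: "finite A" and AB: "tiling A B" and per: "periodic N B" and s: "primepow s" "s dvd N"
  shows "vanishes A s \<longleftrightarrow> \<not> vanishes (period_part N B) s"
proof -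
  have "A \<noteq> {}" "period_part N B \<noteq> {}"
    using card_mult_period_part[OF A AB per] periodic_pos[OF per] by auto
  moreover have "s \<in> primepow_factors N" using s by (simp add: primepow_factors_def)
  ultimately show ?thesis
    using tiling_primepow_factors(2,3)[OF A AB per] S_set_iff[OF A] S_set_iff[OF finite_period_part[of N B]] s(1) by blast
qed

lemma primepow_dvd_period:
  assumes A: "finite A" and AB: "tiling A B" and per: "periodic N B" and s: "primepow s" "vanishes A s"
  shows "s dvd N"
  using tiling_primepow_factors(2)[OF A AB per] S_set_iff[OF A tiling_nonempty[OF AB]] s
  by (auto simp: primepow_factors_def)

lemma period_part_contraction:
  assumes r: "0 < r" and "\<And>x. x \<in> B \<Longrightarrow> int r dvd x"
  shows "period_part (r * M) B = (\<lambda>b. int r * b) ` period_part M (contraction r B)"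
proof
  show "period_part (r * M) B \<subseteq> (\<lambda>b. int r * b) ` period_part M (contraction r B)"
  proof
    fix x assume x: "x \<in> period_part (r * M) B"
    then obtain y where y: "x = int r * y" using assms(2) by (auto simp: period_part_def elim: dvdE)
    then have "y \<in> period_part M (contraction r B)" using x r by (auto simp: period_part_def contraction_def zero_le_mult_iff)
    then show "x \<in> (\<lambda>b. int r * b) ` period_part M (contraction r B)" using y by blast
  qed
qed (use r in \<open>auto simp: period_part_def contraction_def\<close>)

lemma gcd_prime_power_self: "prime (p::nat) \<Longrightarrow> gcd (p ^ Suc a) p = p"
  by (simp add: gcd_nat.absorb2)

lemma vanishes_1_iff: "finite A \<Longrightarrow> vanishes A 1 \<longleftrightarrow> A = {}"
proof -
  assume A: "finite A"
  have "vanishes A 1 \<longleftrightarrow> mask_eval A 1 = 0" unfolding vanishes_def prim_root_1_iff by blast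
  then show ?thesis using A by (simp add: mask_eval_def)
qed

lemma primepow_power: "prime (p::nat) \<Longrightarrow> 1 \<le> a \<Longrightarrow> primepow (p ^ a)"
  by simp

text \<open>If \<open>p\<close> divides the differences of \<open>A\<close>, then \<open>A\<close>
  is a translate of p A' with A' tiling at period N/p, and orders lose one factor \<open>p\<close>.
  If it divides those of \<open>B\<close>, every residue class of \<open>A\<close> modulo
  \<open>p\<close>, rescaled, tiles with the contraction of \<open>B\<close>, and A(z) is a
  combination of the values of these sets at z^p. The induction hypothesis is an assumption so that
  the step serves either prime.\<close>

lemma two_prime_T2_step:
  assumes IH: "\<And>M A B a b. M < N \<Longrightarrow> finite A \<Longrightarrow> tiling A B \<Longrightarrow> periodic M B \<Longrightarrow> prime_factors M \<subseteq> {p, q} \<Longrightarrow>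
      1 \<le> a \<Longrightarrow> 1 \<le> b \<Longrightarrow> vanishes A (p ^ a) \<Longrightarrow> vanishes A (q ^ b) \<Longrightarrow> vanishes A (p ^ a * q ^ b)"
    and A: "finite A" and AB: "tiling A B" and per: "periodic N B"
    and pq: "prime p" "prime q" "p \<noteq> q" and N: "prime_factors N \<subseteq> {p, q}"
    and ab: "1 \<le> a" "1 \<le> b" and vanishes: "vanishes A (p ^ a)" "vanishes A (q ^ b)"
    and p: "p \<in> prime_factors N"
    and div: "(\<forall>x\<in>A. \<forall>y\<in>A. int p dvd x - y) \<or> (\<forall>x\<in>B. \<forall>y\<in>B. int p dvd x - y)"
  shows "vanishes A (p ^ a * q ^ b)"
proof -
  obtain M where M: "N = p * M" using p by (auto simp: prime_factors_dvd)
  have p0: "0 < p" and q0: "0 < q" using pq prime_gt_0_nat by auto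
  have M0: "0 < M" using M periodic_pos[OF per] by simp
  have MN: "M < N" using M M0 prime_gt_1_nat[OF pq(1)] by simp
  have pfM: "prime_factors M \<subseteq> {p, q}" using N M periodic_pos[OF per] by (auto simp: prime_factors_dvd)
  obtain c where c: "a = Suc c" using ab(1) by (cases a) auto
  have cop: "coprime (q ^ b) p" using pq by (simp add: primes_coprime)
  have s1: "p ^ a div gcd (p ^ a) p = p ^ c"
    unfolding c gcd_prime_power_self[OF pq(1)] using p0 by simp
  have s2: "q ^ b div gcd (q ^ b) p = q ^ b" using cop by (simp add: coprime_iff_gcd_eq_1)
  have "gcd (p ^ a * q ^ b) p = p" unfolding c by (simp add: gcd_nat.absorb2)
  then have s3: "(p ^ a * q ^ b) div gcd (p ^ a * q ^ b) p = p ^ c * q ^ b" unfolding c using p0 by simp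
  have pos: "0 < p ^ a" "0 < q ^ b" "0 < p ^ a * q ^ b" using p0 q0 by auto
  note A0 = tiling_nonempty[OF AB]
  show ?thesis
  proof (cases "\<forall>x\<in>A. \<forall>y\<in>A. int p dvd x - y")
    case True
    obtain a0 where a0: "a0 \<in> A" using A0 by blast
    define A1 where "A1 = (\<lambda>x. x + (- a0)) ` A"
    have A1: "A1 = (\<lambda>x. int p * x) ` contraction p A1"
      by (rule contraction_image) (use True a0 in \<open>auto simp: A1_def\<close>)
    have fin: "finite (contraction p A1)"
      by (rule finite_imageD[of "\<lambda>x. int p * x"]) (use A A1 p0 in \<open>auto simp: A1_def inj_on_def\<close>)
    have vanA1: "vanishes A s \<longleftrightarrow> vanishes (contraction p A1) (s div gcd s p)" if "0 < s" for s
      using vanishes_translate[OF that, of "- a0" A] vanishes_scale[OF p0 that, of "contraction p A1"] A1 by (simp add: A1_def)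
    have "tiling A1 B" unfolding A1_def by (rule tiling_translate[OF AB])
    then have til: "tiling (contraction p A1) (contraction p B)" using A1 by (intro tiling_contraction[OF p0]) simp
    have per': "periodic M (contraction p B)" using periodic_contraction[OF p0] per M by simp
    have v1: "vanishes (contraction p A1) (p ^ c)" and v2: "vanishes (contraction p A1) (q ^ b)"
      using vanishes vanA1[OF pos(1)] vanA1[OF pos(2)] s1 s2 by simp_all
    \<comment> \<open>For \<open>c = 0\<close> the contracted set would vanish at 1, that is, be
      empty.\<close>
    have "c \<noteq> 0" using v1 vanishes_1_iff[OF fin] tiling_nonempty[OF til] by (intro notI) auto
    then have "vanishes (contraction p A1) (p ^ c * q ^ b)"
      using IH[OF MN fin til per' pfM _ ab(2) v1 v2] by simp
    then show ?thesis using vanA1[OF pos(3)] s3 by simp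
  next
    case False
    then have divB: "\<And>x y. x \<in> B \<Longrightarrow> y \<in> B \<Longrightarrow> int p dvd x - y" using div by blast
    obtain b0 where b0: "b0 \<in> B" using tilingE[OF AB] by blast
    define B1 where "B1 = (\<lambda>x. x + (- b0)) ` B"
    have dB1: "int p dvd x" if "x \<in> B1" for x using that divB b0 by (auto simp: B1_def)
    have AB1: "tiling A B1" unfolding B1_def by (rule tiling_translate_right[OF AB])
    have per1: "periodic N B1" unfolding B1_def by (rule periodic_translate[OF per])
    have perM: "periodic M (contraction p B1)" using periodic_contraction[OF p0] per1 M by simp
    define A' where "A' = (\<lambda>i. {x. i + int p * x \<in> A})"
    have finA': "finite (A' i)" for i
      by (rule finite_imageD[of "\<lambda>x. i + int p * x"])
        (use A p0 in \<open>auto simp: A'_def inj_on_def intro: finite_subset[of _ A]\<close>)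
    have tilA': "tiling (A' i) (contraction p B1)" for i
    proof (rule tilingI)
      fix g
      obtain x where x: "x \<in> A" "i + int p * g - x \<in> B1" using tilingE[OF AB1] by blast
      then have "int p dvd i + int p * g - x" using dB1 by blast
      then obtain y where y: "i + int p * g - x = int p * y" by (elim dvdE)
      then have "i + int p * (g - y) = x" by (simp add: algebra_simps)
      then have "g - y \<in> A' i" using x(1) by (simp add: A'_def)
      moreover have "g - (g - y) \<in> contraction p B1" using x(2) y by (simp add: contraction_def)
      ultimately show "\<exists>x\<in>A' i. g - x \<in> contraction p B1" by blast
    next
      fix g x y assume "x \<in> A' i" "y \<in> A' i" "g - x \<in> contraction p B1" "g - y \<in> contraction p B1"
      then have "i + int p * x = i + int p * y"
        using tilingD[OF AB1, of "i + int p * x" "i + int p * y" "i + int p * g"]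
        by (auto simp: A'_def contraction_def algebra_simps)
      then show "x = y" using p0 by simp
    qed
    have fundB1: "period_part N B1 = (\<lambda>x. int p * x) ` period_part M (contraction p B1)"
      unfolding M by (rule period_part_contraction[OF p0 dB1])
    \<comment> \<open>As \<open>A\<close> vanishes at \<open>s\<close>, its complement does not.
      Hence the contracted complement does not vanish at the reduced order, and every class tiling
      with it does.\<close>
    have transfer: "vanishes (A' i) (s div gcd s p)"
      if s: "primepow s" "vanishes A s" "primepow (s div gcd s p)" "s div gcd s p dvd M" for s i
    proof -
      have "s dvd N" by (rule primepow_dvd_period[OF A AB1 per1 s(1,2)])
      then have "\<not> vanishes (period_part N B1) s" using vanishes_iff_not_vanishes_period_part[OF A AB1 per1 s(1)] s(2) by blast
      then have "\<not> vanishes (period_part M (contraction p B1)) (s div gcd s p)"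
        unfolding fundB1 using vanishes_scale[OF p0 primepow_gt_0_nat[OF s(1)]] by simp
      then show ?thesis using vanishes_iff_not_vanishes_period_part[OF finA' tilA' perM s(3,4)] by blast
    qed
    have dvdN: "p ^ a dvd N" "q ^ b dvd N"
      using primepow_dvd_period[OF A AB per] vanishes primepow_power pq ab by blast+
    have vq: "vanishes (A' i) (q ^ b)" for i
    proof -
      have "q ^ b dvd M" using dvdN(2) cop unfolding M by (simp add: coprime_dvd_mult_right_iff)
      then show ?thesis using transfer[of "q ^ b" i] vanishes(2) s2 primepow_power[OF pq(2) ab(2)] by simp
    qed
    have vpq: "vanishes (A' i) (p ^ c * q ^ b)" for i
    proof (cases "c = 0")
      case True then show ?thesis using vq by simp
    next
      case False
      then have pp: "primepow (p ^ c)" using pq(1) by simp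
      have "p ^ c dvd M" using dvdN(1) p0 unfolding M c by simp
      then have "vanishes (A' i) (p ^ c)"
        using transfer[of "p ^ a" i] vanishes(1) s1 pp primepow_power[OF pq(1) ab(1)] by simp
      then show ?thesis
        using IH[OF MN finA' tilA' perM pfM _ ab(2) _ vq] False by simp
    qed
    show ?thesis unfolding vanishes_def
    proof (intro allI impI)
      fix z assume z: "prim_root (p ^ a * q ^ b) z"
      have "prim_root (p ^ c * q ^ b) (z ^ p)" using prim_root_power[OF z pos(3), of p] s3 by simp
      then have "mask_eval (A' i) (z ^ p) = 0" for i using vpq by (simp add: vanishes_def)
      then show "mask_eval A z = 0"
        unfolding mask_eval_residues[OF A p0 prim_root_nonzero[OF z pos(3)]] A'_def by simp
    qed
  qed
qed

lemma two_prime_T2: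
  assumes "finite A" "tiling A B" "periodic N B" "prime p" "prime q" "p \<noteq> q" "prime_factors N \<subseteq> {p, q}"
    "1 \<le> a" "1 \<le> b" "vanishes A (p ^ a)" "vanishes A (q ^ b)"
  shows "vanishes A (p ^ a * q ^ b)"
  using assms
proof (induction N arbitrary: A B a b rule: less_induct)
  case (less N)
  have "p ^ a dvd N"
    using primepow_dvd_period[OF less.prems(1-3)] less.prems primepow_power by blast
  moreover have "1 < p ^ a" using less.prems(4,8) prime_gt_1_nat by (intro one_less_power) auto
  ultimately have N: "1 < N" using periodic_pos[OF less.prems(3)] by (auto dest: dvd_imp_le)
  have step: ?case if r: "r \<in> prime_factors N"
    "(\<forall>x\<in>A. \<forall>y\<in>A. int r dvd x - y) \<or> (\<forall>x\<in>B. \<forall>y\<in>B. int r dvd x - y)" for r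
  proof (cases "r = p")
    case True
    show ?thesis
    proof (rule two_prime_T2_step[OF _ less.prems(1-11)])
      show "p \<in> prime_factors N"
        "(\<forall>x\<in>A. \<forall>y\<in>A. int p dvd x - y) \<or> (\<forall>x\<in>B. \<forall>y\<in>B. int p dvd x - y)"
        using r True by simp_all
    next
      fix M A B a b assume "M < N" "finite A" "tiling A B" "periodic M B" "prime_factors M \<subseteq> {p, q}"
        "1 \<le> a" "1 \<le> b" "vanishes A (p ^ a)" "vanishes A (q ^ b)"
      then show "vanishes A (p ^ a * q ^ b)" using less.IH[of M A B a b] less.prems(4-6) by simp
    qed
  next
    case False
    then have q: "r = q" using r less.prems(7) by auto
    have "vanishes A (q ^ b * p ^ a)"
    proof (rule two_prime_T2_step[OF _ less.prems(1-3)])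
      fix M A B a b assume "M < N" "finite A" "tiling A B" "periodic M B" "prime_factors M \<subseteq> {q, p}"
        "1 \<le> a" "1 \<le> b" "vanishes A (q ^ a)" "vanishes A (p ^ b)"
      then have "vanishes A (p ^ b * q ^ a)"
        using less.IH[of M A B b a] less.prems(4-6) by (simp add: insert_commute)
      then show "vanishes A (q ^ a * p ^ b)" by (simp add: mult.commute)
    next
      show "q \<in> prime_factors N"
        "(\<forall>x\<in>A. \<forall>y\<in>A. int q dvd x - y) \<or> (\<forall>x\<in>B. \<forall>y\<in>B. int q dvd x - y)"
        using r q by simp_all
      show "prime_factors N \<subseteq> {q, p}" using less.prems(7) by blast
    qed (use less.prems in simp_all)
    then show ?thesis by (simp add: mult.commute)
  qed
  show ?case using sands[OF less.prems(1-5) N less.prems(7)] step by metis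
qed

section \<open>Tilings satisfy T1 and, for at most two primes, T2\<close>

theorem tiling_imp_T1:
  assumes "finite A" "tiles_int A" shows "T1 A"
proof -
  obtain B where B: "tiling A B" using assms(2) tiles_int_iff by blast
  obtain N where "periodic N B" using tiling_periodic[OF assms(1) B] .
  then show ?thesis
    using T1_iff[OF assms(1) tiling_nonempty[OF B]] tiling_primepow_factors(1)[OF assms(1) B] by simp
qed

theorem tiling_imp_T2:
  assumes A: "finite A" "tiles_int A" and two: "card (prime_factors (card A)) \<le> 2"
  shows "T2 A"
proof -
  obtain B0 where "tiling A B0" using A(2) tiles_int_iff by blast
  then obtain B N where B: "tiling A B" "periodic N B" "prime_factors N \<subseteq> prime_factors (card A)"
    using tiling_period_dividing[OF A(1)] by blast
  have "vanishes A (\<Prod>p\<in>P. p ^ e p)"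
    if P: "finite P" "P \<noteq> {}" "\<forall>p\<in>P. prime p \<and> 1 \<le> e p \<and> vanishes A (p ^ e p)" for P :: "nat set" and e
  proof -
    have sub: "P \<subseteq> prime_factors N"
    proof
      fix p assume p: "p \<in> P"
      then have "p ^ e p dvd N" using P(3) primepow_dvd_period[OF A(1) B(1,2)] primepow_power by blast
      moreover have "p dvd p ^ e p" using P(3) p by (auto intro: dvd_power)
      ultimately show "p \<in> prime_factors N"
        using P(3) p periodic_pos[OF B(2)] by (auto simp: prime_factors_dvd intro: dvd_trans)
    qed
    then have cP: "card P \<le> 2"
      using card_mono[of "prime_factors (card A)" P] subset_trans[OF sub B(3)] two by simp
    show ?thesis
    proof (cases "card P = 1")
      case True
      then obtain p where "P = {p}" by (rule card_1_singletonE)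
      then show ?thesis using P(3) by simp
    next
      case False
      then have "card P = 2" using cP P(1,2) by (metis card_0_eq One_nat_def Suc_1 le_SucE le_zero_eq numeral_2_eq_2)
      then obtain p q where pq: "P = {p, q}" "p \<noteq> q" by (auto simp: card_2_iff)
      \<comment> \<open>\<open>P\<close> already exhausts the primes of |A|, so the period has no
        further prime.\<close>
      have "card (prime_factors (card A)) \<le> card P" using two \<open>card P = 2\<close> by simp
      then have "prime_factors (card A) = P"
        using card_seteq[of "prime_factors (card A)" P] sub B(3) by auto
      then have "vanishes A (p ^ e p * q ^ e q)"
        using two_prime_T2[OF A(1) B(1,2), of p q "e p" "e q"] P(3) pq B(3) by auto
      then show ?thesis using pq by simp
    qed
  qed
  then show ?thesis using T2_iff[OF A(1) tiling_nonempty[OF B(1)]] by blast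
qed

section \<open>The complement of a set satisfying T1 and T2\<close>

definition nat_coeffs :: "complex poly \<Rightarrow> bool" where
  "nat_coeffs f \<longleftrightarrow> (\<forall>i. coeff f i \<in> \<nat>)"

lemma Nats_sum: "(\<And>i. i \<in> S \<Longrightarrow> f i \<in> \<nat>) \<Longrightarrow> (\<Sum>i\<in>S. f i) \<in> \<nat>"
  by (induction S rule: infinite_finite_induct) auto

lemma nat_coeffs_mult: "nat_coeffs f \<Longrightarrow> nat_coeffs g \<Longrightarrow> nat_coeffs (f * g)"
  unfolding nat_coeffs_def coeff_mult by (intro allI Nats_sum) auto

lemma nat_coeffs_sum: "(\<And>i. i \<in> S \<Longrightarrow> nat_coeffs (f i)) \<Longrightarrow> nat_coeffs (\<Sum>i\<in>S. f i)"
  unfolding nat_coeffs_def coeff_sum by (intro allI Nats_sum) auto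

lemma nat_coeffs_prod: "(\<And>i. i \<in> S \<Longrightarrow> nat_coeffs (f i)) \<Longrightarrow> nat_coeffs (\<Prod>i\<in>S. f i)"
proof (induction S rule: infinite_finite_induct)
  case (insert x S) then show ?case by (simp add: nat_coeffs_mult)
qed (auto simp: nat_coeffs_def)

lemma act_const: "act f (\<lambda>_. 1) g = poly f 1"
  by (simp add: act_def poly_altdef)

text \<open>One summand is 1 and all others are 0. This gives uniqueness in the tiling without a
  separate proof that the multiplicities of the complement are at most 1.\<close>

lemma sum_Nats_eq_1:
  fixes f :: "'b \<Rightarrow> complex"
  assumes I: "finite I" "\<And>i. i \<in> I \<Longrightarrow> f i \<in> \<nat>" "(\<Sum>i\<in>I. f i) = 1"
  shows "\<exists>!i. i \<in> I \<and> f i \<noteq> 0"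
proof -
  have "\<exists>n. f i = of_nat n" if "i \<in> I" for i using I(2)[OF that] by (auto elim: Nats_cases)
  then obtain n where n: "\<And>i. i \<in> I \<Longrightarrow> f i = of_nat (n i)" by metis
  have "(of_nat (\<Sum>i\<in>I. n i) :: complex) = of_nat 1" using I(3) n by simp
  then have s: "(\<Sum>i\<in>I. n i) = 1" by (simp only: of_nat_eq_iff)
  then obtain i where i: "i \<in> I" "n i \<noteq> 0" by (metis sum.neutral zero_neq_one)
  have "n j = 0" if "j \<in> I" "j \<noteq> i" for j
  proof -
    have "(\<Sum>k\<in>{i, j}. n k) \<le> (\<Sum>k\<in>I. n k)" using I(1) i that by (intro sum_mono2) auto
    then show ?thesis using s i that by simp
  qed
  then show ?thesis using i n by (intro ex1I[of _ i]) (simp, metis of_nat_0)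
qed

lemma root_poly_dvd_iff:
  assumes "0 < L"
  shows "root_poly L dvd f \<longleftrightarrow> (\<forall>z. z ^ L = 1 \<longrightarrow> poly f z = 0)"
proof -
  let ?c = "\<lambda>k. cis (2 * pi * real k / real L)"
  have eq: "?c k = cis (2 * pi / real L) ^ k" for k by (simp add: DeMoivre mult_ac)
  have "root_poly L dvd f \<longleftrightarrow> (\<forall>k\<in>{1..L}. poly f (?c k) = 0)"
    unfolding root_poly_conv_prod[OF assms]
    by (rule prod_linear_dvd_iff[OF _ cyclotomic_root_inj[OF assms]]) simp
  also have "\<dots> \<longleftrightarrow> (\<forall>z. z ^ L = 1 \<longrightarrow> poly f z = 0)"
  proof (intro iffI allI impI ballI)
    fix z :: complex assume *: "\<forall>k\<in>{1..L}. poly f (?c k) = 0" and z: "z ^ L = 1"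
    from prim_root_power_surj[OF prim_root_cis[OF assms] assms z] obtain k
      where k: "k < L" "z = cis (2 * pi / real L) ^ k" .
    show "poly f z = 0"
    proof (cases "k = 0")
      case True
      have "?c L = 1" using assms by simp
      then show ?thesis using *[rule_format, of L] k True assms by (simp add: Suc_le_eq)
    next
      case False
      then show ?thesis using *[rule_format, of k] k eq by simp
    qed
  next
    fix k assume *: "\<forall>z. z ^ L = 1 \<longrightarrow> poly f z = 0"
    have "?c k ^ L = 1" using assms by (simp add: DeMoivre cis_multiple_2pi)
    then show "poly f (?c k) = 0" using * by blast
  qed
  finally show ?thesis .
qed

text \<open>The complement is the one of Coven and Meyerowitz: the product of \<open>\<Phi>\<^sub>s(X\<^sup>t)\<close> over the prime
  powers \<open>s\<close> dividing \<open>L\<close> outside \<open>S\<^sub>A\<close>, where \<open>t\<close> is the largest divisor of \<open>L\<close> prime to \<open>s\<close>.\<close>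

theorem T1_T2_imp_tiles:
  assumes A: "finite A" "A \<noteq> {}" and T1: "T1 A" and T2: "T2 A"
  shows "tiles_int A"
proof -
  let ?a = "aprimedivisor :: nat \<Rightarrow> nat"
  define S where "S = S_set A"
  note S = S_set_iff[OF A, folded S_def]
  have finS: "finite S" unfolding S_def by (rule finite_S_set[OF A])
  define L where "L = \<Prod>S"
  have L0: "0 < L" unfolding L_def using S primepow_gt_0_nat by (intro prod_pos) auto
  have SL: "S \<subseteq> primepow_factors L"
    using S finS by (auto simp: primepow_factors_def L_def intro: dvd_prodI)
  define U where "U = primepow_factors L - S"
  define t where "t = (\<lambda>s. L div ?a s ^ multiplicity (?a s) L)"
  define C where "C = (\<lambda>s. \<Sum>i<?a s. monom (1::complex) (i * (s div ?a s) * t s))"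
  define Bp where "Bp = (\<Prod>s\<in>U. C s)"
  define I where "I = nat ` normalized A"
  define Mp where "Mp = (\<Sum>i\<in>I. monom (1::complex) i)"
  have finI: "finite I" unfolding I_def normalized_def using A by simp
  have nonneg: "0 \<le> x" if "x \<in> normalized A" for x using that A by (auto simp: normalized_def)
  have injn: "inj_on nat (normalized A)"
    using nonneg by (metis (no_types, lifting) inj_onI int_nat_eq)
  have intI: "int ` I = normalized A" unfolding I_def image_image using nonneg by force
  have Mp: "Mp = mask_poly A" unfolding Mp_def I_def mask_poly_def using injn by (simp add: sum.reindex)
  have Cpoly: "poly (C s) z = poly (cyclotomic s) (z ^ t s)" if pps: "primepow s" for s z
  proof -
    obtain p k where p: "prime p" "s = p ^ Suc k" "?a s = p" using primepowE[OF pps] .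
    then have "s div ?a s = p ^ k" using prime_gt_0_nat by simp
    then show ?thesis
      unfolding C_def p(3) unfolding p(2) cyclotomic_prime_power[OF p(1)] using p
      by (simp add: poly_sum poly_monom mult_ac flip: power_mult)
  qed
  \<comment> \<open>Let \<open>m\<close> be the order of \<open>z\<close>. If all prime power
    components of \<open>m\<close> lie in \<open>S\<close>, then T2 makes A(X) vanish at
    \<open>z\<close>. Otherwise a component \<open>s\<close> lies in \<open>U\<close>; since gcd(m,
    t s) = m/s, the power \<open>z ^ t s\<close> has order \<open>s\<close> and is a root of
    \<Phi>_s.\<close>
  have vanishes: "poly (Mp * Bp) z = 0" if z: "z ^ L = 1" "z \<noteq> 1" for z
  proof -
    obtain m where m: "m dvd L" "prim_root m z" using prim_root_exists[OF L0 z(1)] .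
    have m1: "m \<noteq> 1" using m(2) z(2) prim_root_1_iff by blast
    have m0: "0 < m" using m(1) L0 by (auto intro: Nat.gr0I)
    have mprod: "(\<Prod>p\<in>prime_factors m. p ^ multiplicity p m) = m"
      using m0 by (simp add: prod_prime_factors)
    have mult: "prime p \<and> 1 \<le> multiplicity p m" if "p \<in> prime_factors m" for p
      using that by (auto simp: prime_factors_multiplicity Suc_le_eq)
    show ?thesis
    proof (cases "\<forall>p\<in>prime_factors m. p ^ multiplicity p m \<in> S")
      case True
      have "prime_factors m \<noteq> {}" using m0 m1 mprod by auto
      then have "vanishes A m"
        using T2[unfolded T2_iff[OF A], rule_format, of "prime_factors m" "\<lambda>p. multiplicity p m"]
          mult S True mprod by auto
      then have "cyclotomic m dvd mask_poly A" using cyclotomic_dvd_mask_iff[OF A m0] by simp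
      then show ?thesis using cyclotomic_dvd_iff[OF m0] m(2) Mp by simp
    next
      case False
      then obtain p where p: "p \<in> prime_factors m" "p ^ multiplicity p m \<notin> S" by blast
      define s where "s = p ^ multiplicity p m"
      have pp: "prime p" "1 \<le> multiplicity p m" using mult[OF p(1)] by auto
      have p0: "0 < p" using pp prime_gt_0_nat by blast
      have s: "primepow s" "?a s = p" using pp by (auto simp: s_def aprimedivisor_prime_power)
      have sm: "s dvd m" unfolding s_def by (rule multiplicity_dvd)
      then have sL: "s dvd L" using m(1) by (rule dvd_trans)
      then have sU: "s \<in> U" using s p(2) by (simp add: U_def primepow_factors_def s_def)
      have not_unit: "\<not> is_unit p" using pp(1) not_prime_unit by blast
      obtain l where l: "L = p ^ multiplicity p L * l" "\<not> p dvd l"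
        using multiplicity_decompose'[of L p] L0 not_unit by auto
      have ts: "t s = l" unfolding t_def s(2) using l(1) p0 by (metis nonzero_mult_div_cancel_left power_eq_0_iff not_gr0)
      obtain u where u: "m = s * u" using sm by (elim dvdE)
      have "\<not> p dvd u"
        using multiplicity_decompose[of m p] m0 not_unit u unfolding s_def by (metis less_numeral_extra(3) multiplicity_dvd nonzero_mult_div_cancel_left power_eq_0_iff p0)
      then have "coprime u (p ^ multiplicity p L)" using pp(1) by (simp add: coprime_commute prime_imp_coprime)
      moreover have "u dvd p ^ multiplicity p L * l" using m(1) u l(1) by (metis dvd_mult_right)
      ultimately have ul: "u dvd l" by (simp add: coprime_dvd_mult_right_iff)
      have "coprime s l" using l(2) pp(1) by (simp add: s_def prime_imp_coprime)
      then have "gcd m l = u" unfolding u using ul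
        by (metis coprime_commute coprime_iff_gcd_eq_1 gcd.commute gcd_mult_left_left_cancel gcd_nat.absorb1)
      then have "m div gcd m (t s) = s" unfolding ts using u m0 by (simp add: u)
      then have "prim_root s (z ^ t s)" using prim_root_power[OF m(2) m0, of "t s"] by simp
      then have "poly (C s) z = 0"
        unfolding Cpoly[OF s(1)] using cyclotomic_dvd_iff[OF primepow_gt_0_nat[OF s(1)], of "cyclotomic s"] by simp
      then have "poly Bp z = 0" unfolding Bp_def poly_prod
        using sU finite_primepow_factors[of L] L0 by (intro prod_zero) (auto simp: U_def)
      then show ?thesis by simp
    qed
  qed
  define G where "G = (\<Sum>i<L. monom (1::complex) i)"
  have G: "(monom 1 1 - 1) * G = root_poly L" using geometric_poly[of 1 L, where 'a = complex] by (simp add: G_def)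
  have "root_poly L dvd (monom 1 1 - 1) * (Mp * Bp)"
    unfolding root_poly_dvd_iff[OF L0] poly_mult[of "monom 1 1 - 1"] using vanishes by (auto simp: poly_monom)
  then obtain Q where "(monom 1 1 - 1) * (Mp * Bp) = root_poly L * Q" by (elim dvdE)
  then have "(monom 1 1 - 1) * (Mp * Bp) = (monom 1 1 - 1) * (Q * G)" unfolding G[symmetric] by (simp add: mult_ac)
  moreover have "monom 1 1 - (1 :: complex poly) \<noteq> 0" using lead_coeff_root_poly[of 1] by auto
  ultimately have Q: "Mp * Bp = Q * G" by (metis mult_left_cancel)
  \<comment> \<open>Here T1 enters: the primes below the elements of \<open>S\<close> and of
    \<open>U\<close> multiply to \<open>L\<close>, which forces Q(1) = 1.\<close>
  have "poly Mp 1 = of_nat (\<Prod>s\<in>S. ?a s)"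
    using poly_mask_poly_1[OF A] T1 T1_iff[OF A] by (simp add: Mp S_def)
  moreover have "poly Bp 1 = of_nat (\<Prod>s\<in>U. ?a s)"
    by (simp add: Bp_def poly_prod C_def poly_sum poly_monom)
  moreover have "(\<Prod>s\<in>S. ?a s) * (\<Prod>s\<in>U. ?a s) = L"
    using prod.subset_diff[OF SL, of ?a] finite_primepow_factors[of L] L0 prod_aprimedivisor_primepow_factors[OF L0]
    by (simp add: U_def mult.commute)
  ultimately have "poly (Mp * Bp) 1 = of_nat L"
    by (simp only: poly_mult flip: of_nat_mult)
  moreover have "poly G 1 = of_nat L" by (simp add: G_def poly_sum poly_monom)
  ultimately have Q1: "poly Q 1 = 1" using Q L0 by simp
  \<comment> \<open>Acting on the indicator of L\<int> amounts to reducing exponents modulo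
    \<open>L\<close>. There \<open>G\<close> gives the constant 1, so \<open>Mp * Bp = Q * G\<close>
    acts as Q(1) = 1, which is the tiling equation.\<close>
  define \<delta> :: "int \<Rightarrow> complex" where "\<delta> = (\<lambda>g. of_bool (int L dvd g))"
  have "act G \<delta> g = 1" for g
  proof -
    have "(\<Sum>i<L. \<delta> (g - int i)) = (\<Sum>i\<in>{nat (g mod int L)}. \<delta> (g - int i))"
    proof (rule sum.mono_neutral_right)
      show "{nat (g mod int L)} \<subseteq> {..<L}" using L0 by (simp add: nat_less_iff)
      show "\<forall>i\<in>{..<L} - {nat (g mod int L)}. \<delta> (g - int i) = 0"
      proof
        fix i assume i: "i \<in> {..<L} - {nat (g mod int L)}"
        have "\<not> int L dvd g - int i"
        proof
          assume "int L dvd g - int i"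
          then have "g mod int L = int i mod int L" by (simp add: mod_eq_dvd_iff)
          moreover have "int i mod int L = int i" using i by simp
          ultimately show False using i by simp
        qed
        then show "\<delta> (g - int i) = 0" by (simp add: \<delta>_def)
      qed
    qed simp
    also have "\<dots> = 1" using L0 by (simp add: \<delta>_def dvd_minus_mod)
    finally show ?thesis by (simp add: G_def act_sum act_monom)
  qed
  then have "act G \<delta> = (\<lambda>_. 1)" by blast
  then have one: "act Mp (act Bp \<delta>) g = 1" for g
    using Q Q1 by (simp add: act_const flip: act_mult) (simp add: act_mult act_const)
  have "nat_coeffs Bp" unfolding Bp_def C_def
    by (intro nat_coeffs_prod nat_coeffs_sum) (simp add: nat_coeffs_def)
  then have natB: "act Bp \<delta> g \<in> \<nat>" for g
    unfolding act_def nat_coeffs_def \<delta>_def by (intro Nats_sum Nats_mult) auto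
  have "tiling (int ` I) {g. act Bp \<delta> g \<noteq> 0}"
    unfolding tiling_def
  proof
    fix g
    have "(\<Sum>a\<in>int ` I. act Bp \<delta> (g - a)) = 1"
      using one[of g] by (simp add: sum.reindex Mp_def act_sum act_monom)
    then show "\<exists>!a. a \<in> int ` I \<and> g - a \<in> {g. act Bp \<delta> g \<noteq> 0}"
      using sum_Nats_eq_1[of "int ` I" "\<lambda>a. act Bp \<delta> (g - a)"] natB finI by simp
  qed
  from tiling_translate[OF this, of "Min A"] have "tiling A {g. act Bp \<delta> g \<noteq> 0}"
    unfolding intI normalized_def by (simp add: image_image)
  then show ?thesis using tiles_int_iff by blast
qed

section \<open>An integer criterion for vanishing\<close>

definition moebius :: "nat \<Rightarrow> int" where
  "moebius e = (if squarefree e then (- 1) ^ card (prime_factors e) else 0)"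

lemma prime_factors_prod_primes:
  assumes "finite T" "\<And>p. p \<in> T \<Longrightarrow> prime (p::nat)"
  shows "prime_factorization (\<Prod>T) = mset_set T"
proof -
  have "\<Prod>T = prod_mset (mset_set T)" by (simp add: prod_unfold_prod_mset)
  then show ?thesis using prime_factorization_prod_mset_primes[of "mset_set T"] assms by simp
qed

text \<open>Squarefree divisors correspond to sets of prime factors, and the alternating sum over
  all subsets of \<open>?P\<close> is (1 - 1)^|?P|.\<close>

lemma sum_moebius:
  assumes "0 < n"
  shows "(\<Sum>e | e dvd n. moebius e) = of_bool (n = 1)"
proof -
  let ?P = "prime_factors n"
  have primes: "prime p" if "p \<in> T" "T \<subseteq> ?P" for p T using that by auto
  have pf: "prime_factorization (\<Prod>T) = mset_set T" if "T \<subseteq> ?P" for T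
    using that by (intro prime_factors_prod_primes) (auto intro: finite_subset)
  have pos: "0 < \<Prod>T" if "T \<subseteq> ?P" for T using primes[OF _ that] by (intro prod_pos) (auto simp: prime_gt_0_nat)
  have "(\<Sum>e | e dvd n. moebius e) = (\<Sum>e | e dvd n \<and> squarefree e. (- 1) ^ card (prime_factors e))"
    unfolding moebius_def using assms by (intro sum.mono_neutral_cong_right) auto
  also have "\<dots> = (\<Sum>T\<in>Pow ?P. (- 1) ^ card T)"
  proof (rule sum.reindex_bij_witness[of _ "\<lambda>T. \<Prod>T" prime_factors])
    fix e assume e: "e \<in> {e. e dvd n \<and> squarefree e}"
    then have e0: "e \<noteq> 0" using assms by auto
    have "\<Prod>(prime_factors e) = (\<Prod>p\<in>prime_factors e. p ^ multiplicity p e)"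
      using e e0 squarefree_factorial_semiring'[of e] by (intro prod.cong) auto
    also have "\<dots> = e" using e0 by (simp add: prod_prime_factors)
    finally show "\<Prod>(prime_factors e) = e" .
    show "prime_factors e \<in> Pow ?P" using e assms dvd_prime_factors[of n e] by simp
  next
    fix T assume T: "T \<in> Pow ?P"
    then have fin: "finite T" by (auto intro: finite_subset)
    show "prime_factors (\<Prod>T) = T" using pf[of T] T fin by simp
    have "mset_set T \<subseteq># prime_factorization n"
      using T fin by (intro mset_subset_eqI) (auto simp: count_mset_set' Suc_le_eq)
    then have "\<Prod>T dvd n" using pf[of T] pos[of T] T assms by (simp flip: prime_factorization_subset_iff_dvd)
    moreover have "squarefree (\<Prod>T)"
    proof (subst squarefree_factorial_semiring')
      show "\<forall>p\<in>prime_factors (\<Prod>T). multiplicity p (\<Prod>T) = 1"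
      proof
        fix p assume "p \<in> prime_factors (\<Prod>T)"
        then have "p \<in> T" "prime p" using pf[of T] T fin by auto
        then have "multiplicity p (\<Prod>T) = count (mset_set T) p"
          using pf[of T] T by (simp flip: count_prime_factorization_prime)
        then show "multiplicity p (\<Prod>T) = 1" using \<open>p \<in> T\<close> fin by simp
      qed
    qed (use pos[of T] T in auto)
    ultimately show "\<Prod>T \<in> {e. e dvd n \<and> squarefree e}" by simp
  qed auto
  also have "\<dots> = (\<Prod>p\<in>?P. (- 1) + (1 :: int))" by (subst prod_add) simp_all
  also have "\<dots> = of_bool (?P = {})" by (auto simp: card_gt_0_iff)
  also have "?P = {} \<longleftrightarrow> n = 1" using assms by (auto simp: prime_factorization_empty_iff)
  finally show ?thesis .
qed

lemma sum_powi_roots_unity: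
  assumes d: "0 < d"
  shows "(\<Sum>z | z ^ d = 1. z powi j) = (of_nat (d * of_bool (int d dvd j)) :: complex)"
proof -
  define \<zeta> where "\<zeta> = cis (2 * pi / real d)"
  have pr: "prim_root d \<zeta>" unfolding \<zeta>_def by (rule prim_root_cis[OF d])
  have \<zeta>0: "\<zeta> \<noteq> 0" by (simp add: \<zeta>_def)
  have "(\<Sum>z | z ^ d = 1. z powi j) = (\<Sum>k<d. cis (2 * pi * real k / real d) powi j)"
    by (rule sum.reindex_bij_betw[OF bij_betw_roots_unity[OF d], symmetric])
  also have "\<dots> = (\<Sum>k<d. (\<zeta> powi j) ^ k)"
    by (intro sum.cong refl) (simp add: \<zeta>_def cis_power_int DeMoivre mult_ac)
  also have "\<dots> = of_nat (d * of_bool (int d dvd j))"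
  proof (cases "int d dvd j")
    case True
    then obtain i where "j = int d * i" by (elim dvdE)
    then have "\<zeta> powi j = 1" using prim_root_power_eq_1_iff[OF pr, of d] by (simp add: power_int_mult)
    then show ?thesis using True by simp
  next
    case False
    have "(\<zeta> powi j) ^ d = (\<zeta> ^ d) powi j" by (simp add: mult.commute flip: power_int_of_nat power_int_mult)
    also have "\<dots> = 1" using prim_root_power_eq_1_iff[OF pr, of d] by simp
    finally have p1: "(\<zeta> powi j) ^ d = 1" .
    have "\<zeta> powi j \<noteq> 1"
    proof
      assume 1: "\<zeta> powi j = 1"
      have "\<zeta> ^ nat (j mod int d) = \<zeta> powi (j - int d * (j div int d))"
        using d by (simp add: power_int_def minus_mult_div_eq_mod)
      also have "\<dots> = 1" using 1 \<zeta>0 prim_root_power_eq_1_iff[OF pr, of d] by (simp add: power_int_diff power_int_mult)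
      finally have "d dvd nat (j mod int d)" using prim_root_power_eq_1_iff[OF pr] by blast
      then have "int d dvd j mod int d" using d by (metis dvd_nat_abs_iff int_dvd_int_iff int_nat_eq of_nat_0_less_iff pos_mod_sign)
      then show False using False by (simp add: dvd_mod_iff)
    qed
    then show ?thesis using False p1 by (simp add: geometric_sum)
  qed
  finally show ?thesis .
qed

section \<open>The energy at primitive roots of unity\<close>

definition pair_count :: "nat \<Rightarrow> (nat \<Rightarrow> nat) \<Rightarrow> nat \<Rightarrow> int" where
  "pair_count n w d = (\<Sum>k<n. \<Sum>l<n. of_bool (int d dvd int (w k) - int (w l)))"

text \<open>Both divisors range over intervals and an indicator selects the right pairs: this form
  of Moebius inversion uses bounded sums only, without division.\<close>

definition root_energy :: "nat \<Rightarrow> (nat \<Rightarrow> nat) \<Rightarrow> nat \<Rightarrow> int" where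
  "root_energy n w M =
    (\<Sum>d<M + 1. \<Sum>e<M + 1. of_bool (d * e = M) * (moebius e * (int d * pair_count n w d)))"

text \<open>On the unit circle conjugation is inversion, so the squared modulus expands into powers
  with exponents \<open>w k - w l\<close>; summation over the d-th roots keeps the exponents
  divisible by \<open>d\<close>.\<close>

lemma sum_norm_roots_unity:
  assumes d: "0 < d"
  shows "(\<Sum>z | z ^ d = 1. (cmod (\<Sum>k<n. z ^ w k))\<^sup>2) = real_of_int (int d * pair_count n w d)"
proof -
  have "(\<Sum>z | z ^ d = 1. of_real ((cmod (\<Sum>k<n. z ^ w k))\<^sup>2) :: complex) =
      (\<Sum>z | z ^ d = 1. \<Sum>k<n. \<Sum>l<n. z powi (int (w k) - int (w l)))"
  proof (rule sum.cong[OF refl])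
    fix z :: complex assume "z \<in> {z. z ^ d = 1}"
    then have z: "z ^ d = 1" by simp
    then have z0: "z \<noteq> 0" using d by (auto simp: power_0_left)
    have "cmod z ^ d = 1" using z by (metis norm_one norm_power)
    then have "cmod z = 1" using d by (metis norm_ge_zero power_eq_1_iff not_gr0 real_norm_def abs_of_nonneg)
    then have cnj: "cnj z = inverse z"
      using divide_conv_cnj[of z 1] by (simp add: inverse_eq_divide)
    have "of_real ((cmod (\<Sum>k<n. z ^ w k))\<^sup>2) = (\<Sum>k<n. z ^ w k) * cnj (\<Sum>k<n. z ^ w k)"
      by (rule complex_norm_square)
    also have "\<dots> = (\<Sum>k<n. \<Sum>l<n. z ^ w k * inverse z ^ w l)" by (simp add: sum_product cnj)
    also have "\<dots> = (\<Sum>k<n. \<Sum>l<n. z powi (int (w k) - int (w l)))"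
      using z0 by (simp add: power_int_diff power_inverse divide_inverse)
    finally show "of_real ((cmod (\<Sum>k<n. z ^ w k))\<^sup>2) = (\<Sum>k<n. \<Sum>l<n. z powi (int (w k) - int (w l)))" .
  qed
  also have "\<dots> = (\<Sum>k<n. \<Sum>l<n. \<Sum>z | z ^ d = 1. z powi (int (w k) - int (w l)))"
    by (subst sum.swap) (intro sum.cong refl sum.swap)
  also have "\<dots> = of_real (real_of_int (int d * pair_count n w d))"
    unfolding sum_powi_roots_unity[OF d] pair_count_def by (simp add: sum_distrib_left mult.commute)
  finally have "(of_real (\<Sum>z | z ^ d = 1. (cmod (\<Sum>k<n. z ^ w k))\<^sup>2) :: complex) =
    of_real (real_of_int (int d * pair_count n w d))" by simp
  then show ?thesis by (simp only: of_real_eq_iff)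
qed

text \<open>The energy is \<open>\<Sum>\<bar>A(z)\<bar>\<^sup>2\<close> over the primitive \<open>M\<close>-th roots of unity: the sum over all \<open>d\<close>-th
  roots is \<open>d\<close> times the number of pairs congruent modulo \<open>d\<close>, and Moebius inversion isolates
  the primitive ones.\<close>

lemma root_energy_eq:
  assumes M: "0 < M"
  shows "real_of_int (root_energy n w M) = (\<Sum>z | prim_root M z. (cmod (\<Sum>k<n. z ^ w k))\<^sup>2)"
proof -
  define f where "f = (\<lambda>z :: complex. (cmod (\<Sum>k<n. z ^ w k))\<^sup>2)"
  have fin: "finite {z :: complex. z ^ M = 1}" using M by (intro finite_roots_unity) simp
  have "root_energy n w M = (\<Sum>e<M + 1. \<Sum>d<M + 1. of_bool (d * e = M) * (moebius e * (int d * pair_count n w d)))"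
    unfolding root_energy_def by (rule sum.swap)
  also have "\<dots> = (\<Sum>e | e dvd M. moebius e * (int (M div e) * pair_count n w (M div e)))"
  proof (rule sum.mono_neutral_cong_right)
    show "{e. e dvd M} \<subseteq> {..<M + 1}" using M by (auto dest: dvd_imp_le)
    show "\<forall>e\<in>{..<M + 1} - {e. e dvd M}.
      (\<Sum>d<M + 1. of_bool (d * e = M) * (moebius e * (int d * pair_count n w d))) = 0"
      by (intro ballI sum.neutral) auto
    fix e assume "e \<in> {e. e dvd M}"
    then have e: "e dvd M" "0 < e" using M by (auto intro: Nat.gr0I)
    have eq: "d * e = M \<longleftrightarrow> d = M div e" for d using e by auto
    show "(\<Sum>d<M + 1. of_bool (d * e = M) * (moebius e * (int d * pair_count n w d))) =
      moebius e * (int (M div e) * pair_count n w (M div e))"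
      unfolding eq by (subst sum.mono_neutral_right[of _ "{M div e}"]) (auto simp: div_le_dividend less_Suc_eq_le)
  qed simp
  finally have "real_of_int (root_energy n w M) =
      (\<Sum>e | e dvd M. real_of_int (moebius e) * real_of_int (int (M div e) * pair_count n w (M div e)))" by simp
  also have "\<dots> = (\<Sum>e | e dvd M. \<Sum>z | z ^ M = 1. of_bool (z ^ (M div e) = 1) * real_of_int (moebius e) * f z)"
  proof (rule sum.cong[OF refl])
    fix e assume "e \<in> {e. e dvd M}"
    then have e: "e dvd M" by simp
    then have d: "0 < M div e" using M by (auto simp: div_greater_zero_iff intro: dvd_imp_le Nat.gr0I)
    have sub: "z ^ M = 1" if "z ^ (M div e) = 1" for z :: complex
      using that e by (metis dvd_div_mult_self power_mult power_one)
    have "real_of_int (int (M div e) * pair_count n w (M div e)) = (\<Sum>z | z ^ (M div e) = 1. f z)"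
      unfolding f_def by (rule sum_norm_roots_unity[OF d, symmetric])
    also have "\<dots> = (\<Sum>z | z ^ M = 1. of_bool (z ^ (M div e) = 1) * f z)"
      using sub fin by (intro sum.mono_neutral_cong_left) auto
    finally show "real_of_int (moebius e) * real_of_int (int (M div e) * pair_count n w (M div e)) =
      (\<Sum>z | z ^ M = 1. of_bool (z ^ (M div e) = 1) * real_of_int (moebius e) * f z)"
      by (simp add: sum_distrib_left mult_ac)
  qed
  also have "\<dots> = (\<Sum>z | z ^ M = 1. \<Sum>e | e dvd M. of_bool (z ^ (M div e) = 1) * real_of_int (moebius e) * f z)"
    by (rule sum.swap)
  also have "\<dots> = (\<Sum>z | z ^ M = 1. of_bool (prim_root M z) * f z)"
  proof (rule sum.cong[OF refl])
    fix z :: complex assume "z \<in> {z. z ^ M = 1}"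
    then obtain s where s: "s dvd M" "prim_root s z" using prim_root_exists[OF M] by blast
    have s0: "0 < s" using s(1) M by (auto intro: Nat.gr0I)
    \<comment> \<open>For \<open>z\<close> of order \<open>s\<close> the condition means that
      \<open>e\<close> divides M/s, so the Moebius sum is 1 for \<open>s = M\<close> and 0 for
      smaller orders.\<close>
    have "(\<Sum>e | e dvd M. of_bool (z ^ (M div e) = 1) * moebius e) = (\<Sum>e | e dvd M div s. moebius e)"
    proof (rule sum.mono_neutral_cong_right)
      have iff: "z ^ (M div e) = 1 \<longleftrightarrow> e dvd M div s" if eM: "e dvd M" for e
      proof -
        obtain k where k: "M = e * k" using eM by (elim dvdE)
        then have e0: "0 < e" using M by auto
        obtain l where l: "M = s * l" using s(1) by (elim dvdE)
        have "s dvd k \<longleftrightarrow> e * s dvd e * k" using e0 by simp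
        also have "\<dots> \<longleftrightarrow> s * e dvd s * l" using k l by (simp add: mult.commute)
        also have "\<dots> \<longleftrightarrow> e dvd l" using s0 by simp
        finally have "s dvd k \<longleftrightarrow> e dvd l" .
        moreover have "M div e = k" using k e0 by simp
        moreover have "M div s = l" using l s0 by simp
        ultimately show ?thesis using prim_root_power_eq_1_iff[OF s(2), of k] by simp
      qed
      have "M div s dvd M" using dvd_div_mult_self[OF s(1)] by (metis dvd_triv_left)
      then have sub: "e dvd M" if "e dvd M div s" for e using that by (metis dvd_trans)
      then show "{e. e dvd M div s} \<subseteq> {e. e dvd M}" by blast
      show "\<forall>e\<in>{e. e dvd M} - {e. e dvd M div s}. of_bool (z ^ (M div e) = 1) * moebius e = 0"
        using iff by simp
      fix e assume "e \<in> {e. e dvd M div s}"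
      then show "of_bool (z ^ (M div e) = 1) * moebius e = moebius e"
        using iff[of e] sub[of e] by simp
    qed (use M in simp)
    also have "\<dots> = of_bool (M div s = 1)"
    proof (rule sum_moebius)
      show "0 < M div s" using s M s0 by (simp add: div_greater_zero_iff dvd_imp_le)
    qed
    also have "M div s = 1 \<longleftrightarrow> prim_root M z"
    proof
      assume "M div s = 1"
      then have "M = s" using s(1) by (metis dvd_mult_div_cancel mult.right_neutral)
      then show "prim_root M z" using s(2) by simp
    next
      assume "prim_root M z"
      then have "M = s" using prim_root_unique s(2) by blast
      then show "M div s = 1" using s0 by simp
    qed
    finally have *: "(\<Sum>e | e dvd M. of_bool (z ^ (M div e) = 1) * moebius e) = of_bool (prim_root M z)" .
    have "(\<Sum>e | e dvd M. of_bool (z ^ (M div e) = 1) * real_of_int (moebius e) * f z) =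
      real_of_int (\<Sum>e | e dvd M. of_bool (z ^ (M div e) = 1) * moebius e) * f z"
      by (simp add: sum_distrib_right)
    then show "(\<Sum>e | e dvd M. of_bool (z ^ (M div e) = 1) * real_of_int (moebius e) * f z) = of_bool (prim_root M z) * f z"
      unfolding * by simp
  qed
  also have "\<dots> = (\<Sum>z | prim_root M z. f z)"
    using fin by (intro sum.mono_neutral_cong_right) (auto simp: prim_root_power_eq_1_iff)
  finally show ?thesis unfolding f_def .
qed

lemma root_energy_eq_0_iff:
  assumes M: "0 < M"
  shows "root_energy n w M = 0 \<longleftrightarrow> (\<forall>z. prim_root M z \<longrightarrow> (\<Sum>k<n. z ^ w k) = 0)"
proof -
  have "finite {z. prim_root M z}"
  proof (rule finite_subset)
    show "{z. prim_root M z} \<subseteq> {z. z ^ M = 1}" by (intro Collect_mono impI) (simp add: prim_root_power_eq_1_iff)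
    show "finite {z :: complex. z ^ M = 1}" using M by (intro finite_roots_unity) simp
  qed
  then have "real_of_int (root_energy n w M) = 0 \<longleftrightarrow> (\<forall>z\<in>{z. prim_root M z}. (cmod (\<Sum>k<n. z ^ w k))\<^sup>2 = 0)"
    unfolding root_energy_eq[OF M] by (rule sum_nonneg_eq_0_iff) simp
  then show ?thesis by simp
qed

section \<open>Bounded tests for T1 and T2\<close>

text \<open>Powers of a prime are recognized by their divisors, which avoids exponentiation in the
  program.\<close>

definition power_of :: "nat \<Rightarrow> nat \<Rightarrow> bool" where
  "power_of p q \<longleftrightarrow> 1 < q \<and> (\<forall>d<q + 1. d dvd q \<longrightarrow> d = 1 \<or> p dvd d)"

lemma power_of_iff:
  assumes p: "prime p"
  shows "power_of p q \<longleftrightarrow> primepow q \<and> aprimedivisor q = p"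
proof
  assume q: "power_of p q"
  then have q1: "1 < q" by (simp add: power_of_def)
  have div: "d = 1 \<or> p dvd d" if "d dvd q" for d
  proof -
    have "d < q + 1" using dvd_imp_le[OF that] q1 by simp
    then show ?thesis using q that by (simp add: power_of_def)
  qed
  have "\<not> is_unit p" using p not_prime_unit by blast
  then obtain l where l: "q = p ^ multiplicity p q * l" "\<not> p dvd l"
    using multiplicity_decompose'[of q p] q1 by auto
  have "l dvd q" using l(1) by (metis dvd_triv_right)
  then have "l = 1" using div l(2) by blast
  then have q: "p ^ multiplicity p q = q" using l(1) by simp
  then have "0 < multiplicity p q" using q1 by (metis less_irrefl not_gr0 power_0)
  then show "primepow q \<and> aprimedivisor q = p" using primepowI[OF p _ q] by blast
next
  assume q: "primepow q \<and> aprimedivisor q = p"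
  then obtain k where k: "q = p ^ Suc k" by (metis primepowE)
  show "power_of p q" unfolding power_of_def
  proof (intro conjI allI impI)
    show "1 < q" using primepow_gt_Suc_0 q by simp
    fix d assume "d dvd q"
    then obtain j where "d = p ^ j" using divides_primepow_nat[OF p] k by blast
    then show "d = 1 \<or> p dvd d" by (cases j) auto
  qed
qed

text \<open>A bound for both \<open>|A|\<close> and \<open>D + 1\<close> that needs no maximum.\<close>

definition size_bound :: "nat \<Rightarrow> (nat \<Rightarrow> nat) \<Rightarrow> nat" where
  "size_bound n w = n + (\<Sum>k<n. w k)"

text \<open>T1 as equality of prime factorizations: the exponent of \<open>p\<close> in
  \<open>n\<close> is the number of its positive powers dividing \<open>n\<close>, on the other side
  the number of its powers in \<open>S_set A\<close>. Sums replace the product. The range suffices,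
  as elements of \<open>S_set A\<close> are at most 2 D and divisors of \<open>n\<close> at most
  \<open>n\<close>.\<close>

definition T1_test :: "nat \<Rightarrow> (nat \<Rightarrow> nat) \<Rightarrow> bool" where
  "T1_test n w \<longleftrightarrow> (\<forall>p<2 * size_bound n w. prime p \<longrightarrow>
     (\<Sum>q<2 * size_bound n w. of_bool (power_of p q \<and> root_energy n w q = 0)) =
     (\<Sum>q<2 * size_bound n w. of_bool (power_of p q \<and> q dvd n) :: int))"

text \<open>The premise says that all prime power components of \<open>M\<close> lie in
  \<open>S_set A\<close>; the component at \<open>p\<close> is the power \<open>q\<close> of
  \<open>p\<close> whose cofactor \<open>r\<close> is prime to \<open>p\<close>.\<close>

definition T2_test :: "nat \<Rightarrow> (nat \<Rightarrow> nat) \<Rightarrow> bool" where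
  "T2_test n w \<longleftrightarrow> (\<forall>M<2 * size_bound n w * (size_bound n w * size_bound n w). 1 < M \<longrightarrow>
     (\<forall>p<M + 1. \<forall>q<M + 1. \<forall>r<M + 1.
        prime p \<and> power_of p q \<and> q * r = M \<and> \<not> p dvd r \<longrightarrow> root_energy n w q = 0) \<longrightarrow>
     root_energy n w M = 0)"

section \<open>Correctness of the tests\<close>

locale presented =
  fixes A :: "int set" and xs :: "int list" and n :: nat and w :: "nat \<Rightarrow> nat"
  assumes fin: "finite A" and ne: "A \<noteq> {}" and pres: "presents xs A"
    and n_def: "n = length xs" and w: "\<And>k. k < n \<Longrightarrow> int (w k) = xs ! k"
begin

lemma n_card: "n = card A"
  using pres card_normalized[of A] distinct_card[of xs] by (simp add: presents_def n_def)

lemma mask_eval_normalized: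
  assumes "z \<noteq> 0" shows "(\<Sum>k<n. z ^ w k) = mask_eval (normalized A) z"
proof -
  have "bij_betw (\<lambda>k. xs ! k) {..<n} (normalized A)"
    using pres bij_betw_nth[of xs "{..<n}" "normalized A"] by (simp add: presents_def n_def)
  then have "mask_eval (normalized A) z = (\<Sum>k<n. z powi (xs ! k))"
    unfolding mask_eval_def by (rule sum.reindex_bij_betw[symmetric])
  also have "\<dots> = (\<Sum>k<n. z ^ w k)" by (intro sum.cong refl) (simp flip: w)
  finally show ?thesis by simp
qed

lemma root_energy_vanishes:
  assumes "0 < s" shows "root_energy n w s = 0 \<longleftrightarrow> vanishes A s"
proof -
  have "root_energy n w s = 0 \<longleftrightarrow> vanishes (normalized A) s"
    unfolding root_energy_eq_0_iff[OF assms] vanishes_def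
    using mask_eval_normalized prim_root_nonzero[OF _ assms] by auto
  also have "normalized A = (\<lambda>a. a + (- Min A)) ` A" by (simp add: normalized_def)
  also have "vanishes \<dots> s \<longleftrightarrow> vanishes A s" by (rule vanishes_translate[OF assms])
  finally show ?thesis .
qed

definition D where "D = diam A"

lemma D_bound: "D + 1 \<le> size_bound n w" "n \<le> size_bound n w"
proof -
  have "Max A - Min A \<in> set xs"
    using pres fin ne by (auto simp: presents_def normalized_def)
  then obtain k where k: "k < n" "xs ! k = Max A - Min A" by (metis in_set_conv_nth n_def)
  then have "w k = D" using w[OF k(1)] by (simp add: D_def diam_def)
  moreover have "w k \<le> (\<Sum>k<n. w k)" using k(1) by (intro member_le_sum) auto
  ultimately show "D + 1 \<le> size_bound n w" "n \<le> size_bound n w" using k(1) by (auto simp: size_bound_def)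
qed

lemma totient_le_D:
  assumes "vanishes A s" "0 < s" shows "totient s \<le> D"
proof -
  have deg: "degree (cyclotomic s) = totient s"
  proof -
    have "{k. k \<in> {1..s} \<and> coprime k s} = totatives s" by (auto simp: totatives_def)
    then show ?thesis unfolding cyclotomic_def totient_def by (subst degree_prod_eq_sum_degree) simp_all
  qed
  have "poly (mask_poly A) 1 \<noteq> 0" using poly_mask_poly_1[OF fin ne] fin ne by simp
  then have "mask_poly A \<noteq> 0" by auto
  then have "degree (cyclotomic s) \<le> degree (mask_poly A)"
    using cyclotomic_dvd_mask_iff[OF fin ne assms(2)] assms(1) by (intro dvd_imp_degree_le) auto
  also have "degree (mask_poly A) \<le> D"
    unfolding mask_poly_def
  proof (rule degree_sum_le)
    show "finite (normalized A)" using fin by (simp add: normalized_def)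
    fix a assume "a \<in> normalized A"
    then have "nat a \<le> D" using fin by (auto simp: normalized_def D_def diam_def intro!: nat_mono)
    then show "degree (monom (1::complex) (nat a)) \<le> D" by (simp add: degree_monom_eq)
  qed
  finally show ?thesis using deg by simp
qed

text \<open>For a power of \<open>p\<close> the totient is s (1 - 1/p), hence at least s/2, and it
  is at most \<open>D\<close> by degrees.\<close>

lemma primepow_bound:
  assumes "vanishes A s" "primepow s" shows "s \<le> 2 * D"
proof -
  obtain p k where p: "prime p" "s = p ^ Suc k" using primepowE[OF assms(2)] by metis
  have p2: "2 \<le> p" using p prime_ge_2_nat by blast
  have "p \<le> 2 * (p - 1)" using p2 by simp
  then have "p * p ^ k \<le> 2 * (p - 1) * p ^ k" by (rule mult_le_mono1)
  then have "s \<le> 2 * totient s"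
    unfolding p(2) totient_prime_power_Suc[OF p(1)] by (simp add: mult_ac)
  also have "totient s \<le> D" using totient_le_D[OF assms(1)] primepow_gt_0_nat[OF assms(2)] by simp
  finally show ?thesis by simp
qed

text \<open>Both sides of T1 factor into primes below prime powers, so equality means equal counts
  for every \<open>p\<close>; outside the tested range both counts are 0.\<close>

lemma T1_test_iff: "T1 A \<longleftrightarrow> T1_test n w"
proof -
  let ?a = "aprimedivisor :: nat \<Rightarrow> nat" and ?X = "2 * size_bound n w"
  define S where "S = S_set A"
  note S = S_set_iff[OF fin ne, folded S_def]
  have finS: "finite S" unfolding S_def by (rule finite_S_set[OF fin ne])
  have n0: "0 < n" using fin ne n_card by (simp add: card_gt_0_iff)
  have finP: "finite (primepow_factors n)" using n0 by (intro finite_primepow_factors) simp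
  have Sb: "s < ?X" if "s \<in> S" for s using primepow_bound[of s] S that D_bound by force
  have Pb: "s < ?X" if "s \<in> primepow_factors n" for s
  proof -
    have "s \<le> n" using that n0 by (auto simp: primepow_factors_def dvd_imp_le)
    then show ?thesis using D_bound by simp
  qed
  have count: "count (image_mset ?a (mset_set X)) p = card {q \<in> X. ?a q = p}" if "finite X" for X p
    using that by (simp add: count_image_mset' eq_commute)
  have pfS: "prime_factorization (\<Prod>s\<in>S. ?a s) = image_mset ?a (mset_set S)"
  proof -
    have "\<And>p. p \<in># image_mset ?a (mset_set S) \<Longrightarrow> prime p"
      using finS S aprimedivisor_nat(1) primepow_gt_Suc_0 by (metis (no_types, lifting) finite_set_mset_mset_set image_iff less_irrefl set_image_mset)
    then show ?thesis by (metis prime_factorization_prod_mset_primes prod_unfold_prod_mset)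
  qed
  have pfn: "prime_factorization n = image_mset ?a (mset_set (primepow_factors n))"
    using n0 by (intro aprimedivisor_primepow_factors_conv_prime_factorization[symmetric]) simp
  have Sprod0: "0 < (\<Prod>s\<in>S. ?a s)"
    using S primepow_gt_Suc_0 by (intro prod_pos aprimedivisor_gt_0_nat) auto
  have "T1 A \<longleftrightarrow> n = (\<Prod>s\<in>S. ?a s)" using T1_iff[OF fin ne] by (simp add: n_card S_def)
  also have "\<dots> \<longleftrightarrow> prime_factorization n = prime_factorization (\<Prod>s\<in>S. ?a s)"
    using n0 Sprod0 prime_factorization_unique[of n "\<Prod>s\<in>S. ?a s"] by auto
  also have "\<dots> \<longleftrightarrow> (\<forall>p. card {q \<in> S. ?a q = p} = card {q \<in> primepow_factors n. ?a q = p})"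
    unfolding pfS pfn multiset_eq_iff count[OF finS] count[OF finP] by (simp add: eq_commute)
  also have "\<dots> \<longleftrightarrow> (\<forall>p<?X. prime p \<longrightarrow> card {q \<in> S. ?a q = p} = card {q \<in> primepow_factors n. ?a q = p})"
  proof (intro iffI allI impI)
    fix p assume *: "\<forall>p<?X. prime p \<longrightarrow> card {q \<in> S. ?a q = p} = card {q \<in> primepow_factors n. ?a q = p}"
    have le: "prime (?a q) \<and> ?a q < ?X" if q: "q \<in> S \<union> primepow_factors n" for q
    proof -
      have "1 < q" using q S primepow_gt_Suc_0 by (auto simp: primepow_factors_def)
      then have "prime (?a q)" "?a q \<le> q" using aprimedivisor_nat(1)[of q] aprimedivisor_le_nat[of q] by auto
      moreover have "q < ?X" using q Sb[of q] Pb[of q] by blast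
      ultimately show ?thesis by simp
    qed
    show "card {q \<in> S. ?a q = p} = card {q \<in> primepow_factors n. ?a q = p}"
    proof (cases "prime p \<and> p < ?X")
      case False
      then have "{q \<in> S. ?a q = p} = {}" "{q \<in> primepow_factors n. ?a q = p} = {}" using le by blast+
      then show ?thesis by (simp only:)
    qed (use * in blast)
  qed blast
  also have "\<dots> \<longleftrightarrow> T1_test n w"
  proof -
    have 1: "(\<Sum>q<?X. of_bool (power_of p q \<and> root_energy n w q = 0)) = int (card {q \<in> S. ?a q = p})"
      if p: "prime p" for p
    proof -
      have "{q \<in> S. ?a q = p} = {q. q < ?X \<and> power_of p q \<and> root_energy n w q = 0}"
      proof (rule Collect_cong)
        fix q
        show "(q \<in> S \<and> ?a q = p) = (q < ?X \<and> power_of p q \<and> root_energy n w q = 0)"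
        proof (cases "primepow q")
          case True
          then have "0 < q" by (rule primepow_gt_0_nat)
          then show ?thesis
            using True Sb[of q] S[of q] power_of_iff[OF p, of q] root_energy_vanishes[of q] by auto
        qed (use S[of q] power_of_iff[OF p, of q] in auto)
      qed
      then show ?thesis by (simp add: Collect_conj_eq lessThan_def)
    qed
    have 2: "(\<Sum>q<?X. of_bool (power_of p q \<and> q dvd n)) = int (card {q \<in> primepow_factors n. ?a q = p})"
      if p: "prime p" for p
    proof -
      have "{q \<in> primepow_factors n. ?a q = p} = {q. q < ?X \<and> power_of p q \<and> q dvd n}"
        using Pb power_of_iff[OF p] by (auto simp: primepow_factors_def)
      then show ?thesis by (simp add: Collect_conj_eq lessThan_def)
    qed
    show ?thesis unfolding T1_test_def using 1 2 by simp
  qed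
  finally show ?thesis .
qed

text \<open>A product of prime powers is at most its totient times its radical. The totient is at
  most \<open>D\<close> by degrees, and the radical divides the product over \<open>S_set A\<close>,
  which is \<open>n\<close> by T1.\<close>

lemma partial_product_bound:
  assumes T1: "T1 A" and P: "finite P" "\<And>p. p \<in> P \<Longrightarrow> prime p \<and> 1 \<le> e p \<and> vanishes A (p ^ e p)"
    and vanishes: "vanishes A (\<Prod>p\<in>P. p ^ e p)"
  shows "(\<Prod>p\<in>P. p ^ e p) \<le> D * n"
proof -
  let ?a = "aprimedivisor :: nat \<Rightarrow> nat" and ?M = "\<Prod>p\<in>P. p ^ e p"
  have p0: "0 < p" if "p \<in> P" for p using P(2)[OF that] prime_gt_0_nat by blast
  have cop: "pairwise coprime ((\<lambda>p. p ^ e p) ` P)"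
    using P(2) by (auto simp: pairwise_def intro!: coprime_power_left_iff[THEN iffD2] primes_coprime)
  have inj: "inj_on (\<lambda>p. p ^ e p) P"
  proof (rule inj_onI)
    fix p q assume pq: "p \<in> P" "q \<in> P" "p ^ e p = q ^ e q"
    have "prime p" "prime q" "0 < e p" using P(2)[OF pq(1)] P(2)[OF pq(2)] by simp_all
    then show "p = q" using pq(3) by (rule prime_power_eq_imp_eq)
  qed
  have tot: "totient ?M = (\<Prod>p\<in>P. totient (p ^ e p))"
    by (rule totient_prod_coprime[OF cop inj])
  have "?M \<le> (\<Prod>p\<in>P. totient (p ^ e p) * p)"
  proof (rule prod_mono, safe)
    fix p assume p: "p \<in> P"
    then have e: "e p = Suc (e p - 1)" using P(2) by force
    have "totient (p ^ e p) = p ^ (e p - 1) * (p - 1)"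
      using P(2)[OF p] by (intro totient_prime_power) auto
    moreover have "1 \<le> p - 1" using P(2)[OF p] prime_ge_2_nat[of p] by auto
    ultimately have "p ^ (e p - 1) * 1 \<le> totient (p ^ e p)" by (metis mult_le_mono2)
    then have "p ^ (e p - 1) * p \<le> totient (p ^ e p) * p" by simp
    then show "p ^ e p \<le> totient (p ^ e p) * p" by (subst (1) e) simp
  qed
  also have "\<dots> = totient ?M * \<Prod>P" unfolding tot by (simp add: prod.distrib)
  also have "\<dots> \<le> D * n"
  proof (rule mult_le_mono)
    show "totient ?M \<le> D" using vanishes p0 by (intro totient_le_D prod_pos) auto
    have "\<Prod>P = (\<Prod>s\<in>(\<lambda>p. p ^ e p) ` P. ?a s)"
      using P(2) inj by (subst prod.reindex) (auto simp: aprimedivisor_prime_power Suc_le_eq)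
    also have "\<dots> \<le> (\<Prod>s\<in>S_set A. ?a s)"
    proof (rule dvd_imp_le[OF prod_dvd_prod_subset])
      show "finite (S_set A)" by (rule finite_S_set[OF fin ne])
      show "(\<lambda>p. p ^ e p) ` P \<subseteq> S_set A"
      proof (rule image_subsetI)
        fix p assume "p \<in> P"
        then have "prime p" "0 < e p" "vanishes A (p ^ e p)" using P(2)[of p] by simp_all
        then show "p ^ e p \<in> S_set A" using S_set_iff[OF fin ne] by simp
      qed
      show "0 < (\<Prod>s\<in>S_set A. ?a s)"
        using S_set_iff[OF fin ne] primepow_gt_Suc_0 by (intro prod_pos aprimedivisor_gt_0_nat) auto
    qed
    also have "\<dots> = n" using T1 T1_iff[OF fin ne] n_card by simp
    finally show "\<Prod>P \<le> n" .
  qed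
  finally show ?thesis .
qed

text \<open>Conversely, products are built up one prime at a time: the previous product vanishes by
  induction, hence is at most D n, and one further factor of at most 2 D stays within the range of
  the test.\<close>

lemma T2_test_iff:
  assumes T1: "T1 A" shows "T2 A \<longleftrightarrow> T2_test n w"
proof
  assume T2: "T2 A"
  show "T2_test n w" unfolding T2_test_def
  proof (intro allI impI)
    fix M assume M: "1 < M"
      and comp: "\<forall>p<M + 1. \<forall>q<M + 1. \<forall>r<M + 1.
        prime p \<and> power_of p q \<and> q * r = M \<and> \<not> p dvd r \<longrightarrow> root_energy n w q = 0"
    let ?P = "prime_factors M" and ?e = "\<lambda>p. multiplicity p M"
    have "vanishes A (p ^ ?e p)" if p: "p \<in> ?P" for p
    proof -
      have pp: "prime p" "0 < ?e p" using p by (auto simp: prime_factors_multiplicity)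
      have pM: "p dvd M" using p by (rule in_prime_factors_imp_dvd)
      have "\<not> is_unit p" using pp not_prime_unit by blast
      then obtain r where r: "M = p ^ ?e p * r" "\<not> p dvd r"
        using multiplicity_decompose'[of M p] M by auto
      have pw: "power_of p (p ^ ?e p)"
        using power_of_iff[OF pp(1)] pp by (simp add: aprimedivisor_prime_power)
      have "p \<le> M" "p ^ ?e p \<le> M" "r \<le> M"
        using M pM multiplicity_dvd[of p M] r(1) by (auto intro!: dvd_imp_le) (metis dvd_triv_right)
      then have "root_energy n w (p ^ ?e p) = 0"
        using comp[rule_format, of p "p ^ ?e p" r] pp(1) pw r by simp
      then show ?thesis using root_energy_vanishes pp(1) prime_gt_0_nat by simp
    qed
    moreover have "?P \<noteq> {}" using M by (auto simp: prime_factorization_empty_iff)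
    moreover have "prime p \<and> 1 \<le> ?e p" if "p \<in> ?P" for p
      using that by (auto simp: prime_factors_multiplicity Suc_le_eq)
    ultimately have "vanishes A (\<Prod>p\<in>?P. p ^ ?e p)"
      using T2[unfolded T2_iff[OF fin ne], rule_format, of ?P ?e] by auto
    then have "vanishes A M" using M by (simp add: prod_prime_factors)
    then show "root_energy n w M = 0" using root_energy_vanishes M by simp
  qed
next
  assume test: "T2_test n w"
  have "vanishes A (\<Prod>p\<in>P. p ^ e p)"
    if "finite P" "P \<noteq> {}" "\<forall>p\<in>P. prime p \<and> 1 \<le> e p \<and> vanishes A (p ^ e p)" for P and e :: "nat \<Rightarrow> nat"
    using that
  proof (induction P rule: finite_ne_induct)
    case (singleton p)
    then show ?case by simp
  next
    case (insert p P)
    let ?M' = "\<Prod>p\<in>P. p ^ e p" and ?M = "\<Prod>p\<in>insert p P. p ^ e p"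
    have vanishes': "vanishes A ?M'" using insert by simp
    have pr: "prime r \<and> 1 \<le> e r \<and> vanishes A (r ^ e r)" if "r \<in> insert p P" for r using insert.prems that by blast
    have "?M' \<le> D * n" using partial_product_bound[OF T1 insert.hyps(1) _ vanishes'] pr by blast
    moreover have "p ^ e p \<le> 2 * D"
      using primepow_bound[of "p ^ e p"] pr[of p] by simp
    ultimately have "?M \<le> 2 * D * (D * n)"
      using insert.hyps by (simp add: mult_le_mono)
    also have "\<dots> < 2 * size_bound n w * (size_bound n w * size_bound n w)"
    proof -
      have "2 * D * (D * n) \<le> 2 * D * (size_bound n w * size_bound n w)"
        using D_bound by (intro mult_le_mono) auto
      also have "\<dots> < 2 * size_bound n w * (size_bound n w * size_bound n w)"
        using D_bound by (intro mult_strict_right_mono) auto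
      finally show ?thesis .
    qed
    finally have bound: "?M < 2 * size_bound n w * (size_bound n w * size_bound n w)" .
    have fin': "finite (insert p P)" using insert.hyps by simp
    have M0: "0 < ?M" using pr prime_gt_0_nat by (intro prod_pos) auto
    have p1: "1 < p ^ e p" using pr[of p] prime_gt_1_nat by (intro one_less_power) auto
    have "p ^ e p dvd ?M" using fin' by (intro dvd_prodI) auto
    then have M1: "1 < ?M" using p1 M0 by (auto dest: dvd_imp_le)
    \<comment> \<open>Comparing multiplicities of \<open>r\<close> identifies the component
      \<open>q\<close> with \<open>r ^ e r\<close>.\<close>
    have "root_energy n w q = 0"
      if q: "prime r" "power_of r q" "q * s = ?M" "\<not> r dvd s" for r q s
    proof -
      obtain k where k: "q = r ^ Suc k" using q(2) power_of_iff[OF q(1)] by (metis primepowE)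
      have "\<And>x. x \<in> insert p P \<Longrightarrow> prime x" using pr by blast
      then have m: "multiplicity r ?M = (if r \<in> insert p P then e r else 0)"
        using multiplicity_prod_prime_powers[OF fin' _ q(1)] by blast
      have "multiplicity r (r ^ Suc k * s) = Suc k"
        using q(1,4) by (intro multiplicity_eqI) (simp_all add: prime_gt_0_nat)
      then have mk: "multiplicity r ?M = Suc k" unfolding q(3)[symmetric] k .
      have rP: "r \<in> insert p P"
      proof (rule ccontr)
        assume "r \<notin> insert p P"
        then have "multiplicity r ?M = 0" using m by simp
        then show False using mk by simp
      qed
      moreover have "e r = Suc k" using m mk rP by simp
      ultimately have "q = r ^ e r" using k by simp
      then show ?thesis using pr[OF rP] root_energy_vanishes[of q] q(1) prime_gt_0_nat by simp
    qed
    then have "root_energy n w ?M = 0"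
      using test[unfolded T2_test_def, rule_format, OF bound M1] by blast
    then show ?case using root_energy_vanishes[OF M0] by blast
  qed
  then show "T2 A" unfolding T2_iff[OF fin ne] by blast
qed

end

section \<open>The program\<close>

lemma comput_nat_bind1:
  assumes "comput (\<lambda>e m. int (f e m))" "comput (\<lambda>e m. h (nat (e 0)) m)"
  shows "comput (\<lambda>e m. h (f e m) m)"
  using comput_bind1[OF assms(1), of "\<lambda>x m. h (nat x) m"] assms(2) by simp

lemma comput_nat_bind2:
  assumes "comput (\<lambda>e m. int (f e m))" "comput (\<lambda>e m. int (g e m))"
    "comput (\<lambda>e m. h (nat (e 0)) (nat (e (Suc 0))) m)"
  shows "comput (\<lambda>e m. h (f e m) (g e m) m)"
  using comput_bind2[OF assms(1,2), of "\<lambda>x y m. h (nat x) (nat y) m"] assms(3) by simp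

lemma comput_nat_count:
  assumes "comput (\<lambda>e m. int (b e m))" "comput (\<lambda>e m. of_bool (P (nat (e 0)) (\<lambda>i. e (Suc i)) m))"
  shows "comput (\<lambda>e m. int (\<Sum>i<b e m. of_bool (P i e m)))"
  unfolding of_nat_sum of_nat_of_bool by (rule comput_nat_sum[OF assms])

lemma comput_nat_abs: "comput f \<Longrightarrow> comput (\<lambda>e m. int (nat \<bar>f e m\<bar>))"
proof (erule comput_bind1[where h = "\<lambda>x m. int (nat \<bar>x\<bar>)"])
  have *: "int (nat \<bar>x\<bar>) = x * (of_bool (0 < x) - of_bool (0 < 0 - x))" for x by auto
  show "comput (\<lambda>e m. int (nat \<bar>e 0\<bar>))"
    by (subst *) (intro comput_mult comput_diff comput_pos comput_var comput_const)
qed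

lemma comput_int_dvd:
  assumes "comput f" "comput g" shows "comput (\<lambda>e m. of_bool (f e m dvd g e m))"
proof -
  have *: "x dvd y \<longleftrightarrow> nat \<bar>x\<bar> dvd nat \<bar>y\<bar>" for x y :: int by (simp add: nat_abs_dvd_iff)
  show ?thesis by (subst *) (intro comput_dvd comput_nat_abs assms)
qed

lemmas comput_intros =
  comput_nat_var comput_nat_add comput_nat_mult comput_const comput_nat_eq comput_nat_less comput_dvd
  comput_not comput_conj comput_disj comput_imp comput_all comput_nat_count comput_nat_sum
  comput_mult comput_diff

lemma comput_prime:
  "comput (\<lambda>e m. int (f e m)) \<Longrightarrow> comput (\<lambda>e m. of_bool (prime (f e m)))"
proof (erule comput_nat_bind1[where h = "\<lambda>p m. of_bool (prime p)"])
  have *: "prime p \<longleftrightarrow> 1 < p \<and> (\<forall>d<p + 1. d dvd p \<longrightarrow> d = 1 \<or> d = p)" for p :: nat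
  proof -
    have "d < p + 1" if "1 < p" "d dvd p" for d using dvd_imp_le[OF that(2)] that(1) by simp
    then show ?thesis unfolding prime_nat_iff by blast
  qed
  show "comput (\<lambda>e m. of_bool (prime (nat (e 0))))"
    unfolding * by (intro comput_intros)
qed

lemma comput_power_of:
  "comput (\<lambda>e m. int (f e m)) \<Longrightarrow> comput (\<lambda>e m. int (g e m)) \<Longrightarrow>
    comput (\<lambda>e m. of_bool (power_of (f e m) (g e m)))"
proof (erule (1) comput_nat_bind2[where h = "\<lambda>p q m. of_bool (power_of p q)"])
  show "comput (\<lambda>e m. of_bool (power_of (nat (e 0)) (nat (e (Suc 0)))))"
    unfolding power_of_def by (intro comput_intros)
qed

text \<open>The sign comes from the parity of a count of primes and squarefreeness from a bounded
  search, so that loops suffice.\<close>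

lemma moebius_altdef:
  "moebius e = of_bool (0 < e \<and> (\<forall>x<e + 1. x * x dvd e \<longrightarrow> x = 1)) *
    (1 - 2 * of_bool (\<not> 2 dvd (\<Sum>p<e + 1. of_bool (prime p \<and> p dvd e) :: nat)))"
proof (cases "e = 0")
  case True then show ?thesis by (simp add: moebius_def)
next
  case False
  have "squarefree e \<longleftrightarrow> (\<forall>x<e + 1. x * x dvd e \<longrightarrow> x = 1)"
  proof
    assume "squarefree e"
    then show "\<forall>x<e + 1. x * x dvd e \<longrightarrow> x = 1"
      by (simp add: squarefree_def power2_eq_square)
  next
    assume *: "\<forall>x<e + 1. x * x dvd e \<longrightarrow> x = 1"
    show "squarefree e"
    proof (rule squarefreeI)
      fix x assume x: "x ^ 2 dvd e"
      then have "x dvd e" by (metis dvd_mult_left power2_eq_square)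
      then have "x < e + 1" using False dvd_imp_le[of x e] by simp
      then show "is_unit x" using * x by (simp add: power2_eq_square)
    qed
  qed
  moreover have "(\<Sum>p<e + 1. of_bool (prime p \<and> p dvd e) :: nat) = card (prime_factors e)"
  proof -
    have "prime_factors e = {p. p < e + 1 \<and> prime p \<and> p dvd e}"
      using False dvd_imp_le[of _ e] by (auto simp: prime_factors_dvd less_Suc_eq_le)
    then show ?thesis by (simp add: Collect_conj_eq lessThan_def)
  qed
  ultimately show ?thesis using False by (simp add: moebius_def minus_one_power_iff)
qed

lemma comput_moebius:
  "comput (\<lambda>e m. int (f e m)) \<Longrightarrow> comput (\<lambda>e m. moebius (f e m))"
proof (erule comput_nat_bind1[where h = "\<lambda>x m. moebius x"])
  have "comput (\<lambda>e m. int 2)" by (rule comput_const)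
  then show "comput (\<lambda>e m. moebius (nat (e 0)))"
    unfolding moebius_altdef by (intro comput_intros comput_prime)
qed

abbreviation entries :: "(nat \<Rightarrow> int) \<Rightarrow> nat \<Rightarrow> nat" where
  "entries m \<equiv> \<lambda>k. nat (m k)"

lemma comput_pair_count:
  "comput (\<lambda>e m. int (f e m)) \<Longrightarrow> comput (\<lambda>e m. int (g e m)) \<Longrightarrow>
    comput (\<lambda>e m. pair_count (f e m) (entries m) (g e m))"
proof (erule (1) comput_nat_bind2[where h = "\<lambda>n d m. pair_count n (entries m) d"])
  show "comput (\<lambda>e m. pair_count (nat (e 0)) (entries m) (nat (e (Suc 0))))"
    unfolding pair_count_def by (intro comput_nat_sum comput_int_dvd comput_diff comput_nat_mem comput_nat_var)
qed

lemma comput_root_energy: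
  "comput (\<lambda>e m. int (f e m)) \<Longrightarrow> comput (\<lambda>e m. int (g e m)) \<Longrightarrow>
    comput (\<lambda>e m. root_energy (f e m) (entries m) (g e m))"
proof (erule (1) comput_nat_bind2[where h = "\<lambda>n M m. root_energy n (entries m) M"])
  show "comput (\<lambda>e m. root_energy (nat (e 0)) (entries m) (nat (e (Suc 0))))"
    unfolding root_energy_def
    by (intro comput_nat_sum comput_mult comput_nat_eq comput_moebius comput_pair_count comput_nat_var
        comput_nat_add comput_nat_mult comput_const)
qed

lemma comput_size_bound:
  "comput (\<lambda>e m. int (f e m)) \<Longrightarrow> comput (\<lambda>e m. int (size_bound (f e m) (entries m)))"
proof (erule comput_nat_bind1[where h = "\<lambda>n m. int (size_bound n (entries m))"])
  show "comput (\<lambda>e m. int (size_bound (nat (e 0)) (entries m)))"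
    unfolding size_bound_def of_nat_add of_nat_sum
    by (intro comput_add comput_nat_sum comput_nat_mem comput_nat_var)
qed

lemma comput_tests:
  "comput (\<lambda>e m. of_bool (T1_test (nat (e 0)) (entries m) \<and> T2_test (nat (e 0)) (entries m)))"
  unfolding T1_test_def T2_test_def
  by (intro comput_conj comput_all comput_imp comput_eq comput_nat_eq comput_nat_less comput_not
      comput_prime comput_power_of comput_root_energy comput_size_bound comput_dvd
      comput_nat_sum comput_nat_mult comput_nat_add comput_nat_var comput_const)

lemma presents_bounds:
  assumes A: "finite A" "A \<noteq> {}" and xs: "presents xs A"
  shows "length xs \<le> diam A + 1" "\<And>x. x \<in> set xs \<Longrightarrow> 0 \<le> x \<and> x \<le> int (diam A)"
proof -
  show b: "0 \<le> x \<and> x \<le> int (diam A)" if "x \<in> set xs" for x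
    using that xs A by (auto simp: presents_def normalized_def diam_def)
  have "length xs = card (set xs)" using xs distinct_card[of xs] by (simp add: presents_def)
  also have "\<dots> \<le> card {0..int (diam A)}" using b by (intro card_mono) auto
  finally show "length xs \<le> diam A + 1" by simp
qed

theorem tests_program:
  "\<exists>c q. \<forall>A xs. finite A \<longrightarrow> A \<noteq> {} \<longrightarrow> presents xs A \<longrightarrow>
     (\<exists>t. halts_with c xs t (if T1 A \<and> T2 A then 1 else 0) \<and> t \<le> poly q (diam A))"
proof -
  let ?f = "\<lambda>e m. of_bool (T1_test (nat (e 0)) (entries m) \<and> T2_test (nat (e 0)) (entries m)) :: int"
  obtain q where "\<And>\<rho> d. (\<And>i. \<rho> i < d) \<Longrightarrow> \<exists>c. computes c \<rho> d q ?f"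
    using comput_tests unfolding comput_def by blast
  \<comment> \<open>All variables share register 0, which holds the length of the list; outside its
    binders the formula uses variable 0 only. The result arrives in register 1.\<close>
  from this[of "\<lambda>_. 0" 1] obtain c where c: "computes c (\<lambda>_. 0) 1 q ?f" by auto
  \<comment> \<open>The answer is copied to register 0 at a cost of at most 4; composing with
    \<open>[:1, 1:]\<close> substitutes diam A + 1, which bounds the length of the list and its
    entries.\<close>
  let ?c = "Seq c (Seq (Const 0 0) (Add 0 0 1))"
  let ?q = "pcompose (q + 4) [:1, 1:]"
  have "\<exists>t. halts_with ?c xs t (if T1 A \<and> T2 A then 1 else 0) \<and> t \<le> poly ?q (diam A)"
    if A: "finite A" "A \<noteq> {}" and xs: "presents xs A" for A xs
  proof -
    define R :: "nat \<Rightarrow> int" where "R = (\<lambda>_. 0)(0 := int (length xs))"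
    define M where "M = (\<lambda>i. if i < length xs then xs ! i else 0)"
    define n where "n = length xs"
    note b = presents_bounds[OF A xs]
    have RB: "\<forall>i::nat. \<bar>R 0\<bar> \<le> int (diam A + 1)" using b(1) by (simp add: R_def)
    have MB: "\<forall>i. \<bar>M i\<bar> \<le> int (diam A + 1)"
    proof
      fix i show "\<bar>M i\<bar> \<le> int (diam A + 1)"
        using b(2)[of "xs ! i"] by (auto simp: M_def)
    qed
    interpret presented A xs n "entries M"
    proof
      fix k assume "k < n"
      then show "int (entries M k) = xs ! k" using b(2)[of "xs ! k"] by (simp add: M_def n_def)
    qed (use A xs n_def in auto)
    define v :: int where "v = of_bool (T1_test n (entries M) \<and> T2_test n (entries M))"
    \<comment> \<open>The second equivalence assumes T1, which is harmless in the
      conjunction.\<close>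
    have v: "v = (if T1 A \<and> T2 A then 1 else 0)"
      using T1_test_iff T2_test_iff unfolding v_def by auto
    have v': "?f (\<lambda>_. R 0) M = v" by (simp add: R_def v_def n_def)
    have "runs c (R, M) (poly q (diam A + 1)) (\<lambda>(R', M'). M' = M \<and> R' 1 = v \<and> (\<forall>r<1. R' r = R r))"
      using computesD(2)[where R = R and M = M and B = "diam A + 1", OF c RB MB] unfolding v' .
    moreover have "runs (Seq (Const 0 0) (Add 0 0 1)) \<tau> 4 (\<lambda>(R', M'). R' 0 = v)"
      if post: "case \<tau> of (R', M') \<Rightarrow> M' = M \<and> R' 1 = v \<and> (\<forall>r<1. R' r = R r)" for \<tau>
    proof -
      obtain R' where \<tau>: "\<tau> = (R', M)" "R' 1 = v" using post by (cases \<tau>) auto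
      have "runs (Seq (Const 0 0) (Add 0 0 1)) (R', M)
          (1 + nat \<bar>0\<bar> + (1 + nat \<bar>(R'(0 := 0)) 0\<bar> + nat \<bar>(R'(0 := 0)) 1\<bar>)) (\<lambda>(R', M'). R' 0 = v)"
        using \<tau> by (intro runs_Const_Seq runs_Add) simp
      then show ?thesis unfolding \<tau>(1) by (rule runs_mono) (use \<tau>(2) in \<open>auto simp: v\<close>)
    qed
    ultimately have "runs ?c (R, M) (poly q (diam A + 1) + 4) (\<lambda>(R', M'). R' 0 = v)"
      by (rule runs_Seq)
    then obtain t R' M' where t: "exec ?c (R, M) t (R', M')" "t \<le> poly q (diam A + 1) + 4" "R' 0 = v"
      unfolding runs_def by auto
    have "init xs = (R, M)" by (simp add: init_def R_def M_def)
    then have "halts_with ?c xs t v" unfolding halts_with_def using t by auto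
    moreover have "t \<le> poly ?q (diam A)" using t(2) by (simp add: poly_pcompose add.commute)
    ultimately show ?thesis unfolding v by blast
  qed
  then show ?thesis by blast
qed

theorem theorem2p1:
  shows "\<exists>c :: com.
    decides c {A. finite A \<and> A \<noteq> {}} (\<lambda>A. T1 A \<and> T2 A) \<and>
    (\<exists>q :: nat poly. runs_in_time c {A. finite A \<and> A \<noteq> {}} (\<lambda>A. poly q (diam A))) \<and>
    decides c {A. finite A \<and> A \<noteq> {} \<and> card (prime_factors (card A)) \<le> 2} tiles_int"
proof -
  obtain c q where c: "\<And>A xs. finite A \<Longrightarrow> A \<noteq> {} \<Longrightarrow> presents xs A \<Longrightarrow>
     \<exists>t. halts_with c xs t (if T1 A \<and> T2 A then 1 else 0) \<and> t \<le> poly q (diam A)"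
    using tests_program by blast
  have tiles: "(T1 A \<and> T2 A) = tiles_int A"
    if "finite A" "A \<noteq> {}" "card (prime_factors (card A)) \<le> 2" for A
    using that T1_T2_imp_tiles tiling_imp_T1 tiling_imp_T2 by blast
  have "decides c {A. finite A \<and> A \<noteq> {}} (\<lambda>A. T1 A \<and> T2 A)"
    unfolding decides_def using c by blast
  moreover have "runs_in_time c {A. finite A \<and> A \<noteq> {}} (\<lambda>A. poly q (diam A))"
    unfolding runs_in_time_def using c by blast
  moreover have "decides c {A. finite A \<and> A \<noteq> {} \<and> card (prime_factors (card A)) \<le> 2} tiles_int"
    unfolding decides_def
  proof (intro ballI allI impI)
    fix A xs assume A: "A \<in> {A. finite A \<and> A \<noteq> {} \<and> card (prime_factors (card A)) \<le> 2}" "presents xs A"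
    then have "\<exists>t. halts_with c xs t (if T1 A \<and> T2 A then 1 else 0)" using c by blast
    then show "\<exists>t. halts_with c xs t (if tiles_int A then 1 else 0)" using tiles A by simp
  qed
  ultimately show ?thesis by blast
qed

end
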